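(* Let $(\mathscr{C},\mathbb{E},\mathfrak{s})$ be a small extriangulated category and let $\mathcal{N}\subseteq\mathscr{C}$ be a biresolving thick subcategory. Let $\mathscr{S}_{\mathcal{N}}$ be the associated set of morphisms, and let $\overline{\mathscr{C}}$ and $\overline{\mathscr{S}_{\mathcal{N}}}$ be as in the context. Then $\overline{\mathscr{S}_{\mathcal{N}}}$ satisfies: (MR1) $\overline{\mathscr{S}_{\mathcal{N}}}$ satisfies 2-out-of-3 with respect to compositions in $\overline{\mathscr{C}}$; (MR2) $\overline{\mathscr{S}_{\mathcal{N}}}$ is a multiplicative system in $\overline{\mathscr{C}}$; (MR3) for any $\mathfrak{s}$-triangles $\langle A\xrightarrow{x}B\xrightarrow{y}C,\delta\rangle$, $\langle A'\xrightarrow{x'}B'\xrightarrow{y'}C',\delta'\rangle$ and any $a\in\mathscr{C}(A,A')$, $c\in\mathscr{C}(C,C')$ with $a_*\delta=c^*\delta'$, if $\overline{a},\overline{c}\in\overline{\mathscr{S}_{\mathcal{N}}}$, then there is $\mathbf{b}\in\overline{\mathscr{S}_{\mathcal{N}}}(B,B')$ with $\mathbf{b}\circ\overline{x}=\overline{x'}\circ\overline{a}$ and $\overline{c}\circ\overline{y}=\overline{y'}\circ\mathbf{b}$; (MR4) $\{\mathbf{v}\circ\overline{x}\circ\mathbf{u}\mid x\text{ an }\mathfrak{s}\text{-inflation},\ \mathbf{u},\mathbf{v}\in\overline{\mathscr{S}_{\mathcal{N}}}\}$ and $\{\mathbf{v}\circ\overline{y}\circ\mathbf{u}\mid y\text{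 an }\mathfrak{s}\text{-deflation},\ \mathbf{u},\mathbf{v}\in\overline{\mathscr{S}_{\mathcal{N}}}\}$ are closed under composition in $\overline{\mathscr{C}}$. Moreover, $$\overline{\mathscr{S}_{\mathcal{N}}}=\{\overline{x}\in\mathrm{Mor}(\overline{\mathscr{C}})\mid\overline{x}\text{ is both monomorphic and epimorphic}\}.$$
   Context: Extriangulated categories. Let $\mathscr{C}$ be an additive category and $\mathbb{E}\colon\mathscr{C}^{\mathrm{op}}\times\mathscr{C}\to\mathrm{Ab}$ a biadditive functor. For $\delta\in\mathbb{E}(C,A)$, $a\in\mathscr{C}(A,A')$, $c\in\mathscr{C}(C',C)$ write $a_*\delta=\mathbb{E}(C,a)(\delta)$, $c^*\delta=\mathbb{E}(c,A)(\delta)$. Sequences $A\xrightarrow{x}B\xrightarrow{y}C$ and $A\xrightarrow{x'}B'\xrightarrow{y'}C$ are equivalent if there is an isomorphism $b\colon B\to B'$ with $bx=x'$ and $y'b=y$; $[A\xrightarrow{x}B\xrightarrow{y}C]$ denotes the equivalence class. Let $\mathfrak{s}$ be a map assigning to each $\delta\in\mathbb{E}(C,A)$ an equivalence class $\mathfrak{s}(\delta)=[A\xrightarrow{x}B\xrightarrow{y}C]$. In this situation $A\xrightarrow{x}B\xrightarrow{y}C$ is an $\mathfrak{s}$-conflation, $x$ an $\mathfrak{s}$-inflation, $y$ an $\mathfrak{s}$-deflation, $C=\mathrm{Cone}(x)$, $A=\mathrm{CoCone}(y)$, and the pair $\langle A\xrightarrow{x}B\xrightarrow{y}C,\delta\rangle$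 is an $\mathfrak{s}$-triangle. A morphism of $\mathfrak{s}$-triangles from $\langle A\xrightarrow{x}B\xrightarrow{y}C,\delta\rangle$ to $\langle A'\xrightarrow{x'}B'\xrightarrow{y'}C',\delta'\rangle$ is a triple $(a,b,c)$ with $bx=x'a$, $cy=y'b$, $a_*\delta=c^*\delta'$. $(\mathscr{C},\mathbb{E},\mathfrak{s})$ is extriangulated if: (C1) for every $\mathfrak{s}$-triangle $\langle A\xrightarrow{x}B\xrightarrow{y}C,\delta\rangle$ and object $X$ the sequence $\mathscr{C}(X,A)\to\mathscr{C}(X,B)\to\mathscr{C}(X,C)\to\mathbb{E}(X,A)$ with maps $x\circ-$, $y\circ-$, $f\mapsto f^*\delta$ is exact; (C1') dually $\mathscr{C}(C,X)\to\mathscr{C}(B,X)\to\mathscr{C}(A,X)\to\mathbb{E}(C,X)$ with maps $-\circ y$, $-\circ x$, $g\mapsto g_*\delta$ is exact; (C2) $0\in\mathbb{E}(0,A)$ has $\mathfrak{s}(0)=[A\xrightarrow{\mathrm{id}}A\to0]$; (C2') $0\in\mathbb{E}(A,0)$ has $\mathfrak{s}(0)=[0\to A\xrightarrow{\mathrm{id}}A]$; (C3) for every $\mathfrak{s}$-triangle $\langle A\xrightarrow{x}B\xrightarrow{y}C,\delta\rangle$, every $a\in\mathscr{C}(A,A')$ and every $\mathfrak{s}$-triangle $\langle A'\xrightarrow{x'}B'\xrightarrow{y'}C,a_*\delta\rangle$ there is $b\colon B\to B'$ such that $(a,b,\mathrm{id}_C)$ is a morphism of $\mathfrak{s}$-triangles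 and $A\xrightarrow{\left[\begin{smallmatrix}x\\ a\end{smallmatrix}\right]}B\oplus A'\xrightarrow{[b\ -x']}B'$ with $y'^*\delta$ is an $\mathfrak{s}$-triangle; (C3') for every $\mathfrak{s}$-triangle $\langle A\xrightarrow{x}B\xrightarrow{y}C,\delta\rangle$, every $c\in\mathscr{C}(C',C)$ and every $\mathfrak{s}$-triangle $\langle A\xrightarrow{x'}B'\xrightarrow{y'}C',c^*\delta\rangle$ there is $b\colon B'\to B$ such that $(\mathrm{id}_A,b,c)$ is a morphism of $\mathfrak{s}$-triangles and $B'\xrightarrow{\left[\begin{smallmatrix}-y'\\ b\end{smallmatrix}\right]}C'\oplus B\xrightarrow{[c\ y]}C$ with $x'_*\delta$ is an $\mathfrak{s}$-triangle; (C4) $\mathfrak{s}$-inflations are closed under composition; (C4') $\mathfrak{s}$-deflations are closed under composition. Thick and biresolving subcategories. A full additive subcategory $\mathcal{N}\subseteq\mathscr{C}$ is thick if it is closed under isomorphisms and direct summands, and whenever two of $A,B,C$ in an $\mathfrak{s}$-conflation $A\to B\to C$ lie in $\mathcal{N}$, so does the third. A thick $\mathcal{N}$ is biresolving if for any $C\in\mathscr{C}$ there exist an $\mathfrak{s}$-inflation $C\to N$ and an $\mathfrak{s}$-deflation $N'\to C$ with $N,N'\in\mathcal{N}$. For thick $\mathcal{N}$, $\mathcal{L}$ is the set of $\mathfrak{s}$-inflations $f$ with $\mathrm{Cone}(f)\in\mathcal{N}$, $\mathcal{R}$ is the set of $\mathfrak{s}$-deflations $f$ with $\mathrm{CoCone}(f)\in\mathcal{N}$,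 and $\mathscr{S}_{\mathcal{N}}$ is the smallest set of morphisms closed under composition containing $\mathcal{L}$ and $\mathcal{R}$. For $\mathscr{S}=\mathscr{S}_{\mathcal{N}}$, let $\mathcal{N}_{\mathscr{S}}$ be the full subcategory of objects $N$ with $N\to0$ and $0\to N$ in $\mathscr{S}$ (here $\mathcal{N}_{\mathscr{S}}=\mathcal{N}$), let $p\colon\mathscr{C}\to\overline{\mathscr{C}}=\mathscr{C}/[\mathcal{N}_{\mathscr{S}}]$ be the ideal quotient by morphisms factoring through objects of $\mathcal{N}_{\mathscr{S}}$, $\overline{f}=p(f)$, and $\overline{\mathscr{S}}$ the set of morphisms $\beta\circ p(s)\circ\alpha$ with $s\in\mathscr{S}$ and $\alpha,\beta$ isomorphisms of $\overline{\mathscr{C}}$. A multiplicative system is a set $W$ of morphisms containing identities, closed under composition, such that every $X'\xleftarrow{s}X\xrightarrow{f}Y$ with $s\in W$ can be completed to a commutative square $s'f=f's$ with $s'\in W$, and dually; and for parallel $f,g$: $fs=gs$ for some $s\in W$ if and only if $tf=tg$ for some $t\in W$. *)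

theory Defs
  imports "HOL-Algebra.Coset"
begin

section \<open>Categories\<close>

record ('o, 'm) category =
  Obj :: "'o set"
  Arr :: "'m set"
  Dom :: "'m \<Rightarrow> 'o"
  Cod :: "'m \<Rightarrow> 'o"
  Id :: "'o \<Rightarrow> 'm"
  Comp :: "'m \<Rightarrow> 'm \<Rightarrow> 'm"  (infixl "\<cdot>\<index>" 70)

definition Mor :: "('o, 'm, 'x) category_scheme \<Rightarrow> 'o \<Rightarrow> 'o \<Rightarrow> 'm set" where
  "Mor K A B = {f \<in> Arr K. Dom K f = A \<and> Cod K f = B}"

locale category =
  fixes K :: "('o, 'm, 'x) category_scheme" (structure)
  assumes Dom_Obj: "f \<in> Arr K \<Longrightarrow> Dom K f \<in> Obj K"
    and Cod_Obj: "f \<in> Arr K \<Longrightarrow> Cod K f \<in> Obj K"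
    and Id_Mor: "A \<in> Obj K \<Longrightarrow> Id K A \<in> Mor K A A"
    and Comp_Mor: "f \<in> Mor K A B \<Longrightarrow> g \<in> Mor K B C \<Longrightarrow> g \<cdot> f \<in> Mor K A C"
    and Comp_Id: "f \<in> Mor K A B \<Longrightarrow> f \<cdot> Id K A = f"
    and Id_Comp: "f \<in> Mor K A B \<Longrightarrow> Id K B \<cdot> f = f"
    and Comp_assoc: "f \<in> Mor K A B \<Longrightarrow> g \<in> Mor K B C \<Longrightarrow> h \<in> Mor K C D \<Longrightarrow>
      (h \<cdot> g) \<cdot> f = h \<cdot> (g \<cdot> f)"

definition is_iso :: "('o, 'm, 'x) category_scheme \<Rightarrow> 'm \<Rightarrow> bool" where
  "is_iso K f \<longleftrightarrow> f \<in> Arr K \<and>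
    (\<exists>g \<in> Mor K (Cod K f) (Dom K f).
      g \<cdot>\<^bsub>K\<^esub> f = Id K (Dom K f) \<and> f \<cdot>\<^bsub>K\<^esub> g = Id K (Cod K f))"

definition is_mono :: "('o, 'm, 'x) category_scheme \<Rightarrow> 'm \<Rightarrow> bool" where
  "is_mono K f \<longleftrightarrow> f \<in> Arr K \<and>
    (\<forall>X \<in> Obj K. \<forall>g \<in> Mor K X (Dom K f). \<forall>h \<in> Mor K X (Dom K f).
      f \<cdot>\<^bsub>K\<^esub> g = f \<cdot>\<^bsub>K\<^esub> h \<longrightarrow> g = h)"

definition is_epi :: "('o, 'm, 'x) category_scheme \<Rightarrow> 'm \<Rightarrow> bool" where
  "is_epi K f \<longleftrightarrow> f \<in> Arr K \<and>
    (\<forall>X \<in> Obj K. \<forall>g \<in> Mor K (Cod K f) X. \<forall>h \<in> Mor K (Cod K f) X.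
      g \<cdot>\<^bsub>K\<^esub> f = h \<cdot>\<^bsub>K\<^esub> f \<longrightarrow> g = h)"

definition closed_under_comp :: "('o, 'm, 'x) category_scheme \<Rightarrow> 'm set \<Rightarrow> bool" where
  "closed_under_comp K W \<longleftrightarrow>
    (\<forall>f \<in> W. \<forall>g \<in> W. Cod K f = Dom K g \<longrightarrow> g \<cdot>\<^bsub>K\<^esub> f \<in> W)"

definition two_out_of_three :: "('o, 'm, 'x) category_scheme \<Rightarrow> 'm set \<Rightarrow> bool" where
  "two_out_of_three K W \<longleftrightarrow>
    (\<forall>f \<in> Arr K. \<forall>g \<in> Arr K. Cod K f = Dom K g \<longrightarrow>
      (f \<in> W \<and> g \<in> W \<longrightarrow> g \<cdot>\<^bsub>K\<^esub> f \<in> W) \<and>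
      (f \<in> W \<and> g \<cdot>\<^bsub>K\<^esub> f \<in> W \<longrightarrow> g \<in> W) \<and>
      (g \<in> W \<and> g \<cdot>\<^bsub>K\<^esub> f \<in> W \<longrightarrow> f \<in> W))"

definition multiplicative_system :: "('o, 'm, 'x) category_scheme \<Rightarrow> 'm set \<Rightarrow> bool" where
  "multiplicative_system K W \<longleftrightarrow>
    W \<subseteq> Arr K \<and>
    (\<forall>A \<in> Obj K. Id K A \<in> W) \<and>
    closed_under_comp K W \<and>
    (\<forall>s \<in> W. \<forall>f \<in> Arr K. Dom K s = Dom K f \<longrightarrow>
      (\<exists>Z \<in> Obj K. \<exists>s' \<in> W \<inter> Mor K (Cod K f) Z. \<exists>f' \<in> Mor K (Cod K s) Z.
        s' \<cdot>\<^bsub>K\<^esub> f = f' \<cdot>\<^bsub>K\<^esub> s)) \<and>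
    (\<forall>s \<in> W. \<forall>f \<in> Arr K. Cod K s = Cod K f \<longrightarrow>
      (\<exists>Z \<in> Obj K. \<exists>s' \<in> W \<inter> Mor K Z (Dom K f). \<exists>f' \<in> Mor K Z (Dom K s).
        f \<cdot>\<^bsub>K\<^esub> s' = s \<cdot>\<^bsub>K\<^esub> f')) \<and>
    (\<forall>A \<in> Obj K. \<forall>B \<in> Obj K. \<forall>f \<in> Mor K A B. \<forall>g \<in> Mor K A B.
      (\<exists>s \<in> W. Cod K s = A \<and> f \<cdot>\<^bsub>K\<^esub> s = g \<cdot>\<^bsub>K\<^esub> s) \<longleftrightarrow>
      (\<exists>t \<in> W. Dom K t = B \<and> t \<cdot>\<^bsub>K\<^esub> f = t \<cdot>\<^bsub>K\<^esub> g))"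


section \<open>Additive categories\<close>

record ('o, 'm) preadditive_category = "('o, 'm) category" +
  Add :: "'m \<Rightarrow> 'm \<Rightarrow> 'm"  (infixl "\<boxplus>\<index>" 65)
  Zero :: "'o \<Rightarrow> 'o \<Rightarrow> 'm"

text \<open>
  Abelian groups are those of \<^theory>\<open>HOL-Algebra.Group\<close>, which are written multiplicatively:
  the neutral element of \<open>hom_group K A B\<close> is the zero morphism, and \<open>m_inv\<close> is negation.
\<close>

definition hom_group ::
    "('o, 'm, 'x) preadditive_category_scheme \<Rightarrow> 'o \<Rightarrow> 'o \<Rightarrow> 'm monoid" where
  "hom_group K A B = \<lparr>carrier = Mor K A B, monoid.mult = Add K, one = Zero K A B\<rparr>"

definition neg :: "('o, 'm, 'x) preadditive_category_scheme \<Rightarrow> 'm \<Rightarrow> 'm" where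
  "neg K f = m_inv (hom_group K (Dom K f) (Cod K f)) f"

locale preadditive_category = category K
  for K :: "('o, 'm, 'x) preadditive_category_scheme" (structure) +
  assumes hom_comm_group: "A \<in> Obj K \<Longrightarrow> B \<in> Obj K \<Longrightarrow> comm_group (hom_group K A B)"
    and Comp_Add: "f \<in> Mor K A B \<Longrightarrow> f' \<in> Mor K A B \<Longrightarrow> g \<in> Mor K B C \<Longrightarrow>
      g \<cdot> (f \<boxplus> f') = g \<cdot> f \<boxplus> g \<cdot> f'"
    and Add_Comp: "f \<in> Mor K A B \<Longrightarrow> g \<in> Mor K B C \<Longrightarrow> g' \<in> Mor K B C \<Longrightarrow>
      (g \<boxplus> g') \<cdot> f = g \<cdot> f \<boxplus> g' \<cdot> f"

definition zero_object :: "('o, 'm, 'x) category_scheme \<Rightarrow> 'o \<Rightarrow> bool" where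
  "zero_object K Z \<longleftrightarrow> Z \<in> Obj K \<and>
    (\<forall>X \<in> Obj K. (\<exists>!f. f \<in> Mor K X Z) \<and> (\<exists>!f. f \<in> Mor K Z X))"

definition biproduct :: "('o, 'm, 'x) preadditive_category_scheme \<Rightarrow>
    'o \<Rightarrow> 'o \<Rightarrow> 'o \<Rightarrow> 'm \<Rightarrow> 'm \<Rightarrow> 'm \<Rightarrow> 'm \<Rightarrow> bool" where
  "biproduct K A B P i j p q \<longleftrightarrow> A \<in> Obj K \<and> B \<in> Obj K \<and> P \<in> Obj K \<and>
    i \<in> Mor K A P \<and> j \<in> Mor K B P \<and> p \<in> Mor K P A \<and> q \<in> Mor K P B \<and>
    p \<cdot>\<^bsub>K\<^esub> i = Id K A \<and> q \<cdot>\<^bsub>K\<^esub> j = Id K B \<and>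
    q \<cdot>\<^bsub>K\<^esub> i = Zero K A B \<and> p \<cdot>\<^bsub>K\<^esub> j = Zero K B A \<and>
    i \<cdot>\<^bsub>K\<^esub> p \<boxplus>\<^bsub>K\<^esub> j \<cdot>\<^bsub>K\<^esub> q = Id K P"

locale additive_category = preadditive_category K
  for K :: "('o, 'm, 'x) preadditive_category_scheme" (structure) +
  assumes ex_zero_object: "\<exists>Z. zero_object K Z"
    and ex_biproduct: "A \<in> Obj K \<Longrightarrow> B \<in> Obj K \<Longrightarrow> \<exists>P i j p q. biproduct K A B P i j p q"


section \<open>Extriangulated categories\<close>

text \<open>
  \<open>Ext K C A\<close> is the group $E(C,A)$, and \<open>EMap K c a\<close> is the map
  $E(c,a) : E(C,A) \to E(C',A')$ induced by $c : C' \to C$ and $a : A \to A'$.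
  \<open>Realize K C A \<delta>\<close> is the class of sequences $A \to B \to C$
  assigned to $\delta \in E(C,A)$; a sequence is the pair of its two morphisms.
\<close>

record ('o, 'm, 'e) extri_category = "('o, 'm) preadditive_category" +
  Ext :: "'o \<Rightarrow> 'o \<Rightarrow> 'e monoid"
  EMap :: "'m \<Rightarrow> 'm \<Rightarrow> 'e \<Rightarrow> 'e"
  Realize :: "'o \<Rightarrow> 'o \<Rightarrow> 'e \<Rightarrow> ('m \<times> 'm) set"

definition push :: "('o, 'm, 'e, 'x) extri_category_scheme \<Rightarrow> 'o \<Rightarrow> 'm \<Rightarrow> 'e \<Rightarrow> 'e" where
  "push K C a \<delta> = EMap K (Id K C) a \<delta>"

definition pull :: "('o, 'm, 'e, 'x) extri_category_scheme \<Rightarrow> 'm \<Rightarrow> 'o \<Rightarrow> 'e \<Rightarrow> 'e" where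
  "pull K c A \<delta> = EMap K c (Id K A) \<delta>"

definition sequences :: "('o, 'm, 'x) category_scheme \<Rightarrow> 'o \<Rightarrow> 'o \<Rightarrow> ('m \<times> 'm) set" where
  "sequences K A C = {(x, y). \<exists>B \<in> Obj K. x \<in> Mor K A B \<and> y \<in> Mor K B C}"

definition seq_class :: "('o, 'm, 'x) category_scheme \<Rightarrow> 'm \<Rightarrow> 'm \<Rightarrow> ('m \<times> 'm) set" where
  "seq_class K x y = {(x', y') \<in> sequences K (Dom K x) (Cod K y).
    \<exists>b \<in> Mor K (Cod K x) (Cod K x'). is_iso K b \<and> b \<cdot>\<^bsub>K\<^esub> x = x' \<and> y' \<cdot>\<^bsub>K\<^esub> b = y}"

definition s_triangle ::
    "('o, 'm, 'e, 'x) extri_category_scheme \<Rightarrow> 'm \<Rightarrow> 'm \<Rightarrow> 'e \<Rightarrow> bool" where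
  "s_triangle K x y \<delta> \<longleftrightarrow> x \<in> Arr K \<and> y \<in> Arr K \<and> Cod K x = Dom K y \<and>
    \<delta> \<in> carrier (Ext K (Cod K y) (Dom K x)) \<and>
    Realize K (Cod K y) (Dom K x) \<delta> = seq_class K x y"

definition s_conflation :: "('o, 'm, 'e, 'x) extri_category_scheme \<Rightarrow> 'm \<Rightarrow> 'm \<Rightarrow> bool" where
  "s_conflation K x y \<longleftrightarrow> (\<exists>\<delta>. s_triangle K x y \<delta>)"

definition s_inflation :: "('o, 'm, 'e, 'x) extri_category_scheme \<Rightarrow> 'm \<Rightarrow> bool" where
  "s_inflation K x \<longleftrightarrow> (\<exists>y. s_conflation K x y)"

definition s_deflation :: "('o, 'm, 'e, 'x) extri_category_scheme \<Rightarrow> 'm \<Rightarrow> bool" where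
  "s_deflation K y \<longleftrightarrow> (\<exists>x. s_conflation K x y)"

definition s_triangle_morphism :: "('o, 'm, 'e, 'x) extri_category_scheme \<Rightarrow>
    'm \<times> 'm \<times> 'e \<Rightarrow> 'm \<times> 'm \<times> 'e \<Rightarrow> 'm \<Rightarrow> 'm \<Rightarrow> 'm \<Rightarrow> bool" where
  "s_triangle_morphism K = (\<lambda>(x, y, \<delta>) (x', y', \<delta>') a b c.
    a \<in> Mor K (Dom K x) (Dom K x') \<and> b \<in> Mor K (Cod K x) (Cod K x') \<and>
    c \<in> Mor K (Cod K y) (Cod K y') \<and>
    b \<cdot>\<^bsub>K\<^esub> x = x' \<cdot>\<^bsub>K\<^esub> a \<and> c \<cdot>\<^bsub>K\<^esub> y = y' \<cdot>\<^bsub>K\<^esub> b \<and>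
    push K (Cod K y) a \<delta> = pull K c (Dom K x') \<delta>')"

text \<open>
  The axioms below quantify over all zero objects and over all biproducts of the two given
  objects, instead of fixing choices of \<open>0\<close> and \<open>\<oplus>\<close>. This does not strengthen them:
  (C1) and (C1') give (C2) and (C2') for every zero object, and \<open>Realize\<close> takes values in
  classes of sequences up to isomorphism of the middle term.
\<close>

locale extriangulated_category = additive_category K
  for K :: "('o, 'm, 'e, 'x) extri_category_scheme" (structure) +
  assumes Ext_comm_group: "C \<in> Obj K \<Longrightarrow> A \<in> Obj K \<Longrightarrow> comm_group (Ext K C A)"
    and EMap_hom: "c \<in> Mor K C' C \<Longrightarrow> a \<in> Mor K A A' \<Longrightarrow>
      EMap K c a \<in> hom (Ext K C A) (Ext K C' A')"
    and EMap_Id: "C \<in> Obj K \<Longrightarrow> A \<in> Obj K \<Longrightarrow> \<delta> \<in> carrier (Ext K C A) \<Longrightarrow>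
      EMap K (Id K C) (Id K A) \<delta> = \<delta>"
    and EMap_Comp: "c \<in> Mor K C' C \<Longrightarrow> c' \<in> Mor K C'' C' \<Longrightarrow>
      a \<in> Mor K A A' \<Longrightarrow> a' \<in> Mor K A' A'' \<Longrightarrow> \<delta> \<in> carrier (Ext K C A) \<Longrightarrow>
      EMap K (c \<cdot> c') (a' \<cdot> a) \<delta> = EMap K c' a' (EMap K c a \<delta>)"
    and EMap_Add_left: "c\<^sub>1 \<in> Mor K C' C \<Longrightarrow> c\<^sub>2 \<in> Mor K C' C \<Longrightarrow> a \<in> Mor K A A' \<Longrightarrow>
      \<delta> \<in> carrier (Ext K C A) \<Longrightarrow>
      EMap K (c\<^sub>1 \<boxplus> c\<^sub>2) a \<delta> = EMap K c\<^sub>1 a \<delta> \<otimes>\<^bsub>Ext K C' A'\<^esub> EMap K c\<^sub>2 a \<delta>"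
    and EMap_Add_right: "c \<in> Mor K C' C \<Longrightarrow> a\<^sub>1 \<in> Mor K A A' \<Longrightarrow> a\<^sub>2 \<in> Mor K A A' \<Longrightarrow>
      \<delta> \<in> carrier (Ext K C A) \<Longrightarrow>
      EMap K c (a\<^sub>1 \<boxplus> a\<^sub>2) \<delta> = EMap K c a\<^sub>1 \<delta> \<otimes>\<^bsub>Ext K C' A'\<^esub> EMap K c a\<^sub>2 \<delta>"
    and Realize_class: "C \<in> Obj K \<Longrightarrow> A \<in> Obj K \<Longrightarrow> \<delta> \<in> carrier (Ext K C A) \<Longrightarrow>
      \<exists>(x, y) \<in> sequences K A C. Realize K C A \<delta> = seq_class K x y"
    and C1: "s_triangle K x y \<delta> \<Longrightarrow> x \<in> Mor K A B \<Longrightarrow> y \<in> Mor K B C \<Longrightarrow> X \<in> Obj K \<Longrightarrow>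
      (\<lambda>f. x \<cdot> f) ` Mor K X A = kernel (hom_group K X B) (hom_group K X C) (\<lambda>g. y \<cdot> g) \<and>
      (\<lambda>g. y \<cdot> g) ` Mor K X B = kernel (hom_group K X C) (Ext K X A) (\<lambda>f. pull K f A \<delta>)"
    and C1': "s_triangle K x y \<delta> \<Longrightarrow> x \<in> Mor K A B \<Longrightarrow> y \<in> Mor K B C \<Longrightarrow> X \<in> Obj K \<Longrightarrow>
      (\<lambda>f. f \<cdot> y) ` Mor K C X = kernel (hom_group K B X) (hom_group K A X) (\<lambda>g. g \<cdot> x) \<and>
      (\<lambda>g. g \<cdot> x) ` Mor K B X = kernel (hom_group K A X) (Ext K C X) (\<lambda>g. push K C g \<delta>)"
    and C2: "zero_object K Z \<Longrightarrow> A \<in> Obj K \<Longrightarrow>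
      Realize K Z A \<one>\<^bsub>Ext K Z A\<^esub> = seq_class K (Id K A) (Zero K A Z)"
    and C2': "zero_object K Z \<Longrightarrow> A \<in> Obj K \<Longrightarrow>
      Realize K A Z \<one>\<^bsub>Ext K A Z\<^esub> = seq_class K (Zero K Z A) (Id K A)"
    and C3: "s_triangle K x y \<delta> \<Longrightarrow> x \<in> Mor K A B \<Longrightarrow> y \<in> Mor K B C \<Longrightarrow>
      a \<in> Mor K A A' \<Longrightarrow>
      s_triangle K x' y' (push K C a \<delta>) \<Longrightarrow> x' \<in> Mor K A' B' \<Longrightarrow> y' \<in> Mor K B' C \<Longrightarrow>
      \<exists>b. s_triangle_morphism K (x, y, \<delta>) (x', y', push K C a \<delta>) a b (Id K C) \<and>
        (\<forall>P i j p q. biproduct K B A' P i j p q \<longrightarrow>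
          s_triangle K (i \<cdot> x \<boxplus> j \<cdot> a) (b \<cdot> p \<boxplus> neg K x' \<cdot> q) (pull K y' A \<delta>))"
    and C3': "s_triangle K x y \<delta> \<Longrightarrow> x \<in> Mor K A B \<Longrightarrow> y \<in> Mor K B C \<Longrightarrow>
      c \<in> Mor K C' C \<Longrightarrow>
      s_triangle K x' y' (pull K c A \<delta>) \<Longrightarrow> x' \<in> Mor K A B' \<Longrightarrow> y' \<in> Mor K B' C' \<Longrightarrow>
      \<exists>b. s_triangle_morphism K (x', y', pull K c A \<delta>) (x, y, \<delta>) (Id K A) b c \<and>
        (\<forall>P i j p q. biproduct K C' B P i j p q \<longrightarrow>
          s_triangle K (i \<cdot> neg K y' \<boxplus> j \<cdot> b) (c \<cdot> p \<boxplus> y \<cdot> q) (push K C x' \<delta>))"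
    and C4: "closed_under_comp K {x. s_inflation K x}"
    and C4': "closed_under_comp K {y. s_deflation K y}"


section \<open>Thick and biresolving subcategories\<close>

text \<open>A full subcategory is given by its set of objects.\<close>

definition additive_subcategory ::
    "('o, 'm, 'x) preadditive_category_scheme \<Rightarrow> 'o set \<Rightarrow> bool" where
  "additive_subcategory K N \<longleftrightarrow> N \<subseteq> Obj K \<and> (\<exists>Z \<in> N. zero_object K Z) \<and>
    (\<forall>A \<in> N. \<forall>B \<in> N. \<exists>P \<in> N. \<exists>i j p q. biproduct K A B P i j p q)"

definition thick :: "('o, 'm, 'e, 'x) extri_category_scheme \<Rightarrow> 'o set \<Rightarrow> bool" where
  "thick K N \<longleftrightarrow> additive_subcategory K N \<and>
    (\<forall>f. is_iso K f \<and> Dom K f \<in> N \<longrightarrow> Cod K f \<in> N) \<and>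
    (\<forall>A B P i j p q. biproduct K A B P i j p q \<and> P \<in> N \<longrightarrow> A \<in> N \<and> B \<in> N) \<and>
    (\<forall>x y A B C. s_conflation K x y \<and> x \<in> Mor K A B \<and> y \<in> Mor K B C \<longrightarrow>
      (A \<in> N \<and> B \<in> N \<longrightarrow> C \<in> N) \<and> (A \<in> N \<and> C \<in> N \<longrightarrow> B \<in> N) \<and>
      (B \<in> N \<and> C \<in> N \<longrightarrow> A \<in> N))"

definition biresolving :: "('o, 'm, 'e, 'x) extri_category_scheme \<Rightarrow> 'o set \<Rightarrow> bool" where
  "biresolving K N \<longleftrightarrow> thick K N \<and>
    (\<forall>C \<in> Obj K. (\<exists>M \<in> N. \<exists>x \<in> Mor K C M. s_inflation K x) \<and>
      (\<exists>M \<in> N. \<exists>y \<in> Mor K M C. s_deflation K y))"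

definition inflations_cone_in ::
    "('o, 'm, 'e, 'x) extri_category_scheme \<Rightarrow> 'o set \<Rightarrow> 'm set" where
  "inflations_cone_in K N = {x. \<exists>y. s_conflation K x y \<and> Cod K y \<in> N}"

definition deflations_cocone_in ::
    "('o, 'm, 'e, 'x) extri_category_scheme \<Rightarrow> 'o set \<Rightarrow> 'm set" where
  "deflations_cocone_in K N = {y. \<exists>x. s_conflation K x y \<and> Dom K x \<in> N}"

inductive_set thick_morphisms ::
    "('o, 'm, 'e, 'x) extri_category_scheme \<Rightarrow> 'o set \<Rightarrow> 'm set"
  for K :: "('o, 'm, 'e, 'x) extri_category_scheme" and N :: "'o set" where
  inflation: "f \<in> inflations_cone_in K N \<Longrightarrow> f \<in> thick_morphisms K N"
| deflation: "f \<in> deflations_cocone_in K N \<Longrightarrow> f \<in> thick_morphisms K N"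
| comp: "f \<in> thick_morphisms K N \<Longrightarrow> g \<in> thick_morphisms K N \<Longrightarrow> Cod K f = Dom K g \<Longrightarrow>
    g \<cdot>\<^bsub>K\<^esub> f \<in> thick_morphisms K N"


section \<open>Ideal quotients\<close>

definition null_objects ::
    "('o, 'm, 'x) preadditive_category_scheme \<Rightarrow> 'm set \<Rightarrow> 'o set" where
  "null_objects K S = {X \<in> Obj K. \<forall>Z. zero_object K Z \<longrightarrow> Zero K X Z \<in> S \<and> Zero K Z X \<in> S}"

definition factoring ::
    "('o, 'm, 'x) preadditive_category_scheme \<Rightarrow> 'o set \<Rightarrow> 'o \<Rightarrow> 'o \<Rightarrow> 'm set" where
  "factoring K N A B = {v \<cdot>\<^bsub>K\<^esub> u | u v. \<exists>X \<in> N. u \<in> Mor K A X \<and> v \<in> Mor K X B}"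

definition proj ::
    "('o, 'm, 'x) preadditive_category_scheme \<Rightarrow> 'o set \<Rightarrow> 'm \<Rightarrow> 'm set" where
  "proj K N f =
    factoring K N (Dom K f) (Cod K f) #>\<^bsub>hom_group K (Dom K f) (Cod K f)\<^esub> f"

text \<open>
  A morphism of the quotient is a coset. All its elements are parallel, and its domain and
  codomain are theirs.
\<close>

definition ideal_quotient ::
    "('o, 'm, 'x) preadditive_category_scheme \<Rightarrow> 'o set \<Rightarrow> ('o, 'm set) category" where
  "ideal_quotient K N = \<lparr>
    Obj = Obj K,
    Arr = proj K N ` Arr K,
    Dom = (\<lambda>F. the_elem (Dom K ` F)),
    Cod = (\<lambda>F. the_elem (Cod K ` F)),
    Id = (\<lambda>A. proj K N (Id K A)),
    Comp = (\<lambda>G F. \<Union>g \<in> G. \<Union>f \<in> F. proj K N (g \<cdot>\<^bsub>K\<^esub> f))\<rparr>"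

definition bar_category ::
    "('o, 'm, 'x) preadditive_category_scheme \<Rightarrow> 'm set \<Rightarrow> ('o, 'm set) category" where
  "bar_category K S = ideal_quotient K (null_objects K S)"

definition bar ::
    "('o, 'm, 'x) preadditive_category_scheme \<Rightarrow> 'm set \<Rightarrow> 'm \<Rightarrow> 'm set" where
  "bar K S f = proj K (null_objects K S) f"

definition bar_morphisms ::
    "('o, 'm, 'x) preadditive_category_scheme \<Rightarrow> 'm set \<Rightarrow> 'm set set" where
  "bar_morphisms K S =
    {\<beta> \<cdot>\<^bsub>bar_category K S\<^esub> bar K S s \<cdot>\<^bsub>bar_category K S\<^esub> \<alpha> | \<beta> s \<alpha>.
      s \<in> S \<and> is_iso (bar_category K S) \<alpha> \<and> is_iso (bar_category K S) \<beta> \<and>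
      Cod (bar_category K S) \<alpha> = Dom K s \<and> Cod K s = Dom (bar_category K S) \<beta>}"

definition sandwich :: "('o, 'm, 'x) category_scheme \<Rightarrow> 'm set \<Rightarrow> 'm set \<Rightarrow> 'm set" where
  "sandwich K W T = {v \<cdot>\<^bsub>K\<^esub> t \<cdot>\<^bsub>K\<^esub> u | v t u.
    u \<in> W \<and> v \<in> W \<and> t \<in> T \<and> Cod K u = Dom K t \<and> Cod K t = Dom K v}"

end

theory Submission
  imports Defs
begin

text \<open>
  Call a morphism null if it factors through an object of \<open>N\<close>, and call \<open>f\<close> a weak
  equivalence (\<open>weq f\<close>) if it is monic and epic modulo null morphisms, that is, if its class is
  monic and epic in the ideal quotient. All parts of the theorem follow from the last one, which
  identifies the class \<open>W\<close> with these morphisms.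

  Let \<open>l : A \<rightarrow> B\<close> be an inflation with cone in \<open>N\<close>. If \<open>g l\<close> factors as
  \<open>A \<rightarrow> M \<rightarrow> X\<close>, then \<open>g\<close> factors through the pushout of \<open>l\<close> along
  \<open>A \<rightarrow> M\<close>, whose object lies in \<open>N\<close> because it is an extension of two objects of
  \<open>N\<close>. So \<open>l\<close> is epic modulo null morphisms, and dually deflations with cocone in \<open>N\<close> are
  monic. As there are enough deflations \<open>d : M \<rightarrow> B\<close> from \<open>N\<close>, the inflation \<open>l\<close> is
  the composite of the inclusion \<open>A \<rightarrow> A \<oplus> M\<close>, invertible in the quotient, and of
  \<open>[l d] : A \<oplus> M \<rightarrow> B\<close>, a deflation with cocone in \<open>N\<close>
  (\<open>inflation_factor\<close>). Hence \<open>l\<close> is monic as well, and all morphisms generated by such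
  inflations and deflations are weak equivalences.

  Conversely let \<open>f : A \<rightarrow> B\<close> be a weak equivalence. For an inflation
  \<open>e : A \<rightarrow> M\<close> with \<open>M\<close> in \<open>N\<close>, the morphism \<open>x = [f; e]\<close> into
  \<open>B \<oplus> M\<close> is an inflation, and it has the same class as \<open>f\<close> up to an isomorphism of the
  quotient. The core of the proof, \<open>cone_in_N\<close>, is that its cone \<open>C\<close> lies in \<open>N\<close>. In a
  triangulated category one would argue that \<open>y : B \<rightarrow> C\<close> vanishes because \<open>x\<close> is epic
  and \<open>y x = 0\<close>, that \<open>C[-1] \<rightarrow> A\<close> vanishes because \<open>x\<close> is monic, and that therefore
  \<open>C = 0\<close>. Here \<open>C[-1]\<close> is replaced by the cocone of a deflation from \<open>N\<close> to \<open>C\<close>.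

  The Ore conditions hold because inflations with cone in \<open>N\<close> can be pushed out. Two out of
  three follows from the Ore conditions and cancellation. A morphism of triangles whose outer
  components are weak equivalences factors into one with identical right ends and one with identical
  left ends; in the first case, after enlarging the target by an object of \<open>N\<close>, the middle
  component is a pushout of an inflation with cone in \<open>N\<close> (\<open>weq_push\<close>). Finally every
  morphism is an inflation followed by a weak equivalence, and a weak equivalence followed by a
  deflation, so the inflations and the deflations, composed with \<open>W\<close> on both sides, each yield all
  morphisms of the quotient.

  The axioms give exact sequences up to \<open>E(X,A)\<close>, but not exactness there. That exactness is
  \<open>push_one_imp_pull\<close>, and it implies that a morphism has only one cone up to isomorphism
  (\<open>cone_unique\<close>). Dual statements are obtained from the opposite extriangulated category.
\<close>

section \<open>Calculus in preadditive categories\<close>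

lemma Mor_iff: "f \<in> Mor K A B \<longleftrightarrow> f \<in> Arr K \<and> Dom K f = A \<and> Cod K f = B"
  by (simp add: Mor_def)

context category
begin

lemma Obj_of_Arr [simp]: "f \<in> Arr K \<Longrightarrow> Dom K f \<in> Obj K" "f \<in> Arr K \<Longrightarrow> Cod K f \<in> Obj K"
  by (simp_all add: Dom_Obj Cod_Obj)

lemma Arr_Comp [simp]:
  assumes "f \<in> Arr K" "g \<in> Arr K" "Cod K f = Dom K g"
  shows "g \<cdot> f \<in> Arr K" "Dom K (g \<cdot> f) = Dom K f" "Cod K (g \<cdot> f) = Cod K g"
  using Comp_Mor[of f "Dom K f" "Dom K g" g "Cod K g"] assms by (auto simp: Mor_iff)

lemma Arr_Id [simp]:
  assumes "A \<in> Obj K"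
  shows "Id K A \<in> Arr K" "Dom K (Id K A) = A" "Cod K (Id K A) = A"
  using Id_Mor[OF assms] by (auto simp: Mor_iff)

lemma Comp_Id_Arr [simp]: "f \<in> Arr K \<Longrightarrow> Dom K f = A \<Longrightarrow> f \<cdot> Id K A = f"
  using Comp_Id[of f A "Cod K f"] by (simp add: Mor_iff)

lemma Id_Comp_Arr [simp]: "f \<in> Arr K \<Longrightarrow> Cod K f = A \<Longrightarrow> Id K A \<cdot> f = f"
  using Id_Comp[of f "Dom K f" A] by (simp add: Mor_iff)

lemma Comp_assoc_Arr [simp]:
  assumes "f \<in> Arr K" "g \<in> Arr K" "h \<in> Arr K" "Cod K f = Dom K g" "Cod K g = Dom K h"
  shows "(h \<cdot> g) \<cdot> f = h \<cdot> (g \<cdot> f)"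
  using Comp_assoc[of f "Dom K f" "Dom K g" g "Dom K h" h "Cod K h"] assms by (simp add: Mor_iff)

lemma is_iso_mono_epi:
  assumes "is_iso K f"
  shows "is_mono K f" "is_epi K f"
proof -
  obtain k where [simp]: "f \<in> Arr K" "k \<in> Arr K" "Dom K k = Cod K f" "Cod K k = Dom K f"
    and k: "k \<cdot> f = Id K (Dom K f)" "f \<cdot> k = Id K (Cod K f)"
    using assms unfolding is_iso_def Bex_def Mor_iff by blast
  show "is_mono K f" unfolding is_mono_def
  proof (intro conjI ballI impI)
    fix X g h assume "g \<in> Mor K X (Dom K f)" "h \<in> Mor K X (Dom K f)" and e: "f \<cdot> g = f \<cdot> h"
    then have [simp]: "g \<in> Arr K" "Cod K g = Dom K f" "h \<in> Arr K" "Cod K h = Dom K f" by (simp_all add: Mor_iff)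
    have "g = (k \<cdot> f) \<cdot> g" unfolding k by simp
    also have "\<dots> = k \<cdot> (f \<cdot> g)" by (rule Comp_assoc_Arr) simp_all
    also have "\<dots> = (k \<cdot> f) \<cdot> h" unfolding e by (rule Comp_assoc_Arr[symmetric]) simp_all
    also have "\<dots> = h" unfolding k by simp
    finally show "g = h" .
  qed simp
  show "is_epi K f" unfolding is_epi_def
  proof (intro conjI ballI impI)
    fix X g h assume "g \<in> Mor K (Cod K f) X" "h \<in> Mor K (Cod K f) X" and e: "g \<cdot> f = h \<cdot> f"
    then have [simp]: "g \<in> Arr K" "Dom K g = Cod K f" "h \<in> Arr K" "Dom K h = Cod K f" by (simp_all add: Mor_iff)
    have "g = g \<cdot> (f \<cdot> k)" unfolding k by simp
    also have "\<dots> = (g \<cdot> f) \<cdot> k" by (rule Comp_assoc_Arr[symmetric]) simp_all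
    also have "\<dots> = h \<cdot> (f \<cdot> k)" unfolding e by (rule Comp_assoc_Arr) simp_all
    also have "\<dots> = h" unfolding k by simp
    finally show "g = h" .
  qed simp
qed

end

context preadditive_category
begin

lemma hom_group_simps [simp]:
  "carrier (hom_group K A B) = Mor K A B"
  "f \<otimes>\<^bsub>hom_group K A B\<^esub> g = f \<boxplus> g"
  "\<one>\<^bsub>hom_group K A B\<^esub> = Zero K A B"
  by (simp_all add: hom_group_def)

lemma Zero_Mor [simp]:
  assumes "A \<in> Obj K" "B \<in> Obj K"
  shows "Zero K A B \<in> Arr K" "Dom K (Zero K A B) = A" "Cod K (Zero K A B) = B"
proof -
  interpret H: comm_group "hom_group K A B" using assms by (rule hom_comm_group)
  show "Zero K A B \<in> Arr K" "Dom K (Zero K A B) = A" "Cod K (Zero K A B) = B"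
    using H.one_closed by (auto simp: Mor_iff)
qed

lemma Arr_Add [simp]:
  assumes "f \<in> Arr K" "g \<in> Arr K" "Dom K g = Dom K f" "Cod K g = Cod K f"
  shows "f \<boxplus> g \<in> Arr K" "Dom K (f \<boxplus> g) = Dom K f" "Cod K (f \<boxplus> g) = Cod K f"
proof -
  interpret H: comm_group "hom_group K (Dom K f) (Cod K f)" using assms by (simp add: hom_comm_group)
  show "f \<boxplus> g \<in> Arr K" "Dom K (f \<boxplus> g) = Dom K f" "Cod K (f \<boxplus> g) = Cod K f"
    using H.m_closed[of f g] assms by (auto simp: Mor_iff)
qed

lemma Arr_neg [simp]:
  assumes "f \<in> Arr K"
  shows "neg K f \<in> Arr K" "Dom K (neg K f) = Dom K f" "Cod K (neg K f) = Cod K f"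
proof -
  interpret H: comm_group "hom_group K (Dom K f) (Cod K f)" using assms by (simp add: hom_comm_group)
  show "neg K f \<in> Arr K" "Dom K (neg K f) = Dom K f" "Cod K (neg K f) = Cod K f"
    using H.inv_closed[of f] assms by (auto simp: Mor_iff neg_def)
qed

lemma Add_group:
  assumes "f \<in> Arr K" "g \<in> Arr K" "Dom K g = Dom K f" "Cod K g = Cod K f"
  shows Add_commute: "f \<boxplus> g = g \<boxplus> f"
    and Add_assoc: "h \<in> Arr K \<Longrightarrow> Dom K h = Dom K f \<Longrightarrow> Cod K h = Cod K f \<Longrightarrow>
      (f \<boxplus> g) \<boxplus> h = f \<boxplus> (g \<boxplus> h)"
    and Add_left_commute: "h \<in> Arr K \<Longrightarrow> Dom K h = Dom K f \<Longrightarrow> Cod K h = Cod K f \<Longrightarrow>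
      f \<boxplus> (g \<boxplus> h) = g \<boxplus> (f \<boxplus> h)"
proof -
  interpret H: comm_group "hom_group K (Dom K f) (Cod K f)" using assms by (simp add: hom_comm_group)
  show "f \<boxplus> g = g \<boxplus> f"
    using H.m_comm[of f g] assms by (simp add: Mor_iff)
  show "h \<in> Arr K \<Longrightarrow> Dom K h = Dom K f \<Longrightarrow> Cod K h = Cod K f \<Longrightarrow>
      (f \<boxplus> g) \<boxplus> h = f \<boxplus> (g \<boxplus> h)"
    using H.m_assoc[of f g h] assms by (simp add: Mor_iff)
  show "h \<in> Arr K \<Longrightarrow> Dom K h = Dom K f \<Longrightarrow> Cod K h = Cod K f \<Longrightarrow>
      f \<boxplus> (g \<boxplus> h) = g \<boxplus> (f \<boxplus> h)"
    using H.m_lcomm[of f g h] assms by (simp add: Mor_iff)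
qed

lemma Add_units [simp]:
  assumes "f \<in> Arr K"
  shows "Dom K f = A \<Longrightarrow> Cod K f = B \<Longrightarrow> f \<boxplus> Zero K A B = f"
    and "Dom K f = A \<Longrightarrow> Cod K f = B \<Longrightarrow> Zero K A B \<boxplus> f = f"
    and "f \<boxplus> neg K f = Zero K (Dom K f) (Cod K f)"
    and "neg K f \<boxplus> f = Zero K (Dom K f) (Cod K f)"
    and "neg K (neg K f) = f"
proof -
  interpret H: comm_group "hom_group K (Dom K f) (Cod K f)" using assms by (simp add: hom_comm_group)
  have f: "f \<in> carrier (hom_group K (Dom K f) (Cod K f))" using assms by (simp add: Mor_iff)
  show "Dom K f = A \<Longrightarrow> Cod K f = B \<Longrightarrow> f \<boxplus> Zero K A B = f"
    "Dom K f = A \<Longrightarrow> Cod K f = B \<Longrightarrow> Zero K A B \<boxplus> f = f"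
    using H.r_one[OF f] H.l_one[OF f] by auto
  show "f \<boxplus> neg K f = Zero K (Dom K f) (Cod K f)" "neg K f \<boxplus> f = Zero K (Dom K f) (Cod K f)"
    using H.r_inv[OF f] H.l_inv[OF f] by (simp_all add: neg_def)
  show "neg K (neg K f) = f"
    using H.inv_inv[OF f] Arr_neg[OF assms] by (simp add: neg_def)
qed

lemma Add_cancel:
  assumes "f \<in> Arr K" "g \<in> Arr K" "Dom K g = Dom K f" "Cod K g = Cod K f"
  shows "f \<boxplus> (neg K f \<boxplus> g) = g" "neg K f \<boxplus> (f \<boxplus> g) = g"
    and "(f \<boxplus> neg K g = Zero K (Dom K f) (Cod K f)) = (f = g)"
    and "(f \<boxplus> g = Zero K (Dom K f) (Cod K f)) = (f = neg K g)"
proof -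
  interpret H: comm_group "hom_group K (Dom K f) (Cod K f)" using assms by (simp add: hom_comm_group)
  show *: "f \<boxplus> (neg K f \<boxplus> g) = g" "neg K f \<boxplus> (f \<boxplus> g) = g"
    using assms by (simp_all add: Add_assoc[symmetric])
  have c: "f \<in> carrier (hom_group K (Dom K f) (Cod K f))" "g \<in> carrier (hom_group K (Dom K f) (Cod K f))"
    using assms by (simp_all add: Mor_iff)
  show "(f \<boxplus> g = Zero K (Dom K f) (Cod K f)) = (f = neg K g)"
    using H.inv_equality[OF _ c(2,1)] assms by (auto simp: neg_def[of K g])
      (metis Add_units(4) assms(2) assms(3) assms(4) neg_def)
  show "(f \<boxplus> neg K g = Zero K (Dom K f) (Cod K f)) = (f = g)"
    using assms Add_units(3)[of g]
    by (metis Add_commute Add_units(1) Arr_neg Add_assoc Add_units(4))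
qed

lemma Add_diff_cancel:
  assumes "f \<in> Arr K" "g \<in> Arr K" "Dom K g = Dom K f" "Cod K g = Cod K f"
  shows "f \<boxplus> (g \<boxplus> neg K f) = g"
  using assms Add_cancel(1)[of f g] by (simp add: Add_commute[of g])

lemma Comp_Add_Arr [simp]:
  assumes "f \<in> Arr K" "f' \<in> Arr K" "g \<in> Arr K"
    "Dom K f' = Dom K f" "Cod K f' = Cod K f" "Cod K f = Dom K g"
  shows "g \<cdot> (f \<boxplus> f') = g \<cdot> f \<boxplus> g \<cdot> f'"
  using Comp_Add[of f "Dom K f" "Dom K g" f' g "Cod K g"] assms by (simp add: Mor_iff)

lemma Add_Comp_Arr [simp]:
  assumes "f \<in> Arr K" "g \<in> Arr K" "g' \<in> Arr K"
    "Dom K g' = Dom K g" "Cod K g' = Cod K g" "Cod K f = Dom K g"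
  shows "(g \<boxplus> g') \<cdot> f = g \<cdot> f \<boxplus> g' \<cdot> f"
  using Add_Comp[of f "Dom K f" "Dom K g" g "Cod K g" g'] assms by (simp add: Mor_iff)

lemma idem_Zero:
  assumes "f \<in> Arr K" "f \<boxplus> f = f"
  shows "f = Zero K (Dom K f) (Cod K f)"
  using Add_cancel(2)[of f f] assms by simp

lemma Comp_Zero [simp]:
  assumes "f \<in> Arr K"
  shows "A \<in> Obj K \<Longrightarrow> Dom K f = B \<Longrightarrow> f \<cdot> Zero K A B = Zero K A (Cod K f)"
    and "A \<in> Obj K \<Longrightarrow> Cod K f = B \<Longrightarrow> Zero K B A \<cdot> f = Zero K (Dom K f) A"
proof -
  assume A: "A \<in> Obj K"
  { assume "Dom K f = B"
    then show "f \<cdot> Zero K A B = Zero K A (Cod K f)"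
      using idem_Zero[of "f \<cdot> Zero K A B"] Comp_Add_Arr[of "Zero K A B" "Zero K A B" f, symmetric] A assms
      by force }
  { assume "Cod K f = B"
    then show "Zero K B A \<cdot> f = Zero K (Dom K f) A"
      using idem_Zero[of "Zero K B A \<cdot> f"] Add_Comp_Arr[of f "Zero K B A" "Zero K B A", symmetric] A assms
      by force }
qed

lemma Comp_neg [simp]:
  assumes "f \<in> Arr K" "g \<in> Arr K" "Cod K f = Dom K g"
  shows "g \<cdot> neg K f = neg K (g \<cdot> f)" "neg K g \<cdot> f = neg K (g \<cdot> f)"
proof -
  show "g \<cdot> neg K f = neg K (g \<cdot> f)"
    using Add_cancel(4)[of "g \<cdot> neg K f" "g \<cdot> f"] Comp_Add_Arr[of "neg K f" f g] assms by simp
  show "neg K g \<cdot> f = neg K (g \<cdot> f)"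
    using Add_cancel(4)[of "neg K g \<cdot> f" "g \<cdot> f"] Add_Comp_Arr[of f "neg K g" g] assms by simp
qed

lemma neg_Add [simp]:
  assumes "f \<in> Arr K" "g \<in> Arr K" "Dom K g = Dom K f" "Cod K g = Cod K f"
  shows "neg K (f \<boxplus> g) = neg K f \<boxplus> neg K g"
proof -
  interpret H: comm_group "hom_group K (Dom K f) (Cod K f)" using assms by (simp add: hom_comm_group)
  show ?thesis using H.inv_mult[of f g] assms by (simp add: Mor_iff neg_def)
qed

lemma neg_Zero [simp]:
  assumes "A \<in> Obj K" "B \<in> Obj K"
  shows "neg K (Zero K A B) = Zero K A B"
proof -
  have "neg K (Zero K A B) = Zero K A B \<boxplus> neg K (Zero K A B)"
    by (rule Add_units(2)[symmetric]) (simp_all add: assms)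
  also have "\<dots> = Zero K A B" using Add_units(3)[of "Zero K A B"] assms by simp
  finally show ?thesis .
qed

lemma biproductD:
  assumes "biproduct K A B P i j p q"
  shows "A \<in> Obj K" "B \<in> Obj K" "P \<in> Obj K"
    "i \<in> Arr K" "Dom K i = A" "Cod K i = P" "j \<in> Arr K" "Dom K j = B" "Cod K j = P"
    "p \<in> Arr K" "Dom K p = P" "Cod K p = A" "q \<in> Arr K" "Dom K q = P" "Cod K q = B"
    "p \<cdot> i = Id K A" "q \<cdot> j = Id K B" "q \<cdot> i = Zero K A B" "p \<cdot> j = Zero K B A"
    "i \<cdot> p \<boxplus> j \<cdot> q = Id K P"
  using assms by (auto simp: biproduct_def Mor_iff)

lemma biproduct_swap:
  assumes "biproduct K A B P i j p q"
  shows "biproduct K B A P j i q p"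
  using assms biproductD[OF assms] Add_commute[of "i \<cdot> p" "j \<cdot> q"] by (simp add: biproduct_def)

lemma biproduct_Comp:
  assumes b: "biproduct K A B P i j p q" and f: "f \<in> Arr K"
  shows "Cod K f = A \<Longrightarrow> p \<cdot> (i \<cdot> f) = f" "Cod K f = B \<Longrightarrow> q \<cdot> (j \<cdot> f) = f"
    "Cod K f = A \<Longrightarrow> q \<cdot> (i \<cdot> f) = Zero K (Dom K f) B"
    "Cod K f = B \<Longrightarrow> p \<cdot> (j \<cdot> f) = Zero K (Dom K f) A"
    "Cod K f = P \<Longrightarrow> i \<cdot> (p \<cdot> f) \<boxplus> j \<cdot> (q \<cdot> f) = f"
proof -
  note d = biproductD[OF b]
  note [simp] = d(1-15) f
  show "Cod K f = A \<Longrightarrow> p \<cdot> (i \<cdot> f) = f"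
    using Comp_assoc_Arr[of f i p] d(16) by simp
  show "Cod K f = B \<Longrightarrow> q \<cdot> (j \<cdot> f) = f"
    using Comp_assoc_Arr[of f j q] d(17) by simp
  show "Cod K f = A \<Longrightarrow> q \<cdot> (i \<cdot> f) = Zero K (Dom K f) B"
    using Comp_assoc_Arr[of f i q] d(18) by simp
  show "Cod K f = B \<Longrightarrow> p \<cdot> (j \<cdot> f) = Zero K (Dom K f) A"
    using Comp_assoc_Arr[of f j p] d(19) by simp
  show "Cod K f = P \<Longrightarrow> i \<cdot> (p \<cdot> f) \<boxplus> j \<cdot> (q \<cdot> f) = f"
    using Add_Comp_Arr[of f "i \<cdot> p" "j \<cdot> q"] d(20) by simp
qed

end

section \<open>Ideal quotients\<close>

locale additive_subcat = preadditive_category K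
  for K :: "('o, 'm, 'x) preadditive_category_scheme" (structure) and N :: "'o set" +
  assumes additive_subcat: "additive_subcategory K N"
begin

text \<open>
  Morphisms with zero class in the ideal quotient.
\<close>

definition null :: "'m \<Rightarrow> bool" where
  "null f \<longleftrightarrow> f \<in> factoring K N (Dom K f) (Cod K f)"

lemma N_Obj: "X \<in> N \<Longrightarrow> X \<in> Obj K"
  using additive_subcat by (auto simp: additive_subcategory_def)

lemma factoring_iff: "f \<in> factoring K N A B \<longleftrightarrow> f \<in> Mor K A B \<and> null f"
proof -
  have "f \<in> factoring K N A B \<Longrightarrow> f \<in> Mor K A B"
    by (auto simp: factoring_def Mor_iff)
  then show ?thesis by (metis Mor_iff null_def)
qed

lemma null_Arr [simp]: "null f \<Longrightarrow> f \<in> Arr K"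
  unfolding null_def factoring_def by (auto simp: Mor_iff)

lemma nullE:
  assumes "null f"
  obtains X u v where "X \<in> N" "u \<in> Arr K" "v \<in> Arr K" "Dom K u = Dom K f" "Cod K u = X"
    "Dom K v = X" "Cod K v = Cod K f" "f = v \<cdot> u"
  using assms unfolding null_def factoring_def by (auto simp: Mor_iff)

lemma nullI:
  assumes "u \<in> Arr K" "v \<in> Arr K" "Cod K u = X" "Dom K v = X" "X \<in> N"
  shows "null (v \<cdot> u)"
  using assms unfolding null_def factoring_def by (auto simp: Mor_iff)

lemma null_Comp [simp]:
  assumes "null f" "g \<in> Arr K"
  shows "Cod K f = Dom K g \<Longrightarrow> null (g \<cdot> f)" "Cod K g = Dom K f \<Longrightarrow> null (f \<cdot> g)"
proof -
  obtain X u v where X: "X \<in> N" and [simp]: "u \<in> Arr K" "v \<in> Arr K" "Dom K u = Dom K f" "Cod K u = X"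
    "Dom K v = X" "Cod K v = Cod K f" and f: "f = v \<cdot> u"
    using nullE[OF assms(1)] by blast
  have [simp]: "f \<in> Arr K" using assms(1) by simp
  show "null (g \<cdot> f)" if "Cod K f = Dom K g"
  proof -
    have "g \<cdot> f = (g \<cdot> v) \<cdot> u" unfolding f using assms that by simp
    then show ?thesis using nullI[of u "g \<cdot> v" X] assms that X by simp
  qed
  show "null (f \<cdot> g)" if "Cod K g = Dom K f"
  proof -
    have "f \<cdot> g = v \<cdot> (u \<cdot> g)" unfolding f using assms that by simp
    then show ?thesis using nullI[of "u \<cdot> g" v X] assms that X by simp
  qed
qed

text \<open>Two factorizations through \<open>X\<close> and \<open>Y\<close> add up to one through their biproduct.\<close>

lemma null_Add [simp]:
  assumes "null f" "null g" "Dom K g = Dom K f" "Cod K g = Cod K f"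
  shows "null (f \<boxplus> g)"
proof -
  obtain X u v where X: "X \<in> N" and [simp]: "u \<in> Arr K" "v \<in> Arr K" "Dom K u = Dom K f" "Cod K u = X"
    "Dom K v = X" "Cod K v = Cod K f" and f: "f = v \<cdot> u"
    using nullE[OF assms(1)] by blast
  obtain Y u' v' where Y: "Y \<in> N" and [simp]: "u' \<in> Arr K" "v' \<in> Arr K" "Dom K u' = Dom K f" "Cod K u' = Y"
    "Dom K v' = Y" "Cod K v' = Cod K f" and g: "g = v' \<cdot> u'"
    using nullE[OF assms(2)] assms(3,4) by metis
  have "\<forall>A \<in> N. \<forall>B \<in> N. \<exists>P \<in> N. \<exists>i j p q. biproduct K A B P i j p q"
    using additive_subcat unfolding additive_subcategory_def by (elim conjE)
  from bspec[OF bspec[OF this X] Y]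
  obtain P i j p q where P: "P \<in> N" and b: "biproduct K X Y P i j p q"
    by (elim bexE exE) (rule that)
  note [simp] = biproductD(1-15)[OF b]
  have "(v \<cdot> p \<boxplus> v' \<cdot> q) \<cdot> (i \<cdot> u \<boxplus> j \<cdot> u') = v \<cdot> u \<boxplus> v' \<cdot> u'"
    by (simp add: biproduct_Comp[OF b] assms)
  moreover have "null ((v \<cdot> p \<boxplus> v' \<cdot> q) \<cdot> (i \<cdot> u \<boxplus> j \<cdot> u'))"
    by (rule nullI[of _ _ P]) (simp_all add: P assms)
  ultimately show ?thesis by (simp only: f[symmetric] g[symmetric])
qed

lemma null_Zero [simp]: "A \<in> Obj K \<Longrightarrow> B \<in> Obj K \<Longrightarrow> null (Zero K A B)"
proof -
  assume o: "A \<in> Obj K" "B \<in> Obj K"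
  obtain Z where Z: "Z \<in> N" using additive_subcat by (auto simp: additive_subcategory_def)
  have "null (Zero K Z B \<cdot> Zero K A Z)"
    by (rule nullI[of _ _ Z]) (simp_all add: Z o N_Obj)
  then show ?thesis using o N_Obj[OF Z] by simp
qed

lemma null_neg [simp]: "null f \<Longrightarrow> null (neg K f)"
  using null_Comp(1)[of f "neg K (Id K (Cod K f))"] by simp

lemma null_summand:
  assumes "null (f \<boxplus> g)" "null g" "f \<in> Arr K" "Dom K f = Dom K g" "Cod K f = Cod K g"
  shows "null f"
proof -
  have "f = (f \<boxplus> g) \<boxplus> neg K g" using assms by (simp add: Add_assoc)
  then show ?thesis using null_Add[OF assms(1), of "neg K g"] assms by simp
qed

lemma null_diff:
  assumes "null (f \<boxplus> neg K g)" "f \<in> Arr K" "g \<in> Arr K" "Dom K f = Dom K g" "Cod K f = Cod K g"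
  shows "null f \<longleftrightarrow> null g"
proof
  assume "null f"
  have "null (neg K g \<boxplus> f)" using assms by (simp add: Add_commute)
  then have "null (neg K g)" by (rule null_summand) (simp_all add: assms \<open>null f\<close>)
  then show "null g" using null_neg[of "neg K g"] assms by simp
next
  assume "null g"
  show "null f" by (rule null_summand[OF assms(1)]) (simp_all add: assms \<open>null g\<close>)
qed

abbreviation "pr \<equiv> proj K N"
abbreviation "Q \<equiv> ideal_quotient K N"

lemma pr_eq: "pr f = {h \<boxplus> f | h. null h \<and> Dom K h = Dom K f \<and> Cod K h = Cod K f}"
proof -
  have "pr f = {h \<boxplus> f | h. h \<in> factoring K N (Dom K f) (Cod K f)}"
    by (auto simp: proj_def r_coset_def)
  then show ?thesis by (auto simp: factoring_iff Mor_iff)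
qed

lemma mem_pr_iff:
  assumes "f \<in> Arr K"
  shows "g \<in> pr f \<longleftrightarrow> g \<in> Arr K \<and> Dom K g = Dom K f \<and> Cod K g = Cod K f \<and> null (g \<boxplus> neg K f)"
proof
  assume "g \<in> pr f"
  then obtain h where "g = h \<boxplus> f" "null h" "Dom K h = Dom K f" "Cod K h = Cod K f"
    unfolding pr_eq by blast
  then show "g \<in> Arr K \<and> Dom K g = Dom K f \<and> Cod K g = Cod K f \<and> null (g \<boxplus> neg K f)"
    using assms by (simp add: Add_assoc)
next
  assume g: "g \<in> Arr K \<and> Dom K g = Dom K f \<and> Cod K g = Cod K f \<and> null (g \<boxplus> neg K f)"
  then have "g = (g \<boxplus> neg K f) \<boxplus> f" using assms by (simp add: Add_assoc)
  then show "g \<in> pr f" unfolding pr_eq using g assms by (smt (verit) Arr_Add Arr_neg mem_Collect_eq)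
qed

lemma pr_eq_iff:
  assumes "f \<in> Arr K" "g \<in> Arr K"
  shows "pr f = pr g \<longleftrightarrow> Dom K f = Dom K g \<and> Cod K f = Cod K g \<and> null (f \<boxplus> neg K g)"
proof
  assume "pr f = pr g"
  moreover have "f \<in> pr f" using assms by (simp add: mem_pr_iff)
  ultimately show "Dom K f = Dom K g \<and> Cod K f = Cod K g \<and> null (f \<boxplus> neg K g)"
    using mem_pr_iff[OF assms(2)] by auto
next
  assume *: "Dom K f = Dom K g \<and> Cod K f = Cod K g \<and> null (f \<boxplus> neg K g)"
  have "h \<in> pr f \<longleftrightarrow> h \<in> pr g" for h
  proof (cases "h \<in> Arr K \<and> Dom K h = Dom K g \<and> Cod K h = Cod K g")
    case True
    have e: "h \<boxplus> neg K g = (h \<boxplus> neg K f) \<boxplus> (f \<boxplus> neg K g)"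
      using True * assms by (simp add: Add_assoc Add_cancel)
    show ?thesis
    proof
      assume "h \<in> pr f"
      then show "h \<in> pr g" using True * assms e by (simp add: mem_pr_iff)
    next
      assume "h \<in> pr g"
      then have "null (h \<boxplus> neg K g)" using assms by (simp add: mem_pr_iff)
      then have "null (h \<boxplus> neg K f)"
        using e True * assms by (intro null_summand[of "h \<boxplus> neg K f" "f \<boxplus> neg K g"]) simp_all
      then show "h \<in> pr f" using True * assms by (simp add: mem_pr_iff)
    qed
  qed (use * assms in \<open>auto simp: mem_pr_iff\<close>)
  then show "pr f = pr g" by blast
qed

lemma pr_self: "f \<in> Arr K \<Longrightarrow> f \<in> pr f"
  by (simp add: mem_pr_iff)

lemma Q_simps:
  "Obj Q = Obj K" "Arr Q = pr ` Arr K" "Id Q A = pr (Id K A)"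
  by (simp_all add: ideal_quotient_def)

lemma Dom_Cod_pr [simp]:
  assumes "f \<in> Arr K" shows "Dom Q (pr f) = Dom K f" "Cod Q (pr f) = Cod K f"
proof -
  have "Dom K ` pr f = {Dom K f}" "Cod K ` pr f = {Cod K f}"
    using pr_self[OF assms] by (auto simp: mem_pr_iff[OF assms] intro!: rev_image_eqI[of f])
  then show "Dom Q (pr f) = Dom K f" "Cod Q (pr f) = Cod K f" by (simp_all add: ideal_quotient_def)
qed

lemma Comp_pr [simp]:
  assumes "f \<in> Arr K" "g \<in> Arr K" "Cod K f = Dom K g"
  shows "pr g \<cdot>\<^bsub>Q\<^esub> pr f = pr (g \<cdot> f)"
proof -
  have "pr (g' \<cdot> f') = pr (g \<cdot> f)" if "f' \<in> pr f" "g' \<in> pr g" for f' g'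
  proof -
    have [simp]: "f' \<in> Arr K" "Dom K f' = Dom K f" "Cod K f' = Cod K f" "null (f' \<boxplus> neg K f)"
      "g' \<in> Arr K" "Dom K g' = Dom K g" "Cod K g' = Cod K g" "null (g' \<boxplus> neg K g)"
      using that assms by (auto simp: mem_pr_iff)
    have "g' \<cdot> f' \<boxplus> neg K (g \<cdot> f) = g' \<cdot> (f' \<boxplus> neg K f) \<boxplus> (g' \<boxplus> neg K g) \<cdot> f"
      using assms by (simp add: Add_assoc Add_cancel)
    moreover have "null (g' \<cdot> (f' \<boxplus> neg K f) \<boxplus> (g' \<boxplus> neg K g) \<cdot> f)"
      by (rule null_Add; (rule null_Comp)?) (simp_all add: assms del: Comp_Add_Arr Add_Comp_Arr)
    ultimately show ?thesis using assms by (simp add: pr_eq_iff)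
  qed
  then have "(\<Union>g' \<in> pr g. \<Union>f' \<in> pr f. pr (g' \<cdot> f')) = pr (g \<cdot> f)"
    using pr_self[OF assms(1)] pr_self[OF assms(2)] by blast
  then show ?thesis by (simp add: ideal_quotient_def)
qed

lemma Mor_Q: "Mor Q A B = pr ` Mor K A B"
  by (auto simp: Mor_def Q_simps)

lemma category_Q: "category Q"
proof (unfold_locales, goal_cases)
  case (1 f) then show ?case by (auto simp: Q_simps)
next
  case (2 f) then show ?case by (auto simp: Q_simps)
next
  case (3 A) then show ?case by (auto simp: Mor_Q Q_simps Mor_iff)
next
  case (4 f A B g C)
  then show ?case by (auto simp: Mor_Q Mor_iff intro!: image_eqI)
next
  case (5 f A B) then show ?case by (auto simp: Mor_Q Mor_iff Q_simps)
next
  case (6 f A B) then show ?case by (auto simp: Mor_Q Mor_iff Q_simps)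
next
  case (7 f A B g C h D) then show ?case by (auto simp: Mor_Q Mor_iff)
qed

text \<open>
  The quotient is preadditive, so its monomorphisms and epimorphisms are tested on zero morphisms
  only; see \<open>is_mono_pr\<close> and \<open>is_epi_pr\<close>.
\<close>

definition mono_mod :: "'m \<Rightarrow> bool" where
  "mono_mod f \<longleftrightarrow> (\<forall>g \<in> Arr K. Cod K g = Dom K f \<longrightarrow> null (f \<cdot> g) \<longrightarrow> null g)"

definition epi_mod :: "'m \<Rightarrow> bool" where
  "epi_mod f \<longleftrightarrow> (\<forall>g \<in> Arr K. Dom K g = Cod K f \<longrightarrow> null (g \<cdot> f) \<longrightarrow> null g)"

text \<open>
  These morphisms represent the class at which one localizes, whence the name: weak equivalences.
\<close>

definition weq :: "'m \<Rightarrow> bool" where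
  "weq f \<longleftrightarrow> f \<in> Arr K \<and> mono_mod f \<and> epi_mod f"

lemma mono_modD: "mono_mod f \<Longrightarrow> g \<in> Arr K \<Longrightarrow> Cod K g = Dom K f \<Longrightarrow> null (f \<cdot> g) \<Longrightarrow> null g"
  by (auto simp only: mono_mod_def)

lemma epi_modD: "epi_mod f \<Longrightarrow> g \<in> Arr K \<Longrightarrow> Dom K g = Cod K f \<Longrightarrow> null (g \<cdot> f) \<Longrightarrow> null g"
  by (auto simp only: epi_mod_def)

lemma is_mono_pr:
  assumes f: "f \<in> Arr K" shows "is_mono Q (pr f) \<longleftrightarrow> mono_mod f"
proof -
  have eq: "is_mono Q (pr f) \<longleftrightarrow> (\<forall>X \<in> Obj K. \<forall>g \<in> Mor K X (Dom K f). \<forall>h \<in> Mor K X (Dom K f).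
      pr (f \<cdot> g) = pr (f \<cdot> h) \<longrightarrow> pr g = pr h)"
    unfolding is_mono_def using f by (simp add: Mor_Q Mor_iff Q_simps)
  show ?thesis
  proof
    assume m: "is_mono Q (pr f)"
    show "mono_mod f" unfolding mono_mod_def
    proof (intro ballI impI)
      fix g assume g: "g \<in> Arr K" "Cod K g = Dom K f" "null (f \<cdot> g)"
      let ?z = "Zero K (Dom K g) (Dom K f)"
      have "pr (f \<cdot> g) = pr (f \<cdot> ?z)" using f g by (simp add: pr_eq_iff)
      moreover have "Dom K g \<in> Obj K" "g \<in> Mor K (Dom K g) (Dom K f)" "?z \<in> Mor K (Dom K g) (Dom K f)"
        using f g by (simp_all add: Mor_iff)
      ultimately have "pr g = pr ?z" using m unfolding eq by blast
      then show "null g" using f g by (simp add: pr_eq_iff)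
    qed
  next
    assume m: "mono_mod f"
    show "is_mono Q (pr f)" unfolding eq
    proof (intro ballI impI)
      fix X g h assume "g \<in> Mor K X (Dom K f)" "h \<in> Mor K X (Dom K f)" and e: "pr (f \<cdot> g) = pr (f \<cdot> h)"
      then have [simp]: "g \<in> Arr K" "h \<in> Arr K" "Dom K g = X" "Dom K h = X" "Cod K g = Dom K f" "Cod K h = Dom K f"
        by (auto simp: Mor_iff)
      have "null (f \<cdot> (g \<boxplus> neg K h))" using e f by (simp add: pr_eq_iff)
      then have "null (g \<boxplus> neg K h)" by (intro mono_modD[OF m, of "g \<boxplus> neg K h"]) simp_all
      then show "pr g = pr h" by (simp add: pr_eq_iff)
    qed
  qed
qed

lemma is_epi_pr:
  assumes f: "f \<in> Arr K" shows "is_epi Q (pr f) \<longleftrightarrow> epi_mod f"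
proof -
  have eq: "is_epi Q (pr f) \<longleftrightarrow> (\<forall>X \<in> Obj K. \<forall>g \<in> Mor K (Cod K f) X. \<forall>h \<in> Mor K (Cod K f) X.
      pr (g \<cdot> f) = pr (h \<cdot> f) \<longrightarrow> pr g = pr h)"
    unfolding is_epi_def using f by (simp add: Mor_Q Mor_iff Q_simps)
  show ?thesis
  proof
    assume m: "is_epi Q (pr f)"
    show "epi_mod f" unfolding epi_mod_def
    proof (intro ballI impI)
      fix g assume g: "g \<in> Arr K" "Dom K g = Cod K f" "null (g \<cdot> f)"
      let ?z = "Zero K (Cod K f) (Cod K g)"
      have "pr (g \<cdot> f) = pr (?z \<cdot> f)" using f g by (simp add: pr_eq_iff)
      moreover have "Cod K g \<in> Obj K" "g \<in> Mor K (Cod K f) (Cod K g)" "?z \<in> Mor K (Cod K f) (Cod K g)"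
        using f g by (simp_all add: Mor_iff)
      ultimately have "pr g = pr ?z" using m unfolding eq by blast
      then show "null g" using f g by (simp add: pr_eq_iff)
    qed
  next
    assume m: "epi_mod f"
    show "is_epi Q (pr f)" unfolding eq
    proof (intro ballI impI)
      fix X g h assume "g \<in> Mor K (Cod K f) X" "h \<in> Mor K (Cod K f) X" and e: "pr (g \<cdot> f) = pr (h \<cdot> f)"
      then have [simp]: "g \<in> Arr K" "h \<in> Arr K" "Cod K g = X" "Cod K h = X" "Dom K g = Cod K f" "Dom K h = Cod K f"
        by (auto simp: Mor_iff)
      have "null ((g \<boxplus> neg K h) \<cdot> f)" using e f by (simp add: pr_eq_iff)
      then have "null (g \<boxplus> neg K h)" by (intro epi_modD[OF m, of "g \<boxplus> neg K h"]) simp_all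
      then show "pr g = pr h" by (simp add: pr_eq_iff)
    qed
  qed
qed

end

section \<open>The opposite category\<close>

definition opposite :: "('o, 'm, 'e, 'x) extri_category_scheme \<Rightarrow> ('o, 'm, 'e) extri_category" where
  "opposite K = \<lparr>Obj = Obj K, Arr = Arr K, Dom = Cod K, Cod = Dom K, Id = Id K,
    Comp = (\<lambda>g f. f \<cdot>\<^bsub>K\<^esub> g), Add = Add K, Zero = (\<lambda>A B. Zero K B A),
    Ext = (\<lambda>C A. Ext K A C), EMap = (\<lambda>c a. EMap K a c),
    Realize = (\<lambda>C A \<delta>. prod.swap ` Realize K A C \<delta>)\<rparr>"

lemma opposite_simps [simp]:
  "Obj (opposite K) = Obj K" "Arr (opposite K) = Arr K"
  "Dom (opposite K) = Cod K" "Cod (opposite K) = Dom K" "Id (opposite K) = Id K"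
  "g \<cdot>\<^bsub>opposite K\<^esub> f = f \<cdot>\<^bsub>K\<^esub> g" "Add (opposite K) = Add K" "Zero (opposite K) A B = Zero K B A"
  "Ext (opposite K) C A = Ext K A C" "EMap (opposite K) c a = EMap K a c"
  "Realize (opposite K) C A \<delta> = prod.swap ` Realize K A C \<delta>"
  by (simp_all add: opposite_def)

lemma opposite_Mor [simp]: "Mor (opposite K) A B = Mor K B A"
  by (auto simp: Mor_def)

lemma opposite_hom_group [simp]: "hom_group (opposite K) A B = hom_group K B A"
  by (simp add: hom_group_def)

lemma opposite_neg [simp]: "neg (opposite K) f = neg K f"
  by (simp add: neg_def)

lemma opposite_push_pull [simp]:
  "push (opposite K) A c \<delta> = pull K c A \<delta>" "pull (opposite K) a C \<delta> = push K C a \<delta>"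
  by (simp_all add: push_def pull_def)

lemma opposite_zero_object [simp]: "zero_object (opposite K) Z \<longleftrightarrow> zero_object K Z"
  by (auto simp: zero_object_def)

lemma opposite_biproduct [simp]:
  "biproduct (opposite K) A B P i j p q \<longleftrightarrow> biproduct K A B P p q i j"
  by (auto simp: biproduct_def)

lemma opposite_is_iso [simp]: "is_iso (opposite K) f \<longleftrightarrow> is_iso K f"
  by (auto simp: is_iso_def)

lemma opposite_factoring [simp]: "factoring (opposite K) N A B = factoring K N B A"
  by (auto simp: factoring_def)

lemma opposite_sequences: "sequences (opposite K) A C = prod.swap ` sequences K C A"
  by (auto simp: sequences_def)

context extriangulated_category
begin

lemma is_iso_iff:
  "is_iso K b \<longleftrightarrow> b \<in> Arr K \<and> (\<exists>c. c \<in> Arr K \<and> Dom K c = Cod K b \<and> Cod K c = Dom K b \<and>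
    c \<cdot> b = Id K (Dom K b) \<and> b \<cdot> c = Id K (Cod K b))"
  by (auto simp: is_iso_def Mor_iff)

lemma seq_class_iff:
  assumes "x \<in> Arr K" "y \<in> Arr K" "Cod K x = Dom K y"
  shows "(x', y') \<in> seq_class K x y \<longleftrightarrow>
    x' \<in> Arr K \<and> y' \<in> Arr K \<and> Cod K x' = Dom K y' \<and> Dom K x' = Dom K x \<and> Cod K y' = Cod K y \<and>
    (\<exists>b c. b \<in> Arr K \<and> c \<in> Arr K \<and> Dom K b = Dom K y \<and> Cod K b = Dom K y' \<and>
      Dom K c = Dom K y' \<and> Cod K c = Dom K y \<and> c \<cdot> b = Id K (Dom K y) \<and> b \<cdot> c = Id K (Dom K y') \<and>
      b \<cdot> x = x' \<and> y' \<cdot> b = y)" (is "?L \<longleftrightarrow> ?R")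
proof -
  have s: "(x', y') \<in> sequences K (Dom K x) (Cod K y) \<longleftrightarrow>
    x' \<in> Arr K \<and> y' \<in> Arr K \<and> Cod K x' = Dom K y' \<and> Dom K x' = Dom K x \<and> Cod K y' = Cod K y"
    by (auto simp: sequences_def Mor_iff)
  have L: "?L \<longleftrightarrow> (x', y') \<in> sequences K (Dom K x) (Cod K y) \<and>
    (\<exists>b. (b \<in> Arr K \<and> Dom K b = Cod K x \<and> Cod K b = Cod K x') \<and> is_iso K b \<and> b \<cdot> x = x' \<and> y' \<cdot> b = y)"
    by (simp add: seq_class_def Bex_def Mor_iff)
  show ?thesis unfolding L s is_iso_iff using assms(3)
    by (intro iffI; elim conjE exE; intro conjI exI; (assumption | simp))
qed

lemma seq_class_opposite_iff:
  assumes "x \<in> Arr K" "y \<in> Arr K" "Cod K x = Dom K y"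
  shows "(y', x') \<in> seq_class (opposite K) y x \<longleftrightarrow>
    x' \<in> Arr K \<and> y' \<in> Arr K \<and> Cod K x' = Dom K y' \<and> Dom K x' = Dom K x \<and> Cod K y' = Cod K y \<and>
    (\<exists>b c. b \<in> Arr K \<and> c \<in> Arr K \<and> Dom K b = Dom K y' \<and> Cod K b = Dom K y \<and>
      Dom K c = Dom K y \<and> Cod K c = Dom K y' \<and> c \<cdot> b = Id K (Dom K y') \<and> b \<cdot> c = Id K (Dom K y) \<and>
      y \<cdot> b = y' \<and> b \<cdot> x' = x)" (is "?L \<longleftrightarrow> ?R")
proof -
  have s: "(y', x') \<in> sequences (opposite K) (Cod K y) (Dom K x) \<longleftrightarrow>
    x' \<in> Arr K \<and> y' \<in> Arr K \<and> Cod K x' = Dom K y' \<and> Dom K x' = Dom K x \<and> Cod K y' = Cod K y"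
    by (auto simp: sequences_def Mor_iff)
  have L: "?L \<longleftrightarrow> (y', x') \<in> sequences (opposite K) (Cod K y) (Dom K x) \<and>
    (\<exists>b. (b \<in> Arr K \<and> Dom K b = Dom K y' \<and> Cod K b = Dom K y) \<and> is_iso K b \<and> y \<cdot> b = y' \<and> b \<cdot> x' = x)"
    by (simp add: seq_class_def Bex_def Mor_iff)
  show ?thesis unfolding L s is_iso_iff using assms(3)
    by (intro iffI; elim conjE exE; intro conjI exI; (assumption | simp))
qed

text \<open>
  An isomorphism of middle terms is reversed in the opposite category, so its inverse takes its place.
\<close>

lemma seq_class_opposite:
  assumes xy: "x \<in> Arr K" "y \<in> Arr K" "Cod K x = Dom K y"
  shows "seq_class (opposite K) y x = prod.swap ` seq_class K x y"
proof -
  have "(y', x') \<in> seq_class (opposite K) y x \<longleftrightarrow> (x', y') \<in> seq_class K x y" for x' y'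
  proof (cases "x' \<in> Arr K \<and> y' \<in> Arr K \<and> Cod K x' = Dom K y' \<and> Dom K x' = Dom K x \<and> Cod K y' = Cod K y")
    case True
    have eq: "(y \<cdot> b = y' \<and> b \<cdot> x' = x) = (c \<cdot> x = x' \<and> y' \<cdot> c = y)"
      if h: "b \<in> Arr K" "Dom K b = Dom K y'" "Cod K b = Dom K y" "c \<in> Arr K"
        "Dom K c = Dom K y" "Cod K c = Dom K y'" "c \<cdot> b = Id K (Dom K y')" "b \<cdot> c = Id K (Dom K y)" for b c
    proof -
      have "c \<cdot> (b \<cdot> x') = x'" "b \<cdot> (c \<cdot> x) = x" "y \<cdot> (b \<cdot> c) = y" "y' \<cdot> (c \<cdot> b) = y'"
        using Comp_assoc_Arr[of x' b c] Comp_assoc_Arr[of x c b] xy True h by simp_all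
      moreover have "(y \<cdot> b) \<cdot> c = y \<cdot> (b \<cdot> c)" "(y' \<cdot> c) \<cdot> b = y' \<cdot> (c \<cdot> b)"
        using xy True h by (simp_all del: h(7,8))
      ultimately show ?thesis by metis
    qed
    show ?thesis
    proof
      assume "(y', x') \<in> seq_class (opposite K) y x"
      then obtain b c where h: "b \<in> Arr K" "Dom K b = Dom K y'" "Cod K b = Dom K y" "c \<in> Arr K"
        "Dom K c = Dom K y" "Cod K c = Dom K y'" "c \<cdot> b = Id K (Dom K y')" "b \<cdot> c = Id K (Dom K y)"
        and e: "y \<cdot> b = y' \<and> b \<cdot> x' = x"
        unfolding seq_class_opposite_iff[OF xy] by blast
      have "c \<cdot> x = x' \<and> y' \<cdot> c = y" using eq[OF h] e by blast
      then show "(x', y') \<in> seq_class K x y" unfolding seq_class_iff[OF xy]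
        using True h by blast
    next
      assume "(x', y') \<in> seq_class K x y"
      then obtain c b where h: "b \<in> Arr K" "Dom K b = Dom K y'" "Cod K b = Dom K y" "c \<in> Arr K"
        "Dom K c = Dom K y" "Cod K c = Dom K y'" "c \<cdot> b = Id K (Dom K y')" "b \<cdot> c = Id K (Dom K y)"
        and e: "c \<cdot> x = x' \<and> y' \<cdot> c = y"
        unfolding seq_class_iff[OF xy] by blast
      have "y \<cdot> b = y' \<and> b \<cdot> x' = x" using eq[OF h] e by blast
      then show "(y', x') \<in> seq_class (opposite K) y x" unfolding seq_class_opposite_iff[OF xy]
        using True h by blast
    qed
  next
    case False then show ?thesis unfolding seq_class_opposite_iff[OF xy] seq_class_iff[OF xy] by blast
  qed
  then have "z \<in> seq_class (opposite K) y x \<longleftrightarrow> prod.swap z \<in> seq_class K x y" for z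
    by (cases z) simp
  moreover have "z \<in> prod.swap ` S \<longleftrightarrow> prod.swap z \<in> S" for z and S :: "('m \<times> 'm) set"
    by (cases z) (auto intro: rev_image_eqI)
  ultimately show ?thesis by blast
qed

lemma opposite_s_triangle [simp]: "s_triangle (opposite K) y x \<delta> \<longleftrightarrow> s_triangle K x y \<delta>"
proof -
  have inj: "(prod.swap ` A = prod.swap ` B) = (A = B)" for A B :: "('m \<times> 'm) set"
    by (rule inj_image_eq_iff) simp
  show ?thesis unfolding s_triangle_def
    using seq_class_opposite[of x y] inj[of _ "seq_class K x y"] by auto
qed

lemma s_triangleD:
  assumes "s_triangle K x y \<delta>"
  shows "x \<in> Arr K" "y \<in> Arr K" "Cod K x = Dom K y" "\<delta> \<in> carrier (Ext K (Cod K y) (Dom K x))"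
  using assms by (auto simp: s_triangle_def)

lemma s_triangle_morphismD:
  assumes "s_triangle_morphism K (x, y, \<delta>) (x', y', \<delta>') a b c"
  shows "b \<in> Arr K" "Dom K b = Cod K x" "Cod K b = Cod K x'" "b \<cdot> x = x' \<cdot> a" "y' \<cdot> b = c \<cdot> y"
  using assms by (simp_all only: s_triangle_morphism_def Mor_iff prod.case)

lemma pushoutE:
  assumes t: "s_triangle K x y \<delta>" and a: "a \<in> Arr K" "Dom K a = Dom K x"
    and t': "s_triangle K x' y' (push K (Cod K y) a \<delta>)" "Dom K x' = Cod K a" "Cod K y' = Cod K y"
  obtains b where "b \<in> Arr K" "Dom K b = Dom K y" "Cod K b = Dom K y'" "b \<cdot> x = x' \<cdot> a" "y' \<cdot> b = y"
    "\<And>P i j p q. biproduct K (Dom K y) (Cod K a) P i j p q \<Longrightarrow>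
      s_triangle K (i \<cdot> x \<boxplus> j \<cdot> a) (b \<cdot> p \<boxplus> neg K x' \<cdot> q) (pull K y' (Dom K x) \<delta>)"
proof -
  note d = s_triangleD[OF t] s_triangleD[OF t'(1)]
  have m: "x \<in> Mor K (Dom K x) (Dom K y)" "y \<in> Mor K (Dom K y) (Cod K y)" "a \<in> Mor K (Dom K x) (Cod K a)"
    "x' \<in> Mor K (Cod K a) (Dom K y')" "y' \<in> Mor K (Dom K y') (Cod K y)"
    using d a t' by (simp_all add: Mor_iff)
  from C3[OF t m(1,2,3) t'(1) m(4,5)] obtain b where
    b: "s_triangle_morphism K (x, y, \<delta>) (x', y', push K (Cod K y) a \<delta>) a b (Id K (Cod K y))"
    and h: "\<And>P i j p q. biproduct K (Dom K y) (Cod K a) P i j p q \<Longrightarrow>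
      s_triangle K (i \<cdot> x \<boxplus> j \<cdot> a) (b \<cdot> p \<boxplus> neg K x' \<cdot> q) (pull K y' (Dom K x) \<delta>)"
    by blast
  note m' = s_triangle_morphismD[OF b]
  have bb: "b \<in> Arr K" "Dom K b = Dom K y" "Cod K b = Dom K y'" "b \<cdot> x = x' \<cdot> a" "y' \<cdot> b = y"
    by (simp_all only: m' d Id_Comp_Arr)
  show thesis by (rule that[OF bb]) (rule h)
qed

lemma pullbackE:
  assumes t: "s_triangle K x y \<delta>" and c: "c \<in> Arr K" "Cod K c = Cod K y"
    and t': "s_triangle K x' y' (pull K c (Dom K x) \<delta>)" "Dom K x' = Dom K x" "Cod K y' = Dom K c"
  obtains b where "b \<in> Arr K" "Dom K b = Dom K y'" "Cod K b = Dom K y" "b \<cdot> x' = x" "y \<cdot> b = c \<cdot> y'"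
    "\<And>P i j p q. biproduct K (Dom K c) (Dom K y) P i j p q \<Longrightarrow>
      s_triangle K (i \<cdot> neg K y' \<boxplus> j \<cdot> b) (c \<cdot> p \<boxplus> y \<cdot> q) (push K (Cod K y) x' \<delta>)"
proof -
  note d = s_triangleD[OF t] s_triangleD[OF t'(1)]
  have m: "x \<in> Mor K (Dom K x) (Dom K y)" "y \<in> Mor K (Dom K y) (Cod K y)" "c \<in> Mor K (Dom K c) (Cod K y)"
    "x' \<in> Mor K (Dom K x) (Dom K y')" "y' \<in> Mor K (Dom K y') (Dom K c)"
    using d c t' by (simp_all add: Mor_iff)
  from C3'[OF t m(1,2,3) t'(1) m(4,5)] obtain b where
    b: "s_triangle_morphism K (x', y', pull K c (Dom K x) \<delta>) (x, y, \<delta>) (Id K (Dom K x)) b c"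
    and h: "\<And>P i j p q. biproduct K (Dom K c) (Dom K y) P i j p q \<Longrightarrow>
      s_triangle K (i \<cdot> neg K y' \<boxplus> j \<cdot> b) (c \<cdot> p \<boxplus> y \<cdot> q) (push K (Cod K y) x' \<delta>)"
    by blast
  note m' = s_triangle_morphismD[OF b]
  have bb: "b \<in> Arr K" "Dom K b = Dom K y'" "Cod K b = Dom K y" "b \<cdot> x' = x" "y \<cdot> b = c \<cdot> y'"
    by (simp_all only: m' d Comp_Id_Arr)
  show thesis by (rule that[OF bb]) (rule h)
qed

lemma opposite_inflation [simp]: "s_inflation (opposite K) f \<longleftrightarrow> s_deflation K f"
  "s_deflation (opposite K) f \<longleftrightarrow> s_inflation K f"
  by (simp_all add: s_inflation_def s_deflation_def s_conflation_def)

lemma opposite_conflation [simp]: "s_conflation (opposite K) y x \<longleftrightarrow> s_conflation K x y"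
  by (simp add: s_conflation_def)

text \<open>
  Each axiom is exchanged with its dual. For (C3) and (C3') the two summands of the biproduct must be
  swapped, which only changes the order of the terms in the sums.
\<close>

lemma opposite_extriangulated: "extriangulated_category (opposite K)"
proof (intro extriangulated_category.intro additive_category.intro preadditive_category.intro
    category.intro extriangulated_category_axioms.intro additive_category_axioms.intro
    preadditive_category_axioms.intro, goal_cases)
  case (1 f) then show ?case by simp
next
  case (2 f) then show ?case by simp
next
  case (3 A) then show ?case by (simp add: Mor_iff)
next
  case (4 f A B g C) then show ?case by (auto simp: Mor_iff)
next
  case (5 f A B) then show ?case by (auto simp: Mor_iff)
next
  case (6 f A B) then show ?case by (auto simp: Mor_iff)
next
  case (7 f A B g C h D) then show ?case by (simp add: Mor_iff)
next
  case (8 A B) then show ?case by (simp add: hom_comm_group)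
next
  case (9 f A B f' g C) then show ?case by (simp add: Mor_iff)
next
  case (10 f A B g C g') then show ?case by (simp add: Mor_iff)
next
  case 11 then show ?case using ex_zero_object by simp
next
  case (12 A B)
  then have "\<exists>P i j p q. biproduct K A B P i j p q" by (intro ex_biproduct) simp_all
  then show ?case by simp blast
next
  case (13 C A) then show ?case by (simp add: Ext_comm_group)
next
  case (14 c C' C a A A') then show ?case using EMap_hom[of a A' A c C C'] by simp
next
  case (15 C A \<delta>) then show ?case by (simp add: EMap_Id)
next
  case (16 c C' C c' C'' a A A' a' A'' \<delta>)
  then show ?case by (simp add: EMap_Comp)
next
  case (17 c\<^sub>1 C' C c\<^sub>2 a A A' \<delta>) then show ?case by (simp add: EMap_Add_right)
next
  case (18 c C' C a\<^sub>1 A A' a\<^sub>2 \<delta>) then show ?case by (simp add: EMap_Add_left)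
next
  case (19 C A \<delta>)
  then obtain x y where "(x, y) \<in> sequences K C A" "Realize K A C \<delta> = seq_class K x y"
    using Realize_class[of A C \<delta>] by auto
  moreover from this have "x \<in> Arr K" "y \<in> Arr K" "Cod K x = Dom K y"
    by (auto simp: sequences_def Mor_iff)
  ultimately have "(y, x) \<in> sequences (opposite K) A C" "Realize (opposite K) C A \<delta> = seq_class (opposite K) y x"
    by (simp_all add: opposite_sequences seq_class_opposite)
  then show ?case by (intro bexI[of _ "(y, x)"]) simp_all
next
  case (20 x y \<delta> A B C X)
  then show ?case using C1'[of y x \<delta> C B A X] by simp
next
  case (21 x y \<delta> A B C X)
  then show ?case using C1[of y x \<delta> C B A X] by simp
next
  case (22 Z A)
  then show ?case using C2'[of Z A] seq_class_opposite[of "Zero K Z A" "Id K A"]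
    by (simp add: zero_object_def)
next
  case (23 Z A)
  then show ?case using C2[of Z A] seq_class_opposite[of "Id K A" "Zero K A Z"]
    by (simp add: zero_object_def)
next
  case (24 x y \<delta> A B C a A' x' y' B')
  have t: "s_triangle K y x \<delta>" "s_triangle K y' x' (pull K a C \<delta>)" using 24 by simp_all
  have d [simp]: "x \<in> Arr K" "Dom K x = B" "Cod K x = A" "y \<in> Arr K" "Dom K y = C" "Cod K y = B"
    "a \<in> Arr K" "Dom K a = A'" "Cod K a = A" "x' \<in> Arr K" "Dom K x' = B'" "Cod K x' = A'"
    "y' \<in> Arr K" "Dom K y' = C" "Cod K y' = B'"
    using 24 by (simp_all add: Mor_iff)
  have m: "y \<in> Mor K C B" "x \<in> Mor K B A" "a \<in> Mor K A' A" "y' \<in> Mor K C B'" "x' \<in> Mor K B' A'"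
    by (simp_all add: Mor_iff)
  from C3'[OF t(1) m(1-3) t(2) m(4,5)] obtain b where
    b: "s_triangle_morphism K (y', x', pull K a C \<delta>) (y, x, \<delta>) (Id K C) b a"
    and h: "\<And>P i j p q. biproduct K A' B P i j p q \<Longrightarrow>
      s_triangle K (i \<cdot> neg K x' \<boxplus> j \<cdot> b) (a \<cdot> p \<boxplus> x \<cdot> q) (push K A y' \<delta>)"
    by blast
  have [simp]: "b \<in> Arr K" "Dom K b = B'" "Cod K b = B"
    using b by (auto simp: s_triangle_morphism_def Mor_iff)
  have "s_triangle K (p \<cdot> b \<boxplus> q \<cdot> neg K x') (x \<cdot> i \<boxplus> a \<cdot> j) (push K A y' \<delta>)"
    if bp: "biproduct K B A' P p q i j" for P i j p q
  proof -
    note [simp] = biproductD(1-15)[OF bp]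
    show ?thesis using h[OF biproduct_swap[OF bp]]
      by (simp add: Add_commute[of "p \<cdot> b" "neg K (q \<cdot> x')"] Add_commute[of "x \<cdot> i" "a \<cdot> j"])
  qed
  moreover have "s_triangle_morphism (opposite K) (x, y, \<delta>) (x', y', push (opposite K) C a \<delta>) a b (Id (opposite K) C)"
    using b by (auto simp: s_triangle_morphism_def Mor_iff)
  ultimately show ?case by (intro exI[of _ b]) simp
next
  case (25 x y \<delta> A B C c C' x' y' B')
  have t: "s_triangle K y x \<delta>" "s_triangle K y' x' (push K A c \<delta>)" using 25 by simp_all
  have d [simp]: "x \<in> Arr K" "Dom K x = B" "Cod K x = A" "y \<in> Arr K" "Dom K y = C" "Cod K y = B"
    "c \<in> Arr K" "Dom K c = C" "Cod K c = C'" "x' \<in> Arr K" "Dom K x' = B'" "Cod K x' = A"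
    "y' \<in> Arr K" "Dom K y' = C'" "Cod K y' = B'"
    using 25 by (simp_all add: Mor_iff)
  have m: "y \<in> Mor K C B" "x \<in> Mor K B A" "c \<in> Mor K C C'" "y' \<in> Mor K C' B'" "x' \<in> Mor K B' A"
    by (simp_all add: Mor_iff)
  from C3[OF t(1) m(1-3) t(2) m(4,5)] obtain b where
    b: "s_triangle_morphism K (y, x, \<delta>) (y', x', push K A c \<delta>) c b (Id K A)"
    and h: "\<And>P i j p q. biproduct K B C' P i j p q \<Longrightarrow>
      s_triangle K (i \<cdot> y \<boxplus> j \<cdot> c) (b \<cdot> p \<boxplus> neg K y' \<cdot> q) (pull K x' C \<delta>)"
    by blast
  have [simp]: "b \<in> Arr K" "Dom K b = B" "Cod K b = B'"
    using b by (auto simp: s_triangle_morphism_def Mor_iff)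
  have "s_triangle K (p \<cdot> c \<boxplus> q \<cdot> y) (neg K y' \<cdot> i \<boxplus> b \<cdot> j) (pull K x' C \<delta>)"
    if bp: "biproduct K C' B P p q i j" for P i j p q
  proof -
    note [simp] = biproductD(1-15)[OF bp]
    show ?thesis using h[OF biproduct_swap[OF bp]]
      by (simp add: Add_commute[of "p \<cdot> c" "q \<cdot> y"] Add_commute[of "neg K (y' \<cdot> i)" "b \<cdot> j"])
  qed
  moreover have "s_triangle_morphism (opposite K) (x', y', pull (opposite K) c A \<delta>) (x, y, \<delta>) (Id (opposite K) A) b c"
    using b by (auto simp: s_triangle_morphism_def Mor_iff)
  ultimately show ?case by (intro exI[of _ b]) simp
next
  case 26 then show ?case using C4' by (auto simp: closed_under_comp_def)
next
  case 27 then show ?case using C4 by (auto simp: closed_under_comp_def)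
qed

section \<open>Extensions and exact sequences\<close>

lemma EMap_closed:
  assumes "c \<in> Arr K" "a \<in> Arr K" "\<delta> \<in> carrier (Ext K (Cod K c) (Dom K a))"
  shows "EMap K c a \<delta> \<in> carrier (Ext K (Dom K c) (Cod K a))"
  using EMap_hom[of c "Dom K c" "Cod K c" a "Dom K a" "Cod K a"] assms
  by (auto simp: Mor_iff hom_def Pi_iff)

lemma pull_closed [simp]:
  "c \<in> Arr K \<Longrightarrow> A \<in> Obj K \<Longrightarrow> Dom K c = C' \<Longrightarrow> \<delta> \<in> carrier (Ext K (Cod K c) A) \<Longrightarrow>
    pull K c A \<delta> \<in> carrier (Ext K C' A)"
  using EMap_closed[of c "Id K A" \<delta>] by (simp add: pull_def)

lemma push_closed [simp]:
  "a \<in> Arr K \<Longrightarrow> C \<in> Obj K \<Longrightarrow> Cod K a = A' \<Longrightarrow> \<delta> \<in> carrier (Ext K C (Dom K a)) \<Longrightarrow>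
    push K C a \<delta> \<in> carrier (Ext K C A')"
  using EMap_closed[of "Id K C" a \<delta>] by (simp add: push_def)

lemma pull_Id [simp]: "C \<in> Obj K \<Longrightarrow> A \<in> Obj K \<Longrightarrow> \<delta> \<in> carrier (Ext K C A) \<Longrightarrow> pull K (Id K C) A \<delta> = \<delta>"
  by (simp add: pull_def EMap_Id)

lemma push_Id [simp]: "C \<in> Obj K \<Longrightarrow> A \<in> Obj K \<Longrightarrow> \<delta> \<in> carrier (Ext K C A) \<Longrightarrow> push K C (Id K A) \<delta> = \<delta>"
  by (simp add: push_def EMap_Id)

lemma pull_Comp:
  assumes "c \<in> Arr K" "c' \<in> Arr K" "Cod K c' = Dom K c" "A \<in> Obj K" "\<delta> \<in> carrier (Ext K (Cod K c) A)"
  shows "pull K (c \<cdot> c') A \<delta> = pull K c' A (pull K c A \<delta>)"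
  using EMap_Comp[of c "Dom K c" "Cod K c" c' "Dom K c'" "Id K A" A A "Id K A" A \<delta>] assms
  by (simp add: pull_def Mor_iff)

lemma push_Comp:
  assumes "a \<in> Arr K" "a' \<in> Arr K" "Cod K a = Dom K a'" "C \<in> Obj K" "\<delta> \<in> carrier (Ext K C (Dom K a))"
  shows "push K C (a' \<cdot> a) \<delta> = push K C a' (push K C a \<delta>)"
  using EMap_Comp[of "Id K C" C C "Id K C" C a "Dom K a" "Cod K a" a' "Cod K a'" \<delta>] assms
  by (simp add: push_def Mor_iff)

lemma push_pull:
  assumes "c \<in> Arr K" "a \<in> Arr K" "Dom K c = C'" "Dom K a = A" "\<delta> \<in> carrier (Ext K (Cod K c) A)"
  shows "push K C' a (pull K c A \<delta>) = pull K c (Cod K a) (push K (Cod K c) a \<delta>)"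
proof -
  have "push K C' a (pull K c A \<delta>) = EMap K c a \<delta>"
    using EMap_Comp[of c C' "Cod K c" "Id K C'" C' "Id K A" A A a "Cod K a" \<delta>] assms
    by (auto simp: push_def pull_def Mor_iff)
  also have "\<dots> = pull K c (Cod K a) (push K (Cod K c) a \<delta>)"
    using EMap_Comp[of "Id K (Cod K c)" "Cod K c" "Cod K c" c C' a A "Cod K a" "Id K (Cod K a)" "Cod K a" \<delta>] assms
    by (auto simp: push_def pull_def Mor_iff)
  finally show ?thesis .
qed

lemma pull_Add:
  assumes "c \<in> Arr K" "c' \<in> Arr K" "Dom K c = C'" "Dom K c' = C'" "Cod K c' = Cod K c"
    "A \<in> Obj K" "\<delta> \<in> carrier (Ext K (Cod K c) A)"
  shows "pull K (c \<boxplus> c') A \<delta> = pull K c A \<delta> \<otimes>\<^bsub>Ext K C' A\<^esub> pull K c' A \<delta>"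
  using EMap_Add_left[of c C' "Cod K c" c' "Id K A" A A \<delta>] assms by (simp add: pull_def Mor_iff)

lemma pull_mult:
  assumes "c \<in> Arr K" "Dom K c = C'" "Cod K c = C" "A \<in> Obj K"
    "\<delta> \<in> carrier (Ext K C A)" "\<epsilon> \<in> carrier (Ext K C A)"
  shows "pull K c A (\<delta> \<otimes>\<^bsub>Ext K C A\<^esub> \<epsilon>) = pull K c A \<delta> \<otimes>\<^bsub>Ext K C' A\<^esub> pull K c A \<epsilon>"
  using EMap_hom[of c C' C "Id K A" A A] assms by (simp add: pull_def Mor_iff hom_def)

lemma push_mult:
  assumes "a \<in> Arr K" "Dom K a = A" "Cod K a = A'" "C \<in> Obj K"
    "\<delta> \<in> carrier (Ext K C A)" "\<epsilon> \<in> carrier (Ext K C A)"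
  shows "push K C a (\<delta> \<otimes>\<^bsub>Ext K C A\<^esub> \<epsilon>) = push K C a \<delta> \<otimes>\<^bsub>Ext K C A'\<^esub> push K C a \<epsilon>"
  using EMap_hom[of "Id K C" C C a A A'] assms by (simp add: push_def Mor_iff hom_def)

lemma Ext_group: "C \<in> Obj K \<Longrightarrow> A \<in> Obj K \<Longrightarrow> group (Ext K C A)"
  using Ext_comm_group by (simp add: comm_group_def)

lemma one_Ext [simp]: "C \<in> Obj K \<Longrightarrow> A \<in> Obj K \<Longrightarrow> \<one>\<^bsub>Ext K C A\<^esub> \<in> carrier (Ext K C A)"
  using Ext_group group.is_monoid monoid.one_closed by metis

lemma pull_one [simp]:
  assumes "c \<in> Arr K" "A \<in> Obj K" "Cod K c = C"
  shows "pull K c A \<one>\<^bsub>Ext K C A\<^esub> = \<one>\<^bsub>Ext K (Dom K c) A\<^esub>"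
proof -
  interpret G: group "Ext K C A" using assms by (intro Ext_group) auto
  interpret H: group "Ext K (Dom K c) A" using assms by (intro Ext_group) auto
  have "pull K c A \<in> hom (Ext K C A) (Ext K (Dom K c) A)"
    using assms by (auto simp: hom_def pull_mult)
  then interpret group_hom "Ext K C A" "Ext K (Dom K c) A" "pull K c A"
    by unfold_locales
  show ?thesis by (rule hom_one)
qed

lemma pull_Zero [simp]:
  assumes "A \<in> Obj K" "B \<in> Obj K" "C \<in> Obj K" "\<delta> \<in> carrier (Ext K C A)"
  shows "pull K (Zero K B C) A \<delta> = \<one>\<^bsub>Ext K B A\<^esub>"
proof -
  interpret G: group "Ext K B A" using assms by (intro Ext_group)
  have "pull K (Zero K B C) A \<delta> = pull K (Zero K B C) A \<delta> \<otimes>\<^bsub>Ext K B A\<^esub> pull K (Zero K B C) A \<delta>"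
    using pull_Add[of "Zero K B C" "Zero K B C" B A \<delta>] assms by simp
  then show ?thesis
    using G.l_cancel_one[of "pull K (Zero K B C) A \<delta>" "pull K (Zero K B C) A \<delta>"] assms by simp
qed

lemma push_one [simp]:
  assumes "a \<in> Arr K" "C \<in> Obj K" "Dom K a = A"
  shows "push K C a \<one>\<^bsub>Ext K C A\<^esub> = \<one>\<^bsub>Ext K C (Cod K a)\<^esub>"
  using extriangulated_category.pull_one[OF opposite_extriangulated, of a C A] assms by simp

lemma pull_diff:
  assumes "pull K f A \<delta> = pull K g A \<delta>" "f \<in> Arr K" "g \<in> Arr K" "Dom K g = Dom K f" "Cod K g = Cod K f"
    "A \<in> Obj K" "\<delta> \<in> carrier (Ext K (Cod K f) A)"
  shows "pull K (f \<boxplus> neg K g) A \<delta> = \<one>\<^bsub>Ext K (Dom K f) A\<^esub>"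
proof -
  have "pull K (f \<boxplus> neg K g) A \<delta> = pull K (g \<boxplus> neg K g) A \<delta>"
    using assms pull_Add[of f "neg K g" "Dom K f" A \<delta>] pull_Add[of g "neg K g" "Dom K f" A \<delta>]
    by (simp del: Add_units(3))
  then show ?thesis using assms by simp
qed

lemma tri_Comp [simp]: "s_triangle K x y \<delta> \<Longrightarrow> y \<cdot> x = Zero K (Dom K x) (Cod K y)"
proof -
  assume t: "s_triangle K x y \<delta>"
  note d = s_triangleD[OF t]
  have "x \<cdot> Id K (Dom K x) \<in> (\<lambda>f. x \<cdot> f) ` Mor K (Dom K x) (Dom K x)"
    using d by (intro imageI) (simp add: Mor_iff)
  then show ?thesis using C1[OF t, of "Dom K x" "Dom K y" "Cod K y" "Dom K x"] d
    by (simp add: Mor_iff kernel_def)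
qed

lemma tri_Comp_Comp:
  assumes "s_triangle K x y \<delta>" "f \<in> Arr K" "Cod K f = Dom K x"
  shows "y \<cdot> (x \<cdot> f) = Zero K (Dom K f) (Cod K y)"
  using Comp_assoc_Arr[of f x y] tri_Comp[OF assms(1)] assms s_triangleD[OF assms(1)] by simp

lemma lift_inflation:
  assumes t: "s_triangle K x y \<delta>" and g: "g \<in> Arr K" "Cod K g = Dom K y" "y \<cdot> g = Zero K (Dom K g) (Cod K y)"
  obtains f where "f \<in> Arr K" "Dom K f = Dom K g" "Cod K f = Dom K x" "x \<cdot> f = g"
proof -
  note d = s_triangleD[OF t]
  have "g \<in> (\<lambda>f. x \<cdot> f) ` Mor K (Dom K g) (Dom K x)"
    using C1[OF t, of "Dom K x" "Dom K y" "Cod K y" "Dom K g"] d g by (simp add: Mor_iff kernel_def)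
  then show thesis using that by (auto simp: Mor_iff)
qed

lemma lift_deflation:
  assumes t: "s_triangle K x y \<delta>" and g: "g \<in> Arr K" "Cod K g = Cod K y" "pull K g (Dom K x) \<delta> = \<one>\<^bsub>Ext K (Dom K g) (Dom K x)\<^esub>"
  obtains f where "f \<in> Arr K" "Dom K f = Dom K g" "Cod K f = Dom K y" "y \<cdot> f = g"
proof -
  note d = s_triangleD[OF t]
  have "g \<in> (\<lambda>f. y \<cdot> f) ` Mor K (Dom K g) (Dom K y)"
    using C1[OF t, of "Dom K x" "Dom K y" "Cod K y" "Dom K g"] d g by (simp add: Mor_iff kernel_def)
  then show thesis using that by (auto simp: Mor_iff)
qed

lemma tri_pull: "s_triangle K x y \<delta> \<Longrightarrow> pull K y (Dom K x) \<delta> = \<one>\<^bsub>Ext K (Dom K y) (Dom K x)\<^esub>"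
proof -
  assume t: "s_triangle K x y \<delta>"
  note d = s_triangleD[OF t]
  have "y \<cdot> Id K (Dom K y) \<in> (\<lambda>f. y \<cdot> f) ` Mor K (Dom K y) (Dom K y)"
    using d by (intro imageI) (simp add: Mor_iff)
  then show ?thesis using C1[OF t, of "Dom K x" "Dom K y" "Cod K y" "Dom K y"] d
    by (simp add: Mor_iff kernel_def)
qed

lemma tri_push: "s_triangle K x y \<delta> \<Longrightarrow> push K (Cod K y) x \<delta> = \<one>\<^bsub>Ext K (Cod K y) (Dom K y)\<^esub>"
  using extriangulated_category.tri_pull[OF opposite_extriangulated, of y x \<delta>] s_triangleD(3)[of x y \<delta>] by simp

lemma extend_deflation:
  assumes t: "s_triangle K x y \<delta>" and g: "g \<in> Arr K" "Dom K g = Dom K y" "g \<cdot> x = Zero K (Dom K x) (Cod K g)"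
  obtains f where "f \<in> Arr K" "Cod K f = Cod K g" "Dom K f = Cod K y" "f \<cdot> y = g"
  using extriangulated_category.lift_inflation[OF opposite_extriangulated, of y x \<delta> g thesis] assms
    s_triangleD(3)[OF t] by simp

lemma extend_inflation:
  assumes t: "s_triangle K x y \<delta>" and g: "g \<in> Arr K" "Dom K g = Dom K x" "push K (Cod K y) g \<delta> = \<one>\<^bsub>Ext K (Cod K y) (Cod K g)\<^esub>"
  obtains f where "f \<in> Arr K" "Cod K f = Cod K g" "Dom K f = Dom K y" "f \<cdot> x = g"
  using extriangulated_category.lift_deflation[OF opposite_extriangulated, of y x \<delta> g thesis] assms
    s_triangleD(3)[OF t] by simp

lemma realizeE:
  assumes "\<delta> \<in> carrier (Ext K C A)" "C \<in> Obj K" "A \<in> Obj K"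
  obtains x y where "s_triangle K x y \<delta>" "Dom K x = A" "Cod K y = C"
proof -
  obtain x y where "(x, y) \<in> sequences K A C" "Realize K C A \<delta> = seq_class K x y"
    using Realize_class[OF assms(2,3,1)] by blast
  then show thesis using assms that[of x y] by (auto simp: sequences_def Mor_iff s_triangle_def)
qed

text \<open>
  Replacing the middle term by an isomorphic object does not change the equivalence class.
\<close>

lemma tri_transport:
  assumes t: "s_triangle K x y \<delta>"
    and b: "b \<in> Arr K" "c \<in> Arr K" "Dom K b = Dom K y" "Cod K c = Dom K y" "Dom K c = Cod K b"
      "c \<cdot> b = Id K (Dom K y)" "b \<cdot> c = Id K (Cod K b)"
  shows "s_triangle K (b \<cdot> x) (y \<cdot> c) \<delta>"
proof -
  note d = s_triangleD[OF t]
  have sub: "seq_class K (b \<cdot> x) (y \<cdot> c) \<subseteq> seq_class K x y"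
    if d: "x \<in> Arr K" "y \<in> Arr K" "Cod K x = Dom K y"
    and b: "b \<in> Arr K" "c \<in> Arr K" "Dom K b = Dom K y" "Cod K c = Dom K y" "Dom K c = Cod K b"
      "c \<cdot> b = Id K (Dom K y)" "b \<cdot> c = Id K (Cod K b)" for x y b c
  proof (rule subrelI)
    fix x' y' assume m: "(x', y') \<in> seq_class K (b \<cdot> x) (y \<cdot> c)"
    have bc: "b \<cdot> x \<in> Arr K" "y \<cdot> c \<in> Arr K" "Cod K (b \<cdot> x) = Dom K (y \<cdot> c)"
      "Dom K (b \<cdot> x) = Dom K x" "Cod K (y \<cdot> c) = Cod K y" "Dom K (y \<cdot> c) = Cod K b"
      using d b by simp_all
    obtain e f where s: "x' \<in> Arr K" "y' \<in> Arr K" "Cod K x' = Dom K y'" "Dom K x' = Dom K x" "Cod K y' = Cod K y"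
      and e: "e \<in> Arr K" "f \<in> Arr K" "Dom K e = Cod K b" "Cod K e = Dom K y'" "Dom K f = Dom K y'" "Cod K f = Cod K b"
      and i: "f \<cdot> e = Id K (Cod K b)" "e \<cdot> f = Id K (Dom K y')" "e \<cdot> (b \<cdot> x) = x'" "y' \<cdot> e = y \<cdot> c"
      using m unfolding seq_class_iff[OF bc(1-3)] bc(4-6) by blast
    have "(c \<cdot> f) \<cdot> (e \<cdot> b) = c \<cdot> ((f \<cdot> e) \<cdot> b)" using b e by simp
    then have 1: "(c \<cdot> f) \<cdot> (e \<cdot> b) = Id K (Dom K y)" using b e i by simp
    have "(e \<cdot> b) \<cdot> (c \<cdot> f) = e \<cdot> ((b \<cdot> c) \<cdot> f)" using b(1-5) e by simp
    then have 2: "(e \<cdot> b) \<cdot> (c \<cdot> f) = Id K (Dom K y')" using b e i by simp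
    have "y' \<cdot> (e \<cdot> b) = (y' \<cdot> e) \<cdot> b" using b e s by simp
    then have 3: "y' \<cdot> (e \<cdot> b) = y" using b e i d by simp
    have 4: "(e \<cdot> b) \<cdot> x = x'" using b e i d by simp
    show "(x', y') \<in> seq_class K x y" unfolding seq_class_iff[OF d]
      using s 1 2 3 4 b(1-5) e by (intro conjI exI[of _ "e \<cdot> b"] exI[of _ "c \<cdot> f"]) (assumption | simp)+
  qed
  have 1: "c \<cdot> (b \<cdot> x) = x" using Comp_assoc_Arr[of x b c] b d by simp
  have 2: "(y \<cdot> c) \<cdot> b = y" using b d by simp
  have "seq_class K (c \<cdot> (b \<cdot> x)) ((y \<cdot> c) \<cdot> b) \<subseteq> seq_class K (b \<cdot> x) (y \<cdot> c)"
    by (rule sub) (simp_all only: Arr_Comp d b)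
  then have "seq_class K (b \<cdot> x) (y \<cdot> c) = seq_class K x y"
    using sub[OF d(1-3) b] unfolding 1 2 by (rule equalityI[rotated])
  then show ?thesis using t d b by (simp add: s_triangle_def)
qed

text \<open>
  Exactness of \<open>C(X,C) \<rightarrow> E(X,A) \<rightarrow> E(X,B)\<close>. The extensions
  \<open>\<theta>\<close> and \<open>\<delta>\<close> are glued to one extension \<open>E\<close> of \<open>X \<oplus> C\<close> by
  \<open>A\<close>, realized by \<open>A \<rightarrow> H \<rightarrow> X \<oplus> C\<close>. Pulling it back to \<open>C\<close>
  gives \<open>\<delta>\<close>, so by (C3') there is a triangle
  \<open>B \<rightarrow> C \<oplus> H \<rightarrow> X \<oplus> C\<close> with extension \<open>x\<^sub>* E = 0\<close>. The inclusion of
  \<open>X\<close> therefore lifts to \<open>C \<oplus> H\<close>; the component \<open>X \<rightarrow> C\<close> of the lift is the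
  required morphism.
\<close>

lemma push_one_imp_pull:
  assumes t: "s_triangle K x y \<delta>" and X: "X \<in> Obj K" and th: "\<theta> \<in> carrier (Ext K X (Dom K x))"
    and p: "push K X x \<theta> = \<one>\<^bsub>Ext K X (Dom K y)\<^esub>"
  obtains c where "c \<in> Arr K" "Dom K c = X" "Cod K c = Cod K y" "pull K c (Dom K x) \<delta> = \<theta>"
proof -
  note d [simp] = s_triangleD[OF t]
  note [simp] = X th
  define A where "A = Dom K x"
  define C where "C = Cod K y"
  have [simp]: "A \<in> Obj K" "C \<in> Obj K" "Dom K x = A" "Cod K y = C" "\<delta> \<in> carrier (Ext K C A)" "\<theta> \<in> carrier (Ext K X A)"
    using d th by (simp_all add: A_def C_def del: d th)
  obtain S i j p' q' where bp: "biproduct K X C S i j p' q'" using ex_biproduct[of X C] by auto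
  note [simp] = biproductD(1-15)[OF bp]
  define E where "E = pull K p' A \<theta> \<otimes>\<^bsub>Ext K S A\<^esub> pull K q' A \<delta>"
  interpret GS: group "Ext K S A" by (rule Ext_group) simp_all
  interpret GX: group "Ext K X A" by (rule Ext_group) simp_all
  interpret GC: group "Ext K C A" by (rule Ext_group) simp_all
  have E [simp]: "E \<in> carrier (Ext K S A)" unfolding E_def by (rule GS.m_closed) simp_all
  have pE: "pull K f A E = pull K (p' \<cdot> f) A \<theta> \<otimes>\<^bsub>Ext K (Dom K f) A\<^esub> pull K (q' \<cdot> f) A \<delta>"
    if "f \<in> Arr K" "Cod K f = S" for f
    unfolding E_def using that by (simp add: pull_mult pull_Comp)
  \<comment> \<open>\<open>E\<close> restricts to \<open>\<delta>\<close> on \<open>C\<close> and to \<open>\<theta>\<close> on \<open>X\<close>.\<close>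
  have jE: "pull K j A E = \<delta>" using biproductD[OF bp] by (simp add: pE)
  have iE: "pull K i A E = \<theta>" using biproductD[OF bp] by (simp add: pE)
  obtain u w where uw: "s_triangle K u w E" "Dom K u = A" "Cod K w = S"
    using realizeE[OF E] by auto
  note [simp] = uw(2,3) s_triangleD[OF uw(1)]
  obtain b where "b \<in> Arr K" "Dom K b = Dom K y" "Cod K b = Dom K w"
    and h: "\<And>P i' j' p q. biproduct K (Dom K j) (Dom K w) P i' j' p q \<Longrightarrow>
      s_triangle K (i' \<cdot> neg K y \<boxplus> j' \<cdot> b) (j \<cdot> p \<boxplus> w \<cdot> q) (push K (Cod K w) x E)"
    using pullbackE[OF uw(1), of j x y] t jE by simp blast
  obtain P i' j' r s where bp': "biproduct K (Dom K j) (Dom K w) P i' j' r s"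
    using ex_biproduct[of "Dom K j" "Dom K w"] by auto
  note [simp] = biproductD(1-15)[OF bp']
  have "push K S x E = \<one>\<^bsub>Ext K S (Dom K y)\<^esub>"
  proof -
    interpret H: group "Ext K S (Dom K y)" by (rule Ext_group) simp_all
    have "push K S x E = push K S x (pull K p' A \<theta>) \<otimes>\<^bsub>Ext K S (Dom K y)\<^esub> push K S x (pull K q' A \<delta>)"
      unfolding E_def by (simp add: push_mult)
    also have "push K S x (pull K p' A \<theta>) = \<one>\<^bsub>Ext K S (Dom K y)\<^esub>" using p by (simp add: push_pull)
    also have "push K S x (pull K q' A \<delta>) = \<one>\<^bsub>Ext K S (Dom K y)\<^esub>" using tri_push[OF t] by (simp add: push_pull)
    finally show ?thesis by simp
  qed
  then have t': "s_triangle K (i' \<cdot> neg K y \<boxplus> j' \<cdot> b) (j \<cdot> r \<boxplus> w \<cdot> s) \<one>\<^bsub>Ext K S (Dom K y)\<^esub>"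
    using h[OF bp'] by simp
  note [simp] = s_triangleD[OF t'] \<open>b \<in> Arr K\<close> \<open>Dom K b = Dom K y\<close> \<open>Cod K b = Dom K w\<close>
  obtain g where [simp]: "g \<in> Arr K" "Dom K g = X" "Cod K g = P" and g: "(j \<cdot> r \<boxplus> w \<cdot> s) \<cdot> g = i"
    using lift_deflation[OF t', of i] by auto
  define s1 s2 where "s1 = r \<cdot> g" and "s2 = s \<cdot> g"
  have [simp]: "s1 \<in> Arr K" "Dom K s1 = X" "Cod K s1 = C" "s2 \<in> Arr K" "Dom K s2 = X" "Cod K s2 = Dom K w"
    by (simp_all add: s1_def s2_def)
  have g': "j \<cdot> s1 \<boxplus> w \<cdot> s2 = i" using g by (simp add: s1_def s2_def)
  have "p' \<cdot> (j \<cdot> s1 \<boxplus> w \<cdot> s2) = Id K X" "q' \<cdot> (j \<cdot> s1 \<boxplus> w \<cdot> s2) = Zero K X C"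
    using biproductD[OF bp] g' by simp_all
  then have e: "p' \<cdot> (w \<cdot> s2) = Id K X" "s1 \<boxplus> q' \<cdot> (w \<cdot> s2) = Zero K X C"
    by (simp_all add: biproduct_Comp[OF bp])
  have "pull K (w \<cdot> s2) A E = \<one>\<^bsub>Ext K X A\<^esub>" using tri_pull[OF uw(1)] by (simp add: pull_Comp)
  then have 1: "\<theta> \<otimes>\<^bsub>Ext K X A\<^esub> pull K (q' \<cdot> (w \<cdot> s2)) A \<delta> = \<one>\<^bsub>Ext K X A\<^esub>"
    using e by (simp add: pE)
  have "pull K (s1 \<boxplus> q' \<cdot> (w \<cdot> s2)) A \<delta> = \<one>\<^bsub>Ext K X A\<^esub>" unfolding e by simp
  then have 2: "pull K s1 A \<delta> \<otimes>\<^bsub>Ext K X A\<^esub> pull K (q' \<cdot> (w \<cdot> s2)) A \<delta> = \<one>\<^bsub>Ext K X A\<^esub>"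
    by (simp add: pull_Add)
  have "pull K s1 A \<delta> = \<theta>"
    by (rule GX.right_cancel[THEN iffD1, of "pull K (q' \<cdot> (w \<cdot> s2)) A \<delta>"]) (use 1 2 in simp_all)
  then show thesis using that[of s1] by simp
qed

lemma pull_one_imp_push:
  assumes t: "s_triangle K x y \<delta>" and X: "X \<in> Obj K" and th: "\<theta> \<in> carrier (Ext K (Cod K y) X)"
    and p: "pull K y X \<theta> = \<one>\<^bsub>Ext K (Dom K y) X\<^esub>"
  obtains a where "a \<in> Arr K" "Cod K a = X" "Dom K a = Dom K x" "push K (Cod K y) a \<delta> = \<theta>"
  using extriangulated_category.push_one_imp_pull[OF opposite_extriangulated, of y x \<delta> X \<theta> thesis] assms
    s_triangleD(3)[OF t] by simp

section \<open>Cones and pushouts of inflations\<close>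

text \<open>
  The morphisms of triangles in (C3) and (C3'), without and with the triangle on the biproduct.
\<close>

lemma push_square:
  assumes t: "s_triangle K x y \<delta>" and a: "a \<in> Arr K" "Dom K a = Dom K x"
    and t': "s_triangle K x' y' (push K (Cod K y) a \<delta>)" "Dom K x' = Cod K a" "Cod K y' = Cod K y"
  obtains b where "b \<in> Arr K" "Dom K b = Dom K y" "Cod K b = Dom K y'" "b \<cdot> x = x' \<cdot> a" "y' \<cdot> b = y"
  by (rule pushoutE[OF t a t']) (rule that)

lemma pull_square:
  assumes t: "s_triangle K x y \<delta>" and c: "c \<in> Arr K" "Cod K c = Cod K y"
    and t': "s_triangle K x' y' (pull K c (Dom K x) \<delta>)" "Dom K x' = Dom K x" "Cod K y' = Dom K c"
  obtains b where "b \<in> Arr K" "Dom K b = Dom K y'" "Cod K b = Dom K y" "b \<cdot> x' = x" "y \<cdot> b = c \<cdot> y'"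
  by (rule pullbackE[OF t c t']) (rule that)

lemma push_triangle:
  assumes t: "s_triangle K x y \<delta>" and a: "a \<in> Arr K" "Dom K a = Dom K x"
    and t': "s_triangle K x' y' (push K (Cod K y) a \<delta>)" "Dom K x' = Cod K a" "Cod K y' = Cod K y"
    and bp: "biproduct K (Dom K y) (Cod K a) P i j p q"
  obtains b where "b \<in> Arr K" "Dom K b = Dom K y" "Cod K b = Dom K y'" "b \<cdot> x = x' \<cdot> a" "y' \<cdot> b = y"
    "s_triangle K (i \<cdot> x \<boxplus> j \<cdot> a) (b \<cdot> p \<boxplus> neg K x' \<cdot> q) (pull K y' (Dom K x) \<delta>)"
proof (rule pushoutE[OF t a t'])
  fix b
  assume 1: "b \<in> Arr K" "Dom K b = Dom K y" "Cod K b = Dom K y'" "b \<cdot> x = x' \<cdot> a" "y' \<cdot> b = y"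
    and 2: "\<And>P i j p q. biproduct K (Dom K y) (Cod K a) P i j p q \<Longrightarrow>
      s_triangle K (i \<cdot> x \<boxplus> j \<cdot> a) (b \<cdot> p \<boxplus> neg K x' \<cdot> q) (pull K y' (Dom K x) \<delta>)"
  show thesis by (rule that[OF 1 2[OF bp]])
qed

lemma pull_triangle:
  assumes t: "s_triangle K x y \<delta>" and c: "c \<in> Arr K" "Cod K c = Cod K y"
    and t': "s_triangle K x' y' (pull K c (Dom K x) \<delta>)" "Dom K x' = Dom K x" "Cod K y' = Dom K c"
    and bp: "biproduct K (Dom K c) (Dom K y) P i j p q"
  obtains b where "b \<in> Arr K" "Dom K b = Dom K y'" "Cod K b = Dom K y" "b \<cdot> x' = x" "y \<cdot> b = c \<cdot> y'"
    "s_triangle K (i \<cdot> neg K y' \<boxplus> j \<cdot> b) (c \<cdot> p \<boxplus> y \<cdot> q) (push K (Cod K y) x' \<delta>)"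
proof (rule pullbackE[OF t c t'])
  fix b
  assume 1: "b \<in> Arr K" "Dom K b = Dom K y'" "Cod K b = Dom K y" "b \<cdot> x' = x" "y \<cdot> b = c \<cdot> y'"
    and 2: "\<And>P i j p q. biproduct K (Dom K c) (Dom K y) P i j p q \<Longrightarrow>
      s_triangle K (i \<cdot> neg K y' \<boxplus> j \<cdot> b) (c \<cdot> p \<boxplus> y \<cdot> q) (push K (Cod K y) x' \<delta>)"
  show thesis by (rule that[OF 1 2[OF bp]])
qed

text \<open>
  Since \<open>x\<close> kills \<open>\<delta>\<close>, there is \<open>c\<close> with \<open>\<delta> = c\<^sup>* \<delta>'\<close>, and
  correcting \<open>c\<close> by a morphism that factors through \<open>y'\<close> gives a morphism \<open>u\<close> of
  cones that is compatible both with \<open>y\<close>, \<open>y'\<close> and with the extensions. It is split epic by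
  exactness at \<open>E(C',A)\<close>, and monic by exactness at the preceding terms.
\<close>

lemma cone_unique:
  assumes t: "s_triangle K x y \<delta>" and t': "s_triangle K x y' \<delta>'"
  obtains u v where "u \<in> Arr K" "Dom K u = Cod K y" "Cod K u = Cod K y'"
    "v \<in> Arr K" "Dom K v = Cod K y'" "Cod K v = Cod K y"
    "v \<cdot> u = Id K (Cod K y)" "u \<cdot> v = Id K (Cod K y')" "u \<cdot> y = y'"
proof -
  define A B C C' where defs: "A = Dom K x" "B = Dom K y" "C = Cod K y" "C' = Cod K y'"
  note d = s_triangleD[OF t] s_triangleD[OF t']
  have [simp]: "A \<in> Obj K" "B \<in> Obj K" "C \<in> Obj K" "C' \<in> Obj K" by (simp_all add: defs d)
  have [simp]: "x \<in> Arr K" "Dom K x = A" "Cod K x = B" "y \<in> Arr K" "Dom K y = B" "Cod K y = C"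
    "y' \<in> Arr K" "Dom K y' = B" "Cod K y' = C'" "\<delta> \<in> carrier (Ext K C A)" "\<delta>' \<in> carrier (Ext K C' A)"
    using d by (simp_all add: defs)
  have [simp]: "push K C x \<delta> = \<one>\<^bsub>Ext K C B\<^esub>" "push K C' x \<delta>' = \<one>\<^bsub>Ext K C' B\<^esub>"
    using tri_push[OF t] tri_push[OF t'] by simp_all
  obtain c where [simp]: "c \<in> Arr K" "Dom K c = C" "Cod K c = C'" "pull K c A \<delta>' = \<delta>"
    using push_one_imp_pull[OF t', of C \<delta>] by auto
  obtain b where [simp]: "b \<in> Arr K" "Dom K b = B" "Cod K b = B" and b: "b \<cdot> x = x" "y' \<cdot> b = c \<cdot> y"
    by (rule pull_square[OF t', of c x y]) (use t in simp_all)
  obtain h where [simp]: "h \<in> Arr K" "Dom K h = C" "Cod K h = B" and h: "h \<cdot> y = b \<boxplus> neg K (Id K B)"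
    using extend_deflation[OF t, of "b \<boxplus> neg K (Id K B)"] b by auto
  \<comment> \<open>The correction makes \<open>u y = y'\<close>, and keeps \<open>u\<^sup>* \<delta>' = \<delta>\<close> since \<open>y'\<close> kills \<open>\<delta>'\<close>.\<close>
  define u where "u = c \<boxplus> neg K (y' \<cdot> h)"
  have [simp]: "u \<in> Arr K" "Dom K u = C" "Cod K u = C'" by (simp_all add: u_def)
  have uy: "u \<cdot> y = y'" by (simp add: u_def h b Add_cancel)
  have [simp]: "pull K y' A \<delta>' = \<one>\<^bsub>Ext K B A\<^esub>" using tri_pull[OF t'] by simp
  have pu: "pull K u A \<delta>' = \<delta>"
  proof -
    interpret G: group "Ext K C A" by (rule Ext_group) simp_all
    have "pull K u A \<delta>' = pull K c A \<delta>' \<otimes>\<^bsub>Ext K C A\<^esub> pull K (y' \<cdot> neg K h) A \<delta>'"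
      unfolding u_def by (subst pull_Add) simp_all
    also have "pull K (y' \<cdot> neg K h) A \<delta>' = \<one>\<^bsub>Ext K C A\<^esub>" by (subst pull_Comp) simp_all
    finally show ?thesis by simp
  qed
  obtain k where [simp]: "k \<in> Arr K" "Dom K k = C'" "Cod K k = C" "pull K k A \<delta> = \<delta>'"
    using push_one_imp_pull[OF t, of C' \<delta>'] by auto
  have "pull K (Id K C' \<boxplus> neg K (u \<cdot> k)) A \<delta>' = \<one>\<^bsub>Ext K C' A\<^esub>"
    using pull_diff[of "Id K C'" A \<delta>' "u \<cdot> k"] by (simp add: pull_Comp pu)
  then obtain m where [simp]: "m \<in> Arr K" "Dom K m = C'" "Cod K m = B" and m: "y' \<cdot> m = Id K C' \<boxplus> neg K (u \<cdot> k)"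
    using lift_deflation[OF t', of "Id K C' \<boxplus> neg K (u \<cdot> k)"] by auto
  define v where "v = k \<boxplus> y \<cdot> m"
  have [simp]: "v \<in> Arr K" "Dom K v = C'" "Cod K v = C" by (simp_all add: v_def)
  have "u \<cdot> (y \<cdot> m) = y' \<cdot> m" using uy Comp_assoc_Arr[of m y u] by simp
  then have uv: "u \<cdot> v = Id K C'" by (simp add: v_def m Add_left_commute)
  define z where "z = v \<cdot> u \<boxplus> neg K (Id K C)"
  have [simp]: "z \<in> Arr K" "Dom K z = C" "Cod K z = C" by (simp_all add: z_def)
  have uz: "u \<cdot> z = Zero K C C'"
    using uv Comp_assoc_Arr[of u v u] by (simp add: z_def)
  have "pull K z A (pull K u A \<delta>') = \<one>\<^bsub>Ext K C A\<^esub>" 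
    by (subst pull_Comp[symmetric]) (simp_all add: uz)
  then obtain n where [simp]: "n \<in> Arr K" "Dom K n = C" "Cod K n = B" and n: "y \<cdot> n = z"
    using lift_deflation[OF t, of z] pu by auto
  have "y' \<cdot> n = u \<cdot> (y \<cdot> n)" using uy Comp_assoc_Arr[of n y u] by simp
  then have "y' \<cdot> n = Zero K C C'" by (simp add: n uz)
  then obtain l where [simp]: "l \<in> Arr K" "Dom K l = C" "Cod K l = A" "x \<cdot> l = n"
    using lift_inflation[OF t', of n] by auto
  have "z = Zero K C C" using n tri_Comp_Comp[OF t, of l] by simp
  then have "v \<cdot> u = Id K C" using Add_cancel(3)[of "v \<cdot> u" "Id K C"] by (simp add: z_def)
  then show thesis using that[of u v] uv uy by simp
qed

text \<open>
  The sum of a triangle and the trivial triangle \<open>M \<rightarrow> M \<rightarrow> 0\<close>. A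
  realization \<open>A \<oplus> M \<rightarrow> B1 \<rightarrow> C\<close> of the pushed extension receives a morphism
  \<open>f\<close> from the sum, and \<open>f\<close> has a right and a left inverse by the two halves of the five
  lemma.
\<close>

lemma tri_add_object:
  assumes t: "s_triangle K x y \<delta>"
    and P: "biproduct K (Dom K x) M P i j p q" and P': "biproduct K (Dom K y) M P' i' j' p' q'"
  shows "s_triangle K (i' \<cdot> (x \<cdot> p) \<boxplus> j' \<cdot> q) (y \<cdot> p') (push K (Cod K y) i \<delta>)"
proof -
  define A B C where defs: "A = Dom K x" "B = Dom K y" "C = Cod K y"
  note d = s_triangleD[OF t]
  have [simp]: "A \<in> Obj K" "B \<in> Obj K" "C \<in> Obj K" by (simp_all add: defs d)
  have [simp]: "x \<in> Arr K" "Dom K x = A" "Cod K x = B" "y \<in> Arr K" "Dom K y = B" "Cod K y = C"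
    "\<delta> \<in> carrier (Ext K C A)"
    using d by (simp_all add: defs)
  note P = P[folded defs] and P' = P'[folded defs]
  note [simp] = biproductD(1-15)[OF P] biproductD(1-15)[OF P']
  obtain x1 y1 where t1: "s_triangle K x1 y1 (push K C i \<delta>)" and [simp]: "Dom K x1 = P" "Cod K y1 = C"
    using realizeE[of "push K C i \<delta>" C P] by auto
  note [simp] = s_triangleD(1-3)[OF t1]
  define B1 where "B1 = Dom K y1"
  have [simp]: "Dom K y1 = B1" "B1 \<in> Obj K" by (simp_all add: B1_def)
  obtain b where [simp]: "b \<in> Arr K" "Dom K b = B" "Cod K b = B1" and b: "b \<cdot> x = x1 \<cdot> i" "y1 \<cdot> b = y"
    by (rule push_square[OF t, of i x1 y1]) (use t1 in simp_all)
  define f where "f = b \<cdot> p' \<boxplus> x1 \<cdot> (j \<cdot> q')"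
  define s where "s = i' \<cdot> (x \<cdot> p) \<boxplus> j' \<cdot> q"
  have [simp]: "f \<in> Arr K" "Dom K f = P'" "Cod K f = B1" "s \<in> Arr K" "Dom K s = P" "Cod K s = P'"
    by (simp_all add: f_def s_def)
  have fi: "f \<cdot> i' = b" "f \<cdot> j' = x1 \<cdot> j"
    using biproductD[OF P'] by (simp_all add: f_def)
  have si: "s \<cdot> i = i' \<cdot> x" "s \<cdot> j = j'"
    using biproductD[OF P] by (simp_all add: s_def)
  have "f \<cdot> s = (f \<cdot> i') \<cdot> (x \<cdot> p) \<boxplus> (f \<cdot> j') \<cdot> q" by (simp add: s_def)
  also have "\<dots> = (b \<cdot> x) \<cdot> p \<boxplus> x1 \<cdot> (j \<cdot> q)" by (simp add: fi)
  also have "\<dots> = x1 \<cdot> (i \<cdot> p \<boxplus> j \<cdot> q)" unfolding b by simp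
  finally have fs: "f \<cdot> s = x1" by (simp add: biproductD[OF P] del: Comp_Add_Arr)
  have "y1 \<cdot> (b \<cdot> p') = y \<cdot> p'" using b(2) Comp_assoc_Arr[of p' b y1] by simp
  then have yf: "y1 \<cdot> f = y \<cdot> p'" by (simp add: f_def tri_Comp_Comp[OF t1])
  \<comment> \<open>A right inverse, from the covariant exact sequences: \<open>y1\<close> kills \<open>\<delta>\<close>, hence lifts along \<open>y\<close>.\<close>
  have "push K B1 i (pull K y1 A \<delta>) = \<one>\<^bsub>Ext K B1 P\<^esub>"
    using tri_pull[OF t1] by (simp add: push_pull)
  then have "push K B1 p (push K B1 i (pull K y1 A \<delta>)) = \<one>\<^bsub>Ext K B1 A\<^esub>" by simp
  then have "pull K y1 A \<delta> = \<one>\<^bsub>Ext K B1 A\<^esub>"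
    using push_Comp[of i p B1 "pull K y1 A \<delta>"] biproductD(16)[OF P] by simp
  then obtain h where [simp]: "h \<in> Arr K" "Dom K h = B1" "Cod K h = B" and h: "y \<cdot> h = y1"
    using lift_deflation[OF t, of y1] by auto
  have "y1 \<cdot> (f \<cdot> (i' \<cdot> h)) = (y1 \<cdot> f) \<cdot> (i' \<cdot> h)" by simp
  then have "y1 \<cdot> (f \<cdot> (i' \<cdot> h)) = y1" by (simp add: yf biproduct_Comp[OF P'] h del: fi)
  then obtain n where [simp]: "n \<in> Arr K" "Dom K n = B1" "Cod K n = P" and n: "x1 \<cdot> n = Id K B1 \<boxplus> neg K (f \<cdot> (i' \<cdot> h))"
    using lift_inflation[OF t1, of "Id K B1 \<boxplus> neg K (f \<cdot> (i' \<cdot> h))"] by auto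
  define r where "r = i' \<cdot> h \<boxplus> s \<cdot> n"
  have [simp]: "r \<in> Arr K" "Dom K r = B1" "Cod K r = P'" by (simp_all add: r_def)
  have "f \<cdot> (s \<cdot> n) = x1 \<cdot> n" using fs Comp_assoc_Arr[of n s f] by simp
  then have fr: "f \<cdot> r = Id K B1" by (simp add: r_def n Add_left_commute)
  \<comment> \<open>A left inverse, from the contravariant ones: \<open>s\<close> kills the pushed extension, hence extends along \<open>x1\<close>.\<close>
  have "push K C s (push K C i \<delta>) = push K C (i' \<cdot> x) \<delta>"
    by (simp add: push_Comp[symmetric] si)
  also have "\<dots> = \<one>\<^bsub>Ext K C P'\<^esub>" using tri_push[OF t] by (simp add: push_Comp)
  finally obtain g where [simp]: "g \<in> Arr K" "Dom K g = B1" "Cod K g = P'" and g: "g \<cdot> x1 = s"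
    using extend_inflation[OF t1, of s] by auto
  define z where "z = Id K P' \<boxplus> neg K (g \<cdot> f)"
  have [simp]: "z \<in> Arr K" "Dom K z = P'" "Cod K z = P'" by (simp_all add: z_def)
  have zs: "z \<cdot> s = Zero K P P'" by (simp add: z_def fs g)
  have "z \<cdot> (s \<cdot> i) = Zero K A P'" "z \<cdot> (s \<cdot> j) = Zero K M P'"
    using zs Comp_assoc_Arr[of i s z] Comp_assoc_Arr[of j s z] by simp_all
  then have zx: "(z \<cdot> i') \<cdot> x = Zero K A P'" and zj: "z \<cdot> j' = Zero K M P'" by (simp_all add: si)
  obtain w where [simp]: "w \<in> Arr K" "Dom K w = C" "Cod K w = P'" and w: "w \<cdot> y = z \<cdot> i'"
    using extend_deflation[OF t, of "z \<cdot> i'"] zx by auto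
  have "z = z \<cdot> (i' \<cdot> p' \<boxplus> j' \<cdot> q')" unfolding biproductD(20)[OF P'] by simp
  also have "\<dots> = (z \<cdot> i') \<cdot> p' \<boxplus> (z \<cdot> j') \<cdot> q'" by simp
  also have "\<dots> = w \<cdot> (y \<cdot> p')" unfolding zj w[symmetric] by simp
  also have "\<dots> = (w \<cdot> y1) \<cdot> f" by (simp add: yf)
  finally have z: "z = (w \<cdot> y1) \<cdot> f" .
  define l where "l = g \<boxplus> w \<cdot> y1"
  have [simp]: "l \<in> Arr K" "Dom K l = B1" "Cod K l = P'" by (simp_all add: l_def)
  have "l \<cdot> f = g \<cdot> f \<boxplus> z" unfolding z by (simp add: l_def)
  then have lf: "l \<cdot> f = Id K P'" by (simp add: z_def Add_left_commute)
  have "l = l \<cdot> (f \<cdot> r)" using fr by simp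
  also have "\<dots> = (l \<cdot> f) \<cdot> r" by simp
  also have "\<dots> = r" unfolding lf by simp
  finally have "l = r" .
  then have tl: "s_triangle K (l \<cdot> x1) (y1 \<cdot> f) (push K C i \<delta>)"
    using lf fr by (intro tri_transport[OF t1]) simp_all
  have "(l \<cdot> f) \<cdot> s = s" unfolding lf by simp
  then have "l \<cdot> (f \<cdot> s) = s" by simp
  then have "l \<cdot> x1 = s" unfolding fs .
  then show ?thesis using tl unfolding yf s_def by simp
qed

text \<open>
  The pushout of \<open>e\<close> along \<open>f\<close> yields, by (C3), a conflation beginning with \<open>[f; e]\<close>.
\<close>

lemma inflation_pair:
  assumes t: "s_triangle K e w \<epsilon>" and f: "f \<in> Arr K" "Dom K f = Dom K e"
    and bp: "biproduct K (Cod K f) (Cod K e) P i j p q"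
  shows "\<exists>y \<delta>. s_triangle K (i \<cdot> f \<boxplus> j \<cdot> e) y \<delta>"
proof -
  note [simp] = s_triangleD[OF t] f biproductD(1-15)[OF bp]
  obtain x' y' where t': "s_triangle K x' y' (push K (Cod K w) f \<epsilon>)" "Dom K x' = Cod K f" "Cod K y' = Cod K w"
    using realizeE[of "push K (Cod K w) f \<epsilon>" "Cod K w" "Cod K f"] by auto
  have "biproduct K (Dom K w) (Cod K f) P j i q p" using biproduct_swap[OF bp] by simp
  then obtain b where "s_triangle K (j \<cdot> e \<boxplus> i \<cdot> f) (b \<cdot> q \<boxplus> neg K x' \<cdot> p) (pull K y' (Dom K e) \<epsilon>)"
    by (rule push_triangle[OF t f t'])
  then show ?thesis by (auto simp: Add_commute[of "i \<cdot> f" "j \<cdot> e"])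
qed

text \<open>
  In a pushout square of two inflations, parallel sides have the same cone. Pushing \<open>x\<close> along
  \<open>a\<close> and \<open>a\<close> along \<open>x\<close> gives two triangles that begin with \<open>[x; a]\<close>, so their
  cones are isomorphic, and \<open>b\<close> is identified with an inflation with the cone of \<open>a\<close>.
\<close>

lemma pushout_conflation:
  assumes t: "s_triangle K x y \<delta>" and a: "s_triangle K a m \<mu>" "Dom K a = Dom K x"
    and t': "s_triangle K x' y' (push K (Cod K y) a \<delta>)" "Dom K x' = Cod K a" "Cod K y' = Cod K y"
  obtains b n \<nu> where "s_triangle K b n \<nu>" "Dom K b = Dom K y" "Cod K b = Dom K y'" "Cod K n = Cod K m"
    "b \<cdot> x = x' \<cdot> a" "y' \<cdot> b = y"
proof -
  note [simp] = s_triangleD[OF t] s_triangleD[OF a(1)] a(2) s_triangleD[OF t'(1)] t'(2,3)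
    s_triangleD(4)[OF a(1), unfolded a(2)]
  obtain P i j p q where bp: "biproduct K (Dom K y) (Cod K a) P i j p q" using ex_biproduct[of "Dom K y" "Cod K a"] by auto
  note [simp] = biproductD(1-15)[OF bp]
  obtain b where [simp]: "b \<in> Arr K" "Dom K b = Dom K y" "Cod K b = Dom K y'" and b: "b \<cdot> x = x' \<cdot> a" "y' \<cdot> b = y"
    and tb: "s_triangle K (i \<cdot> x \<boxplus> j \<cdot> a) (b \<cdot> p \<boxplus> neg K x' \<cdot> q) (pull K y' (Dom K x) \<delta>)"
    by (rule push_triangle[OF t s_triangleD(1)[OF a(1)] a(2) t' bp])
  obtain l n where t2: "s_triangle K l n (push K (Cod K m) x \<mu>)" and l [simp]: "Dom K l = Cod K x" "Cod K n = Cod K m"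
    using realizeE[of "push K (Cod K m) x \<mu>" "Cod K m" "Cod K x"] by auto
  note [simp] = s_triangleD(1-3)[OF t2]
  obtain b2 where [simp]: "b2 \<in> Arr K" "Dom K b2 = Dom K m" "Cod K b2 = Dom K n"
    and tb2: "s_triangle K (j \<cdot> a \<boxplus> i \<cdot> x) (b2 \<cdot> q \<boxplus> neg K l \<cdot> p) (pull K n (Dom K a) \<mu>)"
    by (rule push_triangle[OF a(1), of x l n P j i q p]) (use t2 biproduct_swap[OF bp] in simp_all)
  have "s_triangle K (i \<cdot> x \<boxplus> j \<cdot> a) (b2 \<cdot> q \<boxplus> neg K l \<cdot> p) (pull K n (Dom K a) \<mu>)"
    using tb2 by (simp add: Add_commute[of "i \<cdot> x" "j \<cdot> a"])
  from cone_unique[OF tb this] obtain u v where [simp]: "u \<in> Arr K" "Dom K u = Dom K y'" "Cod K u = Dom K n"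
    "v \<in> Arr K" "Dom K v = Dom K n" "Cod K v = Dom K y'"
    and uv: "v \<cdot> u = Id K (Dom K y')" "u \<cdot> v = Id K (Dom K n)"
    and e: "u \<cdot> (b \<cdot> p \<boxplus> neg K x' \<cdot> q) = b2 \<cdot> q \<boxplus> neg K l \<cdot> p"
    by simp metis
  have "(u \<cdot> (b \<cdot> p \<boxplus> neg K x' \<cdot> q)) \<cdot> i = u \<cdot> b" using biproductD[OF bp] by simp
  moreover have "(b2 \<cdot> q \<boxplus> neg K l \<cdot> p) \<cdot> i = neg K l" using biproductD[OF bp] by simp
  ultimately have "u \<cdot> b = neg K l" unfolding e by simp
  moreover have "v \<cdot> (u \<cdot> b) = b" using uv Comp_assoc_Arr[of b u v] by simp
  ultimately have vl: "neg K v \<cdot> l = b" by simp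
  have "s_triangle K (neg K v \<cdot> l) (n \<cdot> neg K u) (push K (Cod K m) x \<mu>)"
    using uv by (intro tri_transport[OF t2]) simp_all
  then show thesis using that[of b "n \<cdot> neg K u"] b vl by simp
qed

lemma pull_conflation:
  assumes t: "s_triangle K x y \<delta>" and c: "s_triangle K k c \<kappa>" "Cod K c = Cod K y"
    and t': "s_triangle K x' y' (pull K c (Dom K x) \<delta>)" "Dom K x' = Dom K x" "Cod K y' = Dom K c"
  obtains b n \<nu> where "s_triangle K n b \<nu>" "Cod K b = Dom K y" "Dom K b = Dom K y'" "Dom K n = Dom K k"
    "y \<cdot> b = c \<cdot> y'" "b \<cdot> x' = x"
  using extriangulated_category.pushout_conflation[OF opposite_extriangulated, of y x \<delta> c k \<kappa> y' x' thesis]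
    assms s_triangleD(3)[OF t] s_triangleD(3)[OF c(1)] s_triangleD(3)[OF t'(1)]
  by simp

lemma push_Add:
  assumes "a \<in> Arr K" "a' \<in> Arr K" "Cod K a = A'" "Cod K a' = A'" "Dom K a' = Dom K a"
    "C \<in> Obj K" "\<delta> \<in> carrier (Ext K C (Dom K a))"
  shows "push K C (a \<boxplus> a') \<delta> = push K C a \<delta> \<otimes>\<^bsub>Ext K C A'\<^esub> push K C a' \<delta>"
  using extriangulated_category.pull_Add[OF opposite_extriangulated, of a a' A' C \<delta>] assms by simp

text \<open>
  This is \<open>0 \<rightarrow> M \<rightarrow> M\<close> with the object \<open>A\<close> added.
\<close>

lemma split_triangle:
  assumes bp: "biproduct K A M P i j p q"
  shows "s_triangle K i q \<one>\<^bsub>Ext K M A\<^esub>"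
proof -
  note [simp] = biproductD(1-15)[OF bp]
  obtain Z where Z: "zero_object K Z" using ex_zero_object by blast
  have [simp]: "Z \<in> Obj K" using Z by (simp add: zero_object_def)
  have "\<exists>!f. f \<in> Mor K Z Z" using Z unfolding zero_object_def by blast
  moreover have "Id K Z \<in> Mor K Z Z" "Zero K Z Z \<in> Mor K Z Z" by (simp_all add: Mor_iff)
  ultimately have IdZ: "Id K Z = Zero K Z Z" by blast
  have t: "s_triangle K (Zero K Z M) (Id K M) \<one>\<^bsub>Ext K M Z\<^esub>"
    using C2'[OF Z, of M] by (simp add: s_triangle_def)
  have 1: "biproduct K Z A A (Zero K Z A) (Id K A) (Zero K A Z) (Id K A)"
    by (simp add: biproduct_def Mor_iff IdZ)
  have 2: "biproduct K M A P j i q p" by (rule biproduct_swap[OF bp])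
  show ?thesis using tri_add_object[OF t, of A A "Zero K Z A" "Id K A" "Zero K A Z" "Id K A" P j i q p] 1 2
    by simp
qed

end

section \<open>Monomorphisms and epimorphisms modulo a biresolving subcategory\<close>

locale biresolving_subcategory = extriangulated_category K
  for K :: "('o, 'm, 'e, 'x) extri_category_scheme" (structure) and N :: "'o set" +
  assumes biresolving: "biresolving K N"
begin

sublocale additive_subcat K N
  using biresolving by unfold_locales (simp add: biresolving_def thick_def)

lemma opposite_biresolving: "biresolving (opposite K) N"
proof -
  have 1: "additive_subcategory (opposite K) N"
  proof -
    have ex: "(\<exists>i j p q. biproduct (opposite K) A B P i j p q) = (\<exists>i j p q. biproduct K A B P i j p q)" for A B P
      using opposite_biproduct[of K A B P] by meson
    show ?thesis using additive_subcat unfolding additive_subcategory_def ex by simp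
  qed
  have th: "thick K N" using biresolving by (simp add: biresolving_def)
  note th = th[unfolded thick_def, THEN conjunct2]
  note iso = th[THEN conjunct1] and bip = th[THEN conjunct2, THEN conjunct1] and con = th[THEN conjunct2, THEN conjunct2]
  have "Dom K f \<in> N" if f: "is_iso K f" "Cod K f \<in> N" for f
  proof -
    obtain g where "is_iso K g" "Dom K g = Cod K f" "Cod K g = Dom K f"
      using f(1) unfolding is_iso_iff by metis
    then show ?thesis using iso f(2) by metis
  qed
  moreover have "A \<in> N \<and> B \<in> N" if "biproduct (opposite K) A B P i j p q" "P \<in> N" for A B P i j p q
    using bip that(2) that(1)[unfolded opposite_biproduct] by blast
  moreover have "(A \<in> N \<and> B \<in> N \<longrightarrow> C \<in> N) \<and> (A \<in> N \<and> C \<in> N \<longrightarrow> B \<in> N) \<and> (B \<in> N \<and> C \<in> N \<longrightarrow> A \<in> N)"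
    if "s_conflation (opposite K) x y" "x \<in> Mor (opposite K) A B" "y \<in> Mor (opposite K) B C" for x y A B C
  proof -
    have "s_conflation K y x" "x \<in> Mor K B A" "y \<in> Mor K C B" using that by simp_all
    then show ?thesis using con by blast
  qed
  ultimately have 2: "thick (opposite K) N" unfolding thick_def opposite_is_iso opposite_simps
    using 1 by blast
  show ?thesis using biresolving 2 by (auto simp: biresolving_def)
qed

lemma opposite_biresolving_subcategory: "biresolving_subcategory (opposite K) N"
  using opposite_extriangulated opposite_biresolving
  by (simp add: biresolving_subcategory_def biresolving_subcategory_axioms_def)

lemma opposite_null: "additive_subcat.null (opposite K) N f \<longleftrightarrow> null f"
proof -
  interpret D: biresolving_subcategory "opposite K" N by (rule opposite_biresolving_subcategory)
  show ?thesis by (simp add: D.null_def null_def)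
qed

lemma opposite_mono_epi:
  "additive_subcat.mono_mod (opposite K) N f \<longleftrightarrow> epi_mod f"
  "additive_subcat.epi_mod (opposite K) N f \<longleftrightarrow> mono_mod f"
  "additive_subcat.weq (opposite K) N f \<longleftrightarrow> weq f"
proof -
  interpret D: biresolving_subcategory "opposite K" N by (rule opposite_biresolving_subcategory)
  show *: "D.mono_mod f \<longleftrightarrow> epi_mod f" "D.epi_mod f \<longleftrightarrow> mono_mod f"
    unfolding D.mono_mod_def D.epi_mod_def mono_mod_def epi_mod_def opposite_null by simp_all
  show "D.weq f \<longleftrightarrow> weq f" unfolding D.weq_def weq_def * by auto
qed

lemmas opposite_mod = opposite_null opposite_mono_epi

lemma tri_N:
  assumes "s_triangle K x y \<delta>"
  shows "Dom K x \<in> N \<Longrightarrow> Dom K y \<in> N \<Longrightarrow> Cod K y \<in> N"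
    and "Dom K x \<in> N \<Longrightarrow> Cod K y \<in> N \<Longrightarrow> Dom K y \<in> N"
    and "Dom K y \<in> N \<Longrightarrow> Cod K y \<in> N \<Longrightarrow> Dom K x \<in> N"
proof -
  note d = s_triangleD[OF assms]
  have "s_conflation K x y" "x \<in> Mor K (Dom K x) (Dom K y)" "y \<in> Mor K (Dom K y) (Cod K y)"
    using assms d by (auto simp: s_conflation_def Mor_iff)
  moreover have "\<forall>x y A B C. s_conflation K x y \<and> x \<in> Mor K A B \<and> y \<in> Mor K B C \<longrightarrow>
      (A \<in> N \<and> B \<in> N \<longrightarrow> C \<in> N) \<and> (A \<in> N \<and> C \<in> N \<longrightarrow> B \<in> N) \<and> (B \<in> N \<and> C \<in> N \<longrightarrow> A \<in> N)"
    using biresolving unfolding biresolving_def thick_def by (elim conjE)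
  ultimately show "Dom K x \<in> N \<Longrightarrow> Dom K y \<in> N \<Longrightarrow> Cod K y \<in> N"
    "Dom K x \<in> N \<Longrightarrow> Cod K y \<in> N \<Longrightarrow> Dom K y \<in> N"
    "Dom K y \<in> N \<Longrightarrow> Cod K y \<in> N \<Longrightarrow> Dom K x \<in> N"
    by blast+
qed

lemma inflation_into_N:
  assumes "A \<in> Obj K"
  obtains x y \<delta> where "s_triangle K x y \<delta>" "Dom K x = A" "Dom K y \<in> N"
proof -
  obtain M x where "M \<in> N" "x \<in> Mor K A M" "s_inflation K x"
    using biresolving assms unfolding biresolving_def by blast
  then show thesis using that s_triangleD(3) by (auto simp: s_inflation_def s_conflation_def Mor_iff)
qed

lemma deflation_from_N:
  assumes "A \<in> Obj K"
  obtains x y \<delta> where "s_triangle K x y \<delta>" "Cod K y = A" "Dom K y \<in> N"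
proof -
  obtain M y where "M \<in> N" "y \<in> Mor K M A" "s_deflation K y"
    using biresolving assms unfolding biresolving_def by blast
  then show thesis using that s_triangleD(3) by (auto simp: s_deflation_def s_conflation_def Mor_iff)
qed

lemma biproduct_in_N:
  assumes "X \<in> N" "Y \<in> N"
  obtains P i j p q where "P \<in> N" "biproduct K X Y P i j p q"
proof -
  have "\<forall>A \<in> N. \<forall>B \<in> N. \<exists>P \<in> N. \<exists>i j p q. biproduct K A B P i j p q"
    using additive_subcat unfolding additive_subcategory_def by (elim conjE)
  from bspec[OF bspec[OF this assms(1)] assms(2)] show thesis
    by (elim bexE exE) (rule that)
qed

lemma summand_in_N: "biproduct K A B P i j p q \<Longrightarrow> P \<in> N \<Longrightarrow> A \<in> N"
  using biresolving unfolding biresolving_def thick_def by metis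

text \<open>
  If the identity of \<open>F\<close> factors through \<open>M\<close> in \<open>N\<close>, then \<open>F\<close> is a retract of
  \<open>M\<close>, but idempotents need not split, so \<open>F\<close> need not be a direct summand of \<open>M\<close>.
  Adding an inflation \<open>F \<rightarrow> M'\<close> with \<open>M'\<close> in \<open>N\<close> turns the section into an
  inflation. Its extension is zero because it has a retraction, so \<open>F\<close> is a direct summand of
  \<open>M \<oplus> M'\<close>.
\<close>

lemma null_Id_imp_N:
  assumes "null (Id K F)" and [simp]: "F \<in> Obj K"
  shows "F \<in> N"
proof -
  obtain M u v where M: "M \<in> N" and uv: "u \<in> Arr K" "v \<in> Arr K" "Dom K u = Dom K (Id K F)" "Cod K u = M"
    "Dom K v = M" "Cod K v = Cod K (Id K F)" and vu: "Id K F = v \<cdot> u"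
    by (rule nullE[OF assms(1)])
  have [simp]: "u \<in> Arr K" "v \<in> Arr K" "Dom K u = F" "Cod K u = M" "Dom K v = M" "Cod K v = F"
    using uv by simp_all
  obtain e w \<epsilon> where e: "s_triangle K e w \<epsilon>" "Dom K e = F" "Dom K w \<in> N"
    using inflation_into_N[of F] by auto
  obtain P i j p q where P: "P \<in> N" and bp: "biproduct K M (Dom K w) P i j p q"
    using biproduct_in_N[OF M e(3)] .
  note [simp] = biproductD(1-15)[OF bp] s_triangleD(1-3)[OF e(1)] e(2)
  define x where "x = i \<cdot> u \<boxplus> j \<cdot> e"
  have [simp]: "x \<in> Arr K" "Dom K x = F" "Cod K x = P" by (simp_all add: x_def)
  obtain y \<delta> where t: "s_triangle K x y \<delta>"
    using inflation_pair[OF e(1), of u P i j p q] bp by (auto simp: x_def)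
  have [simp]: "y \<in> Arr K" "Dom K y = P" "\<delta> \<in> carrier (Ext K (Cod K y) F)"
    using s_triangleD[OF t] by simp_all
  define C where "C = Cod K y"
  have [simp]: "C \<in> Obj K" by (simp add: C_def)
  have [simp]: "Cod K y = C" by (simp add: C_def)
  define r where "r = v \<cdot> p"
  have [simp]: "r \<in> Arr K" "Dom K r = P" "Cod K r = F" by (simp_all add: r_def)
  have rx: "r \<cdot> x = Id K F" by (simp add: r_def x_def vu biproduct_Comp[OF bp])
  have dC [simp]: "\<delta> \<in> carrier (Ext K C F)" using s_triangleD(4)[OF t] by simp
  have "\<delta> = push K C (r \<cdot> x) \<delta>" unfolding rx by simp
  also have "\<dots> = \<one>\<^bsub>Ext K C F\<^esub>" using tri_push[OF t] by (simp add: push_Comp)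
  finally obtain s0 where [simp]: "s0 \<in> Arr K" "Dom K s0 = C" "Cod K s0 = P" and s0: "y \<cdot> s0 = Id K C"
    using lift_deflation[OF t, of "Id K C"] by auto
  define s where "s = s0 \<boxplus> neg K (x \<cdot> (r \<cdot> s0))"
  have [simp]: "s \<in> Arr K" "Dom K s = C" "Cod K s = P" by (simp_all add: s_def)
  have ys: "y \<cdot> s = Id K C" by (simp add: s_def s0 tri_Comp_Comp[OF t])
  have "r \<cdot> (x \<cdot> (r \<cdot> s0)) = (r \<cdot> x) \<cdot> (r \<cdot> s0)" by simp
  then have "r \<cdot> (x \<cdot> (r \<cdot> s0)) = r \<cdot> s0" unfolding rx by simp
  then have rs: "r \<cdot> s = Zero K C F" by (simp add: s_def)
  define z where "z = Id K P \<boxplus> neg K (x \<cdot> r)"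
  have [simp]: "z \<in> Arr K" "Dom K z = P" "Cod K z = P" by (simp_all add: z_def)
  have "z \<cdot> x = Zero K F P" by (simp add: z_def rx)
  then obtain h where [simp]: "h \<in> Arr K" "Dom K h = C" "Cod K h = P" and h: "h \<cdot> y = z"
    using extend_deflation[OF t, of z] by auto
  have "h = h \<cdot> (y \<cdot> s)" unfolding ys by simp
  also have "\<dots> = z \<cdot> s" unfolding h[symmetric] by simp
  also have "\<dots> = s" by (simp add: z_def rs)
  finally have "s \<cdot> y = z" using h by simp
  then have "x \<cdot> r \<boxplus> s \<cdot> y = Id K P" by (simp add: z_def Add_left_commute)
  then have "biproduct K F C P x s r y"
    using rx ys rs tri_Comp[OF t] by (simp add: biproduct_def Mor_iff)
  then show ?thesis using P by (rule summand_in_N)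
qed

lemma null_through_N:
  assumes "u \<in> Arr K" "v \<in> Arr K" "Cod K u = Dom K v" "Dom K v \<in> N"
  shows "null (v \<cdot> u)"
  using nullI[of u v "Dom K v"] assms by simp

text \<open>
  Let \<open>r g = v u\<close> factor through \<open>M\<close> in \<open>N\<close>. The pullback of \<open>r\<close> along \<open>v\<close>
  is an extension of \<open>M\<close> by the cocone of \<open>r\<close>, hence lies in \<open>N\<close>, and \<open>(u, g)\<close>
  induces a factorization of \<open>g\<close> through it.
\<close>

lemma deflation_mono_mod:
  assumes t: "s_triangle K n r \<rho>" and n: "Dom K n \<in> N"
  shows "mono_mod r"
  unfolding mono_mod_def
proof (intro ballI impI)
  fix g assume g [simp]: "g \<in> Arr K" "Cod K g = Dom K r" and rg: "null (r \<cdot> g)"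
  note [simp] = s_triangleD[OF t]
  obtain M u v where M: "M \<in> N" and uv: "u \<in> Arr K" "v \<in> Arr K" "Dom K u = Dom K (r \<cdot> g)" "Cod K u = M"
    "Dom K v = M" "Cod K v = Cod K (r \<cdot> g)" and vu: "r \<cdot> g = v \<cdot> u"
    by (rule nullE[OF rg])
  have [simp]: "u \<in> Arr K" "v \<in> Arr K" "Dom K u = Dom K g" "Cod K u = M" "Dom K v = M" "Cod K v = Cod K r"
    using uv by simp_all
  have [simp]: "M \<in> Obj K" using M by (rule N_Obj)
  obtain x' y' where t': "s_triangle K x' y' (pull K v (Dom K n) \<rho>)" "Dom K x' = Dom K n" "Cod K y' = Dom K v"
    using realizeE[of "pull K v (Dom K n) \<rho>" M "Dom K n"] by auto
  note [simp] = s_triangleD(1-3)[OF t'(1)] t'(2,3)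
  have y': "Dom K y' \<in> N" using tri_N(2)[OF t'(1)] M n by simp
  obtain P i j p q where bp: "biproduct K M (Dom K r) P i j p q"
    using ex_biproduct[of M "Dom K r"] by auto
  note [simp] = biproductD(1-15)[OF bp]
  obtain b where [simp]: "b \<in> Arr K" "Dom K b = Dom K y'" "Cod K b = Dom K r"
    and tb: "s_triangle K (i \<cdot> neg K y' \<boxplus> j \<cdot> b) (v \<cdot> p \<boxplus> r \<cdot> q) (push K (Cod K r) x' \<rho>)"
    by (rule pull_triangle[OF t _ _ t', of P i j p q]) (use bp in simp_all)
  define h where "h = i \<cdot> neg K u \<boxplus> j \<cdot> g"
  have [simp]: "h \<in> Arr K" "Dom K h = Dom K g" "Cod K h = P" by (simp_all add: h_def)
  have "(v \<cdot> p \<boxplus> r \<cdot> q) \<cdot> h = Zero K (Dom K g) (Cod K r)"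
    by (simp add: h_def biproduct_Comp[OF bp] vu)
  then obtain f where [simp]: "f \<in> Arr K" "Dom K f = Dom K g" "Cod K f = Dom K y'"
    and f: "(i \<cdot> neg K y' \<boxplus> j \<cdot> b) \<cdot> f = h"
    using lift_inflation[OF tb, of h] by auto
  have "b \<cdot> f = q \<cdot> ((i \<cdot> neg K y' \<boxplus> j \<cdot> b) \<cdot> f)" by (simp add: biproduct_Comp[OF bp])
  also have "\<dots> = g" unfolding f by (simp add: h_def biproduct_Comp[OF bp])
  finally have "b \<cdot> f = g" .
  moreover have "null (b \<cdot> f)" by (rule null_through_N) (simp_all add: y')
  ultimately show "null g" by simp
qed

lemma inflation_epi_mod:
  assumes t: "s_triangle K l y \<delta>" and y: "Cod K y \<in> N"
  shows "epi_mod l"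
  using biresolving_subcategory.deflation_mono_mod[OF opposite_biresolving_subcategory, of y l \<delta>] assms
  by (simp add: opposite_mod)

lemma weqI:
  assumes "f \<in> Arr K" "\<And>g. g \<in> Arr K \<Longrightarrow> Cod K g = Dom K f \<Longrightarrow> null (f \<cdot> g) \<Longrightarrow> null g"
    "\<And>g. g \<in> Arr K \<Longrightarrow> Dom K g = Cod K f \<Longrightarrow> null (g \<cdot> f) \<Longrightarrow> null g"
  shows "weq f"
  unfolding weq_def mono_mod_def epi_mod_def using assms by blast

lemma weqD:
  assumes "weq f"
  shows "f \<in> Arr K" "mono_mod f" "epi_mod f"
  using assms by (simp_all add: weq_def)

lemma weq_Comp:
  assumes "weq f" "weq g" "Cod K f = Dom K g"
  shows "weq (g \<cdot> f)"
proof -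
  note f = weqD[OF assms(1)] and g = weqD[OF assms(2)]
  note [simp] = f(1) g(1) assms(3)
  show ?thesis
  proof (rule weqI)
    fix h assume h: "h \<in> Arr K" "Cod K h = Dom K (g \<cdot> f)" "null ((g \<cdot> f) \<cdot> h)"
    then have "null (g \<cdot> (f \<cdot> h))" by simp
    then have "null (f \<cdot> h)" by (rule mono_modD[OF g(2), rotated 2]) (use h in simp_all)
    then show "null h" by (rule mono_modD[OF f(2), rotated 2]) (use h in simp_all)
  next
    fix h assume h: "h \<in> Arr K" "Dom K h = Cod K (g \<cdot> f)" "null (h \<cdot> (g \<cdot> f))"
    then have "null ((h \<cdot> g) \<cdot> f)" by simp
    then have "null (h \<cdot> g)" by (rule epi_modD[OF f(3), rotated 2]) (use h in simp_all)
    then show "null h" by (rule epi_modD[OF g(3), rotated 2]) (use h in simp_all)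
  qed simp
qed

lemma weq_null:
  assumes "weq f" and g: "g \<in> Arr K" "Dom K g = Dom K f" "Cod K g = Cod K f" "null (f \<boxplus> neg K g)"
  shows "weq g"
proof -
  note f = weqD[OF assms(1)]
  note [simp] = f(1) g(1-3)
  show ?thesis
  proof (rule weqI)
    fix h assume h: "h \<in> Arr K" "Cod K h = Dom K g" "null (g \<cdot> h)"
    have "null ((f \<boxplus> neg K g) \<cdot> h)" by (rule null_Comp(2)[OF g(4)]) (use h in simp_all)
    then have "null (f \<cdot> h \<boxplus> neg K (g \<cdot> h))" using h by simp
    then have "null (f \<cdot> h) \<longleftrightarrow> null (g \<cdot> h)" by (rule null_diff) (use h in simp_all)
    then show "null h" using h mono_modD[OF f(2) h(1)] by simp
  next
    fix h assume h: "h \<in> Arr K" "Dom K h = Cod K g" "null (h \<cdot> g)"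
    have "null (h \<cdot> (f \<boxplus> neg K g))" by (rule null_Comp(1)[OF g(4)]) (use h in simp_all)
    then have "null (h \<cdot> f \<boxplus> neg K (h \<cdot> g))" using h by simp
    then have "null (h \<cdot> f) \<longleftrightarrow> null (h \<cdot> g)" by (rule null_diff) (use h in simp_all)
    then show "null h" using h epi_modD[OF f(3) h(1)] by simp
  qed simp
qed

lemma weq_biproduct:
  assumes bp: "biproduct K A M P i j p q" and M: "M \<in> N"
  shows "weq i" "weq p"
proof -
  note [simp] = biproductD(1-15)[OF bp]
  have "mono_mod i" unfolding mono_mod_def
  proof (intro ballI impI)
    fix g assume g: "g \<in> Arr K" "Cod K g = Dom K i" "null (i \<cdot> g)"
    then have "p \<cdot> (i \<cdot> g) = g" by (simp add: biproduct_Comp[OF bp])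
    moreover have "null (p \<cdot> (i \<cdot> g))" by (rule null_Comp(1)) (use g in simp_all)
    ultimately show "null g" by (simp only:)
  qed
  moreover have "epi_mod i" unfolding epi_mod_def
  proof (intro ballI impI)
    fix g assume g: "g \<in> Arr K" "Dom K g = Cod K i" "null (g \<cdot> i)"
    have "null ((g \<cdot> j) \<cdot> q)" by (rule null_through_N) (use g M in simp_all)
    moreover have "null ((g \<cdot> i) \<cdot> p)" by (rule null_Comp(2)) (use g in simp_all)
    ultimately have "null ((g \<cdot> i) \<cdot> p \<boxplus> (g \<cdot> j) \<cdot> q)" using g by (intro null_Add) simp_all
    moreover have "(g \<cdot> i) \<cdot> p \<boxplus> (g \<cdot> j) \<cdot> q = g \<cdot> (i \<cdot> p \<boxplus> j \<cdot> q)" using g by simp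
    moreover have "\<dots> = g" unfolding biproductD(20)[OF bp] using g by simp
    ultimately show "null g" by (simp only:)
  qed
  moreover have "epi_mod p" unfolding epi_mod_def
  proof (intro ballI impI)
    fix g assume g: "g \<in> Arr K" "Dom K g = Cod K p" "null (g \<cdot> p)"
    then have "(g \<cdot> p) \<cdot> i = g" using biproductD(16)[OF bp] by simp
    moreover have "null ((g \<cdot> p) \<cdot> i)" by (rule null_Comp(2)) (use g in simp_all)
    ultimately show "null g" by (simp only:)
  qed
  moreover have "mono_mod p" unfolding mono_mod_def
  proof (intro ballI impI)
    fix g assume g: "g \<in> Arr K" "Cod K g = Dom K p" "null (p \<cdot> g)"
    have "null (j \<cdot> (q \<cdot> g))" by (rule null_through_N[of "q \<cdot> g" j]) (use g M in simp_all)
    moreover have "null (i \<cdot> (p \<cdot> g))" by (rule null_Comp(1)) (use g in simp_all)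
    ultimately have "null (i \<cdot> (p \<cdot> g) \<boxplus> j \<cdot> (q \<cdot> g))" using g by (intro null_Add) simp_all
    moreover have "i \<cdot> (p \<cdot> g) \<boxplus> j \<cdot> (q \<cdot> g) = g" using biproduct_Comp(5)[OF bp g(1)] g by simp
    ultimately show "null g" by (simp only:)
  qed
  ultimately show "weq i" "weq p" by (simp_all add: weq_def)
qed

text \<open>
  The morphism \<open>b\<close> is \<open>[l d]\<close> for a deflation \<open>d\<close> from an object of \<open>N\<close>. The
  composite \<open>y d\<close> is a deflation between objects of \<open>N\<close>, so its cocone is in \<open>N\<close>; the
  extension \<open>\<delta>\<close> pulls back to zero along it, which makes the pullback split, and its
  projection \<open>b\<close> to the middle term has the same cocone.
\<close>

lemma inflation_factor:
  assumes t: "s_triangle K l y \<delta>" and y: "Cod K y \<in> N"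
  obtains M P i j p q n b \<rho> where "M \<in> N" "biproduct K (Dom K l) M P i j p q"
    "s_triangle K n b \<rho>" "Dom K n \<in> N" "Dom K b = P" "Cod K b = Cod K l" "b \<cdot> i = l"
proof -
  note [simp] = s_triangleD[OF t]
  obtain k d \<kappa> where k: "s_triangle K k d \<kappa>" "Cod K d = Dom K y" "Dom K d \<in> N"
    using deflation_from_N[of "Dom K y"] by auto
  note [simp] = s_triangleD(1-3)[OF k(1)] k(2)
  have "s_deflation K d" "s_deflation K y" using k(1) t by (auto simp: s_deflation_def s_conflation_def)
  then have "s_deflation K (y \<cdot> d)" using C4' k(2) by (auto simp: closed_under_comp_def)
  then obtain n c where c: "s_triangle K n (y \<cdot> d) c" by (auto simp: s_deflation_def s_conflation_def)
  have n: "Dom K n \<in> N" using tri_N(3)[OF c] k(3) y by simp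
  obtain P i j p q where bp: "biproduct K (Dom K l) (Dom K d) P i j p q"
    using ex_biproduct[of "Dom K l" "Dom K d"] by auto
  note [simp] = biproductD(1-15)[OF bp]
  have "pull K (y \<cdot> d) (Dom K l) \<delta> = \<one>\<^bsub>Ext K (Dom K d) (Dom K l)\<^esub>"
    using tri_pull[OF t] by (simp add: pull_Comp)
  then have s: "s_triangle K i q (pull K (y \<cdot> d) (Dom K l) \<delta>)" using split_triangle[OF bp] by simp
  show thesis
  proof (rule pull_conflation[OF t c _ s])
    fix b n' \<nu> assume "s_triangle K n' b \<nu>" "Cod K b = Dom K y" "Dom K b = Dom K q" "Dom K n' = Dom K n" "b \<cdot> i = l"
    then show thesis using that[OF k(3) bp, of n' b \<nu>] n by simp
  qed simp_all
qed

lemma inflation_weq: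
  assumes t: "s_triangle K l y \<delta>" and y: "Cod K y \<in> N"
  shows "weq l"
proof -
  obtain M P i j p q n b \<rho> where M: "M \<in> N" and bp: "biproduct K (Dom K l) M P i j p q"
    and b: "s_triangle K n b \<rho>" "Dom K n \<in> N" "Dom K b = P" "b \<cdot> i = l"
    using inflation_factor[OF t y] .
  note [simp] = biproductD(1-15)[OF bp] s_triangleD(1-3)[OF b(1)] b(3)
  have m: "mono_mod b" "mono_mod i" using deflation_mono_mod[OF b(1,2)] weq_biproduct(1)[OF bp M]
    by (simp_all add: weq_def)
  have "mono_mod l" unfolding mono_mod_def
  proof (intro ballI impI)
    fix g assume g [simp]: "g \<in> Arr K" "Cod K g = Dom K l" and n: "null (l \<cdot> g)"
    have "null (b \<cdot> (i \<cdot> g))" using n unfolding b(4)[symmetric] by simp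
    then have "null (i \<cdot> g)" by (intro mono_modD[OF m(1), of "i \<cdot> g"]) simp_all
    then show "null g" by (intro mono_modD[OF m(2), of g]) simp_all
  qed
  then show ?thesis using inflation_epi_mod[OF t y] s_triangleD[OF t] by (simp add: weq_def)
qed

lemma deflation_weq:
  assumes t: "s_triangle K n r \<rho>" and n: "Dom K n \<in> N"
  shows "weq r"
  using biresolving_subcategory.inflation_weq[OF opposite_biresolving_subcategory, of r n \<rho>] assms
  by (simp add: opposite_mod)

text \<open>
  By \<open>inflation_factor\<close>, \<open>e\<close> is a deflation with cocone in \<open>N\<close> up to an
  isomorphism of the quotient, and that deflation can be pulled back along \<open>g\<close>.
\<close>

lemma ore_inflation:
  assumes t: "s_triangle K e y \<delta>" and y: "Cod K y \<in> N" and g: "g \<in> Arr K" "Cod K g = Cod K e"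
  obtains s h where "weq s" "Cod K s = Dom K g" "h \<in> Arr K" "Dom K h = Dom K s" "Cod K h = Dom K e"
    "null (g \<cdot> s \<boxplus> neg K (e \<cdot> h))"
proof -
  obtain M P i j p q n b \<rho> where M: "M \<in> N" and bp: "biproduct K (Dom K e) M P i j p q"
    and b: "s_triangle K n b \<rho>" "Dom K n \<in> N" "Dom K b = P" "Cod K b = Cod K e" "b \<cdot> i = e"
    using inflation_factor[OF t y] .
  note [simp] = biproductD(1-15)[OF bp] s_triangleD[OF b(1)] b(3,4) g s_triangleD(1-3)[OF t]
    s_triangleD(4)[OF b(1), unfolded b(4) s_triangleD(3)[OF t]]
  obtain x' y' where t': "s_triangle K x' y' (pull K g (Dom K n) \<rho>)" "Dom K x' = Dom K n" "Cod K y' = Dom K g"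
    using realizeE[of "pull K g (Dom K n) \<rho>" "Dom K g" "Dom K n"] by auto
  note [simp] = s_triangleD(1-3)[OF t'(1)] t'(2,3)
  obtain b2 where [simp]: "b2 \<in> Arr K" "Dom K b2 = Dom K y'" "Cod K b2 = P" and b2: "b \<cdot> b2 = g \<cdot> y'"
    by (rule pull_square[OF b(1) _ _ t']) simp_all
  have "weq y'" using deflation_weq[OF t'(1)] b(2) by simp
  moreover have "null (g \<cdot> y' \<boxplus> neg K (e \<cdot> (p \<cdot> b2)))"
  proof -
    have "g \<cdot> y' = b \<cdot> ((i \<cdot> p \<boxplus> j \<cdot> q) \<cdot> b2)" unfolding biproductD(20)[OF bp] by (simp add: b2)
    also have "\<dots> = (b \<cdot> i) \<cdot> (p \<cdot> b2) \<boxplus> (b \<cdot> j) \<cdot> (q \<cdot> b2)" by simp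
    finally have "g \<cdot> y' = e \<cdot> (p \<cdot> b2) \<boxplus> (b \<cdot> j) \<cdot> (q \<cdot> b2)" unfolding b(5) .
    then have "g \<cdot> y' \<boxplus> neg K (e \<cdot> (p \<cdot> b2)) = (b \<cdot> j) \<cdot> (q \<cdot> b2)"
      by (simp add: Add_commute Add_cancel Add_left_commute)
    moreover have "null ((b \<cdot> j) \<cdot> (q \<cdot> b2))" by (rule null_through_N) (simp_all add: M)
    ultimately show ?thesis by simp
  qed
  ultimately show thesis using that[of y' "p \<cdot> b2"] by simp
qed

text \<open>
  A test morphism into the codomain of \<open>e\<close> lifts to its domain after composition with a weak
  equivalence, by \<open>ore_inflation\<close>.
\<close>

lemma mono_mod_cancel_inflation:
  assumes t: "s_triangle K e y \<delta>" and y: "Cod K y \<in> N" and b: "b \<in> Arr K" "Dom K b = Cod K e"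
    and m: "mono_mod (b \<cdot> e)"
  shows "mono_mod b"
  unfolding mono_mod_def
proof (intro ballI impI)
  fix g assume g [simp]: "g \<in> Arr K" "Cod K g = Dom K b" and n: "null (b \<cdot> g)"
  note [simp] = b s_triangleD(1-3)[OF t]
  obtain s h where s: "weq s" and [simp]: "Cod K s = Dom K g" "h \<in> Arr K" "Dom K h = Dom K s" "Cod K h = Dom K e"
    and sh: "null (g \<cdot> s \<boxplus> neg K (e \<cdot> h))"
    using ore_inflation[OF t y, of g] by auto
  have [simp]: "s \<in> Arr K" using s by (simp add: weq_def)
  have "null (b \<cdot> (g \<cdot> s \<boxplus> neg K (e \<cdot> h)))" by (rule null_Comp(1)[OF sh]) simp_all
  then have "null (b \<cdot> (g \<cdot> s) \<boxplus> neg K (b \<cdot> (e \<cdot> h)))" by simp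
  moreover have "null ((b \<cdot> g) \<cdot> s)" by (rule null_Comp(2)[OF n]) simp_all
  then have "null (b \<cdot> (g \<cdot> s))" by simp
  ultimately have "null (b \<cdot> (e \<cdot> h))" using null_diff[of "b \<cdot> (g \<cdot> s)" "b \<cdot> (e \<cdot> h)"] by simp
  then have "null h" by (intro mono_modD[OF m, of h]) simp_all
  then have "null (e \<cdot> h)" by simp
  then have "null (g \<cdot> s)" using null_diff[OF sh] by simp
  then show "null g" using s by (intro epi_modD[of s g]) (simp_all add: weq_def)
qed

section \<open>Weak equivalences\<close>

text \<open>
  Choose a triangle \<open>X \<rightarrow> M0 \<rightarrow> C\<close> with extension \<open>\<epsilon>\<close> and \<open>M0\<close>
  in \<open>N\<close>, and let \<open>A \<rightarrow> E \<rightarrow> M0\<close> be the pullback of \<open>\<delta>\<close>, so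
  that \<open>b : E \<rightarrow> B\<close> is monic modulo null morphisms like \<open>x\<close>. The extension
  \<open>e\<^sub>* \<delta>\<close> vanishes on \<open>M0\<close>, hence is \<open>k\<^sub>* \<epsilon>\<close> for some
  \<open>k : X \<rightarrow> E\<close>, the analogue of \<open>C[-1] \<rightarrow> A\<close>. As \<open>b k\<close> is null, so is
  \<open>k\<close>, and \<open>e\<^sub>* \<delta>\<close> is pushed from an extension
  \<open>M \<rightarrow> F \<rightarrow> C\<close> with \<open>M\<close> in \<open>N\<close>. The deflation \<open>F \<rightarrow> C\<close>
  factors through \<open>[d y]\<close>, which is null since \<open>x\<close> is epic. But it is also monic modulo null
  morphisms, so \<open>F\<close> lies in \<open>N\<close>, and hence so does \<open>C\<close>.
\<close>

lemma cone_in_N: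
  assumes t: "s_triangle K x y \<delta>" and x: "weq x"
  shows "Cod K y \<in> N"
proof -
  define A C where defs: "A = Dom K x" "C = Cod K y"
  have [simp]: "A \<in> Obj K" "C \<in> Obj K" using s_triangleD[OF t] by (simp_all add: defs)
  have [simp]: "x \<in> Arr K" "Dom K x = A" "Cod K x = Dom K y" "y \<in> Arr K" "Cod K y = C"
    "\<delta> \<in> carrier (Ext K C A)"
    using s_triangleD[OF t] by (simp_all add: defs)
  obtain \<kappa> d \<epsilon> where td: "s_triangle K \<kappa> d \<epsilon>" and dC [simp]: "Cod K d = C" and dN: "Dom K d \<in> N"
    using deflation_from_N[of C] by auto
  define X where "X = Dom K \<kappa>"
  have [simp]: "X \<in> Obj K" using s_triangleD[OF td] by (simp add: X_def)
  have [simp]: "\<kappa> \<in> Arr K" "Dom K \<kappa> = X" "Cod K \<kappa> = Dom K d" "d \<in> Arr K" "\<epsilon> \<in> carrier (Ext K C X)"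
    using s_triangleD[OF td] by (simp_all add: X_def)
  obtain e p where te: "s_triangle K e p (pull K d A \<delta>)" and ep: "Dom K e = A" "Cod K p = Dom K d"
    using realizeE[of "pull K d A \<delta>" "Dom K d" A] by auto
  note [simp] = s_triangleD(1-3)[OF te] ep
  obtain P i j p1 q1 where bp: "biproduct K (Dom K d) (Dom K y) P i j p1 q1"
    using ex_biproduct[of "Dom K d" "Dom K y"] by auto
  note [simp] = biproductD(1-15)[OF bp]
  obtain b where [simp]: "b \<in> Arr K" "Dom K b = Dom K p" "Cod K b = Dom K y" and be: "b \<cdot> e = x"
    and tb: "s_triangle K (i \<cdot> neg K p \<boxplus> j \<cdot> b) (d \<cdot> p1 \<boxplus> y \<cdot> q1) (push K C e \<delta>)"
    by (rule pull_triangle[OF t, of d e p P i j p1 q1]) (use te bp in simp_all)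
  have mb: "mono_mod b"
    by (rule mono_mod_cancel_inflation[OF te]) (use dN weqD[OF x] be in simp_all)
  have "pull K d (Dom K p) (push K C e \<delta>) = \<one>\<^bsub>Ext K (Dom K d) (Dom K p)\<^esub>"
    using tri_push[OF te] push_pull[of d e "Dom K d" A \<delta>] by simp
  then obtain k where [simp]: "k \<in> Arr K" "Cod K k = Dom K p" "Dom K k = X" and k: "push K C k \<epsilon> = push K C e \<delta>"
    using pull_one_imp_push[OF td, of "Dom K p" "push K C e \<delta>"] by auto
  obtain f where [simp]: "f \<in> Arr K" "Dom K f = Dom K d" "Cod K f = P"
    and f: "f \<cdot> \<kappa> = (i \<cdot> neg K p \<boxplus> j \<cdot> b) \<cdot> k"
    by (rule push_square[OF td, of k "i \<cdot> neg K p \<boxplus> j \<cdot> b" "d \<cdot> p1 \<boxplus> y \<cdot> q1"]) (use tb k in simp_all)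
  have "b \<cdot> k = q1 \<cdot> ((i \<cdot> neg K p \<boxplus> j \<cdot> b) \<cdot> k)" by (simp add: biproduct_Comp[OF bp])
  also have "\<dots> = (q1 \<cdot> f) \<cdot> \<kappa>" unfolding f[symmetric] by simp
  finally have "b \<cdot> k = (q1 \<cdot> f) \<cdot> \<kappa>" .
  moreover have "null ((q1 \<cdot> f) \<cdot> \<kappa>)" by (rule null_through_N) (simp_all add: dN)
  ultimately have "null (b \<cdot> k)" by (simp only:)
  then have nk: "null k" by (rule mono_modD[OF mb, rotated 2]) simp_all
  obtain M u v where M: "M \<in> N" and uv: "u \<in> Arr K" "v \<in> Arr K" "Dom K u = Dom K k" "Cod K u = M"
    "Dom K v = M" "Cod K v = Cod K k" and vu: "k = v \<cdot> u"
    by (rule nullE[OF nk])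
  have [simp]: "u \<in> Arr K" "v \<in> Arr K" "Dom K u = X" "Cod K u = M" "Dom K v = M" "Cod K v = Dom K p"
    using uv by simp_all
  have [simp]: "M \<in> Obj K" using M by (rule N_Obj)
  have pv: "push K C v (push K C u \<epsilon>) = push K C e \<delta>"
    using push_Comp[of u v C \<epsilon>] k vu by simp
  obtain m w where tm: "s_triangle K m w (push K C u \<epsilon>)" and mw: "Dom K m = M" "Cod K w = C"
    using realizeE[of "push K C u \<epsilon>" C M] by auto
  note [simp] = s_triangleD(1-3)[OF tm] mw
  obtain g where [simp]: "g \<in> Arr K" "Dom K g = Dom K w" "Cod K g = P" and g: "(d \<cdot> p1 \<boxplus> y \<cdot> q1) \<cdot> g = w"
    by (rule push_square[OF tm, of v "i \<cdot> neg K p \<boxplus> j \<cdot> b" "d \<cdot> p1 \<boxplus> y \<cdot> q1"]) (use tb pv in simp_all)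
  have "null (y \<cdot> x)" using tri_Comp[OF t] by simp
  then have "null y" by (rule epi_modD[OF weqD(3)[OF x], rotated 2]) simp_all
  then have "null (y \<cdot> q1)" by (rule null_Comp(2)) simp_all
  moreover have "null (d \<cdot> p1)" by (rule null_through_N) (simp_all add: dN)
  ultimately have "null (d \<cdot> p1 \<boxplus> y \<cdot> q1)" by (intro null_Add) simp_all
  then have "null ((d \<cdot> p1 \<boxplus> y \<cdot> q1) \<cdot> g)" by (rule null_Comp(2)) simp_all
  then have "null (w \<cdot> Id K (Dom K w))" unfolding g by simp
  then have "null (Id K (Dom K w))"
    by (rule mono_modD[OF deflation_mono_mod[OF tm], rotated 3]) (simp_all add: M)
  then have "Dom K w \<in> N" by (rule null_Id_imp_N) simp
  then show ?thesis using tri_N(1)[OF tm] M by simp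
qed

text \<open>
  Up to the isomorphism \<open>p\<close> of the quotient, \<open>f\<close> is the inflation \<open>x\<close> with cone in
  \<open>N\<close>.
\<close>

lemma weq_inflation:
  assumes f: "weq f"
  obtains M P i j p q e x y \<delta> where "M \<in> N" "biproduct K (Cod K f) M P i j p q"
    "e \<in> Arr K" "Dom K e = Dom K f" "Cod K e = M" "x = i \<cdot> f \<boxplus> j \<cdot> e"
    "s_triangle K x y \<delta>" "Cod K y \<in> N"
proof -
  note f' [simp] = weqD(1)[OF f]
  obtain e w \<epsilon> where e: "s_triangle K e w \<epsilon>" "Dom K e = Dom K f" and M: "Dom K w \<in> N"
    using inflation_into_N[of "Dom K f"] by auto
  note [simp] = s_triangleD(1-3)[OF e(1)] e(2)
  obtain P i j p q where bp: "biproduct K (Cod K f) (Dom K w) P i j p q"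
    using ex_biproduct[of "Cod K f" "Dom K w"] by auto
  note [simp] = biproductD(1-15)[OF bp]
  obtain y \<delta> where t: "s_triangle K (i \<cdot> f \<boxplus> j \<cdot> e) y \<delta>"
    using inflation_pair[OF e(1), of f P i j p q] bp by auto
  have "weq (i \<cdot> f)" by (rule weq_Comp[OF f weq_biproduct(1)[OF bp M]]) simp
  moreover have "null (j \<cdot> e)" by (rule null_through_N) (simp_all add: M)
  then have "null (i \<cdot> f \<boxplus> neg K (i \<cdot> f \<boxplus> j \<cdot> e))" by (simp add: Add_cancel)
  ultimately have "weq (i \<cdot> f \<boxplus> j \<cdot> e)" by (rule_tac weq_null) simp_all
  then have "Cod K y \<in> N" by (rule cone_in_N[OF t])
  then show thesis by (intro that[OF M bp _ _ _ refl t]) simp_all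
qed

text \<open>
  The pushout along \<open>f\<close> of the inflation that represents \<open>s\<close>.
\<close>

lemma weq_ore:
  assumes s: "weq s" and f: "f \<in> Arr K" "Dom K f = Dom K s"
  obtains s' f' where "weq s'" "Dom K s' = Cod K f" "f' \<in> Arr K" "Dom K f' = Cod K s" "Cod K f' = Cod K s'"
    "null (s' \<cdot> f \<boxplus> neg K (f' \<cdot> s))"
proof -
  obtain M P i j p q e x y \<delta> where M: "M \<in> N" and bp: "biproduct K (Cod K s) M P i j p q"
    and e: "e \<in> Arr K" "Dom K e = Dom K s" "Cod K e = M" and x: "x = i \<cdot> s \<boxplus> j \<cdot> e"
    and t: "s_triangle K x y \<delta>" and y: "Cod K y \<in> N"
    by (rule weq_inflation[OF s])
  note [simp] = weqD(1)[OF s] f e biproductD(1-15)[OF bp]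
  have [simp]: "Dom K x = Dom K s" "Cod K x = P" by (simp_all add: x)
  note d = s_triangleD[OF t]
  note [simp] = d(1,2) d(3)[symmetric]
  have [simp]: "\<delta> \<in> carrier (Ext K (Cod K y) (Dom K s))" using d(4) by simp
  obtain x' y' where t': "s_triangle K x' y' (push K (Cod K y) f \<delta>)" "Dom K x' = Cod K f" "Cod K y' = Cod K y"
    using realizeE[of "push K (Cod K y) f \<delta>" "Cod K y" "Cod K f"] by auto
  note d' = s_triangleD[OF t'(1)]
  note [simp] = d'(1,2) t'(2,3)
  obtain b where [simp]: "b \<in> Arr K" "Dom K b = P" "Cod K b = Dom K y'" and b: "b \<cdot> x = x' \<cdot> f"
    by (rule push_square[OF t _ _ t']) simp_all
  have "weq x'" using inflation_weq[OF t'(1)] y by simp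
  moreover have "null (x' \<cdot> f \<boxplus> neg K ((b \<cdot> i) \<cdot> s))"
  proof -
    have "x' \<cdot> f = (b \<cdot> i) \<cdot> s \<boxplus> (b \<cdot> j) \<cdot> e" unfolding b[symmetric] by (simp add: x)
    then have "x' \<cdot> f \<boxplus> neg K ((b \<cdot> i) \<cdot> s) = (b \<cdot> j) \<cdot> e"
      by (simp add: Add_assoc Add_diff_cancel)
    moreover have "null ((b \<cdot> j) \<cdot> e)" by (rule null_through_N) (simp_all add: M)
    ultimately show ?thesis by (simp only:)
  qed
  ultimately show thesis using d'(3) by (intro that[of x' "b \<cdot> i"]) simp_all
qed

lemma weq_ore':
  assumes s: "weq s" and f: "f \<in> Arr K" "Cod K f = Cod K s"
  obtains s' f' where "weq s'" "Cod K s' = Dom K f" "f' \<in> Arr K" "Cod K f' = Dom K s" "Dom K f' = Dom K s'"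
    "null (f \<cdot> s' \<boxplus> neg K (s \<cdot> f'))"
  using biresolving_subcategory.weq_ore[OF opposite_biresolving_subcategory, of s f thesis] assms
  by (simp add: opposite_mod)

text \<open>
  Only monicity needs an argument: by the Ore condition, a morphism \<open>h\<close> with \<open>g h\<close> null
  factors through \<open>f\<close> after composition with a weak equivalence.
\<close>

lemma weq_cancel_right:
  assumes f: "weq f" and gf: "weq (g \<cdot> f)" and g: "g \<in> Arr K" "Dom K g = Cod K f"
  shows "weq g"
proof (rule weqI)
  note [simp] = g weqD(1)[OF f]
  show "g \<in> Arr K" by simp
  fix h assume h [simp]: "h \<in> Arr K" "Cod K h = Dom K g" and n: "null (g \<cdot> h)"
  obtain s k where s: "weq s" and [simp]: "Cod K s = Dom K h" "k \<in> Arr K" "Cod K k = Dom K f" "Dom K k = Dom K s"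
    and sk: "null (h \<cdot> s \<boxplus> neg K (f \<cdot> k))"
    using weq_ore'[OF f, of h] by auto
  note [simp] = weqD(1)[OF s]
  have "null (g \<cdot> (h \<cdot> s \<boxplus> neg K (f \<cdot> k)))" by (rule null_Comp(1)[OF sk]) simp_all
  then have "null (g \<cdot> (h \<cdot> s) \<boxplus> neg K (g \<cdot> (f \<cdot> k)))" by simp
  then have "null (g \<cdot> (h \<cdot> s)) \<longleftrightarrow> null (g \<cdot> (f \<cdot> k))" by (rule null_diff) simp_all
  moreover have "null ((g \<cdot> h) \<cdot> s)" by (rule null_Comp(2)[OF n]) simp_all
  ultimately have "null ((g \<cdot> f) \<cdot> k)" by simp
  then have "null k" by (rule mono_modD[OF weqD(2)[OF gf], rotated 2]) simp_all
  then have "null (f \<cdot> k)" by (rule null_Comp(1)) simp_all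
  moreover have "null (h \<cdot> s) \<longleftrightarrow> null (f \<cdot> k)" by (rule null_diff[OF sk]) simp_all
  ultimately have "null (h \<cdot> s)" by simp
  then show "null h" by (rule epi_modD[OF weqD(3)[OF s], rotated 2]) simp_all
next
  note [simp] = g weqD(1)[OF f]
  fix h assume h [simp]: "h \<in> Arr K" "Dom K h = Cod K g" and n: "null (h \<cdot> g)"
  have "null ((h \<cdot> g) \<cdot> f)" by (rule null_Comp(2)[OF n]) simp_all
  then have "null (h \<cdot> (g \<cdot> f))" by simp
  then show "null h" by (rule epi_modD[OF weqD(3)[OF gf], rotated 2]) simp_all
qed

lemma weq_cancel_left:
  assumes "weq g" "weq (g \<cdot> f)" "f \<in> Arr K" "Cod K f = Dom K g"
  shows "weq f"
  using biresolving_subcategory.weq_cancel_right[OF opposite_biresolving_subcategory, of g f] assms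
  by (simp add: opposite_mod)

text \<open>
  Let \<open>\<iota> : B \<rightarrow> M\<close> be an inflation into \<open>N\<close>. Replacing \<open>a\<close> by
  \<open>a' = [a; \<iota> x]\<close> makes it an inflation with cone in \<open>N\<close>, to which
  \<open>pushout_conflation\<close> applies. Since \<open>\<iota> x\<close> extends along \<open>x\<close>, it kills
  \<open>\<delta>\<close>, so the extension pushed along \<open>a'\<close> is the one pushed along \<open>a\<close> and realized
  by adding \<open>M\<close> to the target triangle. The added summand is then projected away.
\<close>

lemma weq_push:
  assumes t: "s_triangle K x y \<delta>" and a: "weq a" "Dom K a = Dom K x"
    and t': "s_triangle K x' y' (push K (Cod K y) a \<delta>)" "Dom K x' = Cod K a" "Cod K y' = Cod K y"
  obtains b where "weq b" "Dom K b = Dom K y" "Cod K b = Dom K y'" "b \<cdot> x = x' \<cdot> a" "y' \<cdot> b = y"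
proof -
  note [simp] = s_triangleD[OF t] weqD(1)[OF a(1)] a(2) s_triangleD(1-3)[OF t'(1)] t'(2,3)
  define C where "C = Cod K y"
  have [simp]: "C \<in> Obj K" by (simp add: C_def)
  have [simp]: "Cod K y = C" "\<delta> \<in> carrier (Ext K C (Dom K x))" using s_triangleD(4)[OF t] by (simp_all add: C_def)
  obtain \<iota> w \<epsilon> where ti: "s_triangle K \<iota> w \<epsilon>" and i1: "Dom K \<iota> = Dom K y" and M: "Dom K w \<in> N"
    using inflation_into_N[of "Dom K y"] by auto
  note [simp] = s_triangleD(1-3)[OF ti] i1
  have "s_inflation K x" "s_inflation K \<iota>" using t ti by (auto simp: s_inflation_def s_conflation_def)
  then have "s_inflation K (\<iota> \<cdot> x)" using C4 by (simp add: closed_under_comp_def)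
  then obtain w2 \<epsilon>2 where t2: "s_triangle K (\<iota> \<cdot> x) w2 \<epsilon>2" by (auto simp: s_inflation_def s_conflation_def)
  obtain P i j p q where bp: "biproduct K (Cod K a) (Dom K w) P i j p q"
    using ex_biproduct[of "Cod K a" "Dom K w"] by auto
  note [simp] = biproductD(1-15)[OF bp]
  define a' where "a' = i \<cdot> a \<boxplus> j \<cdot> (\<iota> \<cdot> x)"
  have [simp]: "a' \<in> Arr K" "Dom K a' = Dom K x" "Cod K a' = P" by (simp_all add: a'_def)
  obtain m \<mu> where tm: "s_triangle K a' m \<mu>"
    using inflation_pair[OF t2, of a P i j p q] bp by (auto simp: a'_def)
  have "weq (i \<cdot> a)" by (rule weq_Comp[OF a(1) weq_biproduct(1)[OF bp M]]) simp
  moreover have "null (j \<cdot> (\<iota> \<cdot> x))" by (rule null_through_N) (simp_all add: M)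
  then have "null (i \<cdot> a \<boxplus> neg K a')" by (simp add: a'_def Add_cancel)
  ultimately have "weq a'" by (rule_tac weq_null) simp_all
  then have m: "Cod K m \<in> N" by (rule cone_in_N[OF tm])
  obtain P' i' j' p' q' where bp': "biproduct K (Dom K y') (Dom K w) P' i' j' p' q'"
    using ex_biproduct[of "Dom K y'" "Dom K w"] by auto
  note [simp] = biproductD(1-15)[OF bp']
  have "push K C i (push K C a \<delta>) = push K C a' \<delta>"
  proof -
    interpret G: group "Ext K C P" by (rule Ext_group) simp_all
    have "push K C a' \<delta> = push K C (i \<cdot> a) \<delta> \<otimes>\<^bsub>Ext K C P\<^esub> push K C ((j \<cdot> \<iota>) \<cdot> x) \<delta>"
      unfolding a'_def by (subst push_Add) simp_all
    also have "push K C ((j \<cdot> \<iota>) \<cdot> x) \<delta> = \<one>\<^bsub>Ext K C P\<^esub>"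
      using tri_push[OF t] by (subst push_Comp) simp_all
    finally show ?thesis by (simp add: push_Comp)
  qed
  then have tX: "s_triangle K (i' \<cdot> (x' \<cdot> p) \<boxplus> j' \<cdot> q) (y' \<cdot> p') (push K C a' \<delta>)"
    using tri_add_object[OF t'(1), of "Dom K w" P i j p q P' i' j' p' q'] bp bp' by simp
  show thesis
  proof (rule pushout_conflation[OF t tm])
    show "s_triangle K (i' \<cdot> (x' \<cdot> p) \<boxplus> j' \<cdot> q) (y' \<cdot> p') (push K (Cod K y) a' \<delta>)" using tX by simp
    fix b n \<nu>
    assume tb: "s_triangle K b n \<nu>" and b: "Dom K b = Dom K y" "Cod K b = Dom K (y' \<cdot> p')" "Cod K n = Cod K m"
      and bx: "b \<cdot> x = (i' \<cdot> (x' \<cdot> p) \<boxplus> j' \<cdot> q) \<cdot> a'" and yb: "(y' \<cdot> p') \<cdot> b = y"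
    have [simp]: "b \<in> Arr K" "Dom K b = Dom K y" "Cod K b = P'" using b s_triangleD(1)[OF tb] by simp_all
    have "weq b" using inflation_weq[OF tb] b m by simp
    then have "weq (p' \<cdot> b)" by (rule weq_Comp[OF _ weq_biproduct(2)[OF bp' M]]) simp
    moreover have "p' \<cdot> (b \<cdot> x) = x' \<cdot> a"
      unfolding bx by (simp add: biproduct_Comp[OF bp'] biproduct_Comp[OF bp] a'_def)
    ultimately show thesis using yb by (intro that[of "p' \<cdot> b"]) simp_all
  qed simp_all
qed

lemma weq_pull:
  assumes t: "s_triangle K x y \<delta>" and c: "weq c" "Cod K c = Cod K y"
    and t': "s_triangle K x' y' (pull K c (Dom K x) \<delta>)" "Dom K x' = Dom K x" "Cod K y' = Dom K c"
  obtains b where "weq b" "Cod K b = Dom K y" "Dom K b = Dom K y'" "y \<cdot> b = c \<cdot> y'" "b \<cdot> x' = x"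
  using biresolving_subcategory.weq_push[OF opposite_biresolving_subcategory, of y x \<delta> c y' x' thesis]
    assms s_triangleD(3)[OF t] s_triangleD(3)[OF t'(1)]
  by (simp add: opposite_mod)

lemma weq_middle:
  assumes t: "s_triangle K x y \<delta>" and t': "s_triangle K x' y' \<delta>'"
    and a: "weq a" "Dom K a = Dom K x" "Cod K a = Dom K x'"
    and c: "weq c" "Dom K c = Cod K y" "Cod K c = Cod K y'"
    and e: "push K (Cod K y) a \<delta> = pull K c (Dom K x') \<delta>'"
  obtains b where "weq b" "Dom K b = Dom K y" "Cod K b = Dom K y'" "b \<cdot> x = x' \<cdot> a" "y' \<cdot> b = c \<cdot> y"
proof -
  note [simp] = s_triangleD[OF t] s_triangleD(1-3)[OF t'] a(2,3) c(2,3) weqD(1)[OF a(1)] weqD(1)[OF c(1)]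
  obtain u v where tu: "s_triangle K u v (push K (Cod K y) a \<delta>)" and [simp]: "Dom K u = Dom K x'" "Cod K v = Cod K y"
    using realizeE[of "push K (Cod K y) a \<delta>" "Cod K y" "Dom K x'"] by auto
  note [simp] = s_triangleD(1-3)[OF tu]
  obtain b1 where b1: "weq b1" and [simp]: "Dom K b1 = Dom K y" "Cod K b1 = Dom K v"
    and e1: "b1 \<cdot> x = u \<cdot> a" "v \<cdot> b1 = y"
    by (rule weq_push[OF t a(1,2) tu]) simp_all
  obtain b2 where b2: "weq b2" and [simp]: "Cod K b2 = Dom K y'" "Dom K b2 = Dom K v"
    and e2: "y' \<cdot> b2 = c \<cdot> v" "b2 \<cdot> u = x'"
    by (rule weq_pull[OF t' c(1,3), of u v]) (use tu e in simp_all)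
  note [simp] = weqD(1)[OF b1] weqD(1)[OF b2]
  have "(b2 \<cdot> b1) \<cdot> x = x' \<cdot> a" using e1(1) e2(2) Comp_assoc_Arr[of a u b2] by simp
  moreover have "y' \<cdot> (b2 \<cdot> b1) = (y' \<cdot> b2) \<cdot> b1" by simp
  then have "y' \<cdot> (b2 \<cdot> b1) = c \<cdot> y" unfolding e2(1) using e1(2) by simp
  ultimately show thesis using weq_Comp[OF b1 b2] by (intro that[of "b2 \<cdot> b1"]) simp_all
qed

lemma thick_morphisms_weq:
  assumes "s \<in> thick_morphisms K N"
  shows "weq s"
  using assms
proof induction
  case (inflation f) then show ?case
    using inflation_weq by (auto simp: inflations_cone_in_def s_conflation_def)
next
  case (deflation f) then show ?case
    using deflation_weq by (auto simp: deflations_cocone_in_def s_conflation_def)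
next
  case (comp f g) then show ?case by (intro weq_Comp)
qed

text \<open>
  If \<open>0 \<rightarrow> X\<close> is a weak equivalence, then the identity of \<open>X\<close> is null.
\<close>

lemma null_objects_eq: "null_objects K (thick_morphisms K N) = N"
proof (intro equalityI subsetI)
  fix X assume X: "X \<in> null_objects K (thick_morphisms K N)"
  obtain Z where Z: "zero_object K Z" using ex_zero_object by blast
  have [simp]: "X \<in> Obj K" "Z \<in> Obj K" using X Z by (auto simp: null_objects_def zero_object_def)
  have "Zero K Z X \<in> thick_morphisms K N" using X Z by (auto simp: null_objects_def)
  then have "epi_mod (Zero K Z X)" using thick_morphisms_weq weqD by blast
  then have "null (Id K X)" by (rule epi_modD) simp_all
  then show "X \<in> N" by (rule null_Id_imp_N) simp
next
  fix X assume X: "X \<in> N"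
  have [simp]: "X \<in> Obj K" using X by (rule N_Obj)
  have "Zero K X Z \<in> thick_morphisms K N \<and> Zero K Z X \<in> thick_morphisms K N" if Z: "zero_object K Z" for Z
  proof -
    have [simp]: "Z \<in> Obj K" using Z by (simp add: zero_object_def)
    have "s_triangle K (Id K X) (Zero K X Z) \<one>\<^bsub>Ext K Z X\<^esub>" "s_triangle K (Zero K Z X) (Id K X) \<one>\<^bsub>Ext K X Z\<^esub>"
      using C2[OF Z, of X] C2'[OF Z, of X] by (simp_all add: s_triangle_def)
    then have "Zero K X Z \<in> deflations_cocone_in K N" "Zero K Z X \<in> inflations_cone_in K N"
      unfolding deflations_cocone_in_def inflations_cone_in_def s_conflation_def using X by auto
    then show ?thesis by (simp add: thick_morphisms.intros)
  qed
  then show "X \<in> null_objects K (thick_morphisms K N)" by (simp add: null_objects_def)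
qed

section \<open>The class of weak equivalences in the quotient\<close>

abbreviation "S \<equiv> thick_morphisms K N"
abbreviation "W \<equiv> bar_morphisms K S"

lemma bar_eq: "bar_category K S = Q" "bar K S f = pr f"
  by (simp_all add: bar_category_def bar_def null_objects_eq)

lemma arr_inflation:
  assumes f: "f \<in> Arr K"
  obtains p x where "s_inflation K x" "x \<in> Arr K" "weq p" "Dom K x = Dom K f" "Cod K x = Dom K p" "p \<cdot> x = f"
proof -
  note [simp] = f
  obtain e w \<epsilon> where e: "s_triangle K e w \<epsilon>" "Dom K e = Dom K f" and M: "Dom K w \<in> N"
    using inflation_into_N[of "Dom K f"] by auto
  note [simp] = s_triangleD(1-3)[OF e(1)] e(2)
  obtain P i j p q where bp: "biproduct K (Cod K f) (Dom K w) P i j p q"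
    using ex_biproduct[of "Cod K f" "Dom K w"] by auto
  note [simp] = biproductD(1-15)[OF bp]
  have "\<exists>y \<delta>. s_triangle K (i \<cdot> f \<boxplus> j \<cdot> e) y \<delta>"
    using inflation_pair[OF e(1), of f P i j p q] bp by simp
  then have "s_inflation K (i \<cdot> f \<boxplus> j \<cdot> e)" by (auto simp: s_inflation_def s_conflation_def)
  then show thesis
    by (rule that[of _ p]) (simp_all add: weq_biproduct(2)[OF bp M] biproduct_Comp[OF bp])
qed

lemma arr_deflation:
  assumes f: "f \<in> Arr K"
  obtains i y where "s_deflation K y" "y \<in> Arr K" "weq i" "Cod K y = Cod K f" "Dom K y = Cod K i" "y \<cdot> i = f"
  using biresolving_subcategory.arr_inflation[OF opposite_biresolving_subcategory, of f thesis] assms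
  by (simp add: opposite_mod)

lemma W_iff: "F \<in> W \<longleftrightarrow> (\<exists>f. weq f \<and> F = pr f)"
proof
  interpret QC: category Q by (rule category_Q)
  assume "F \<in> W"
  then obtain \<beta> s \<alpha> where F: "F = \<beta> \<cdot>\<^bsub>Q\<^esub> pr s \<cdot>\<^bsub>Q\<^esub> \<alpha>" and s: "s \<in> S" and iso: "is_iso Q \<alpha>" "is_iso Q \<beta>"
    and e: "Cod Q \<alpha> = Dom K s" "Cod K s = Dom Q \<beta>"
    unfolding bar_morphisms_def bar_eq by blast
  have "\<alpha> \<in> Arr Q" "\<beta> \<in> Arr Q" using iso by (simp_all add: is_iso_def)
  then obtain a b where ab: "\<alpha> = pr a" "\<beta> = pr b" and [simp]: "a \<in> Arr K" "b \<in> Arr K"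
    by (auto simp: Q_simps)
  have w: "weq a" "weq b" "weq s"
    using QC.is_iso_mono_epi[OF iso(1)] QC.is_iso_mono_epi[OF iso(2)] thick_morphisms_weq[OF s]
    unfolding ab by (simp_all add: weq_def is_mono_pr is_epi_pr)
  have [simp]: "s \<in> Arr K" using w(3) by (rule weqD)
  have [simp]: "Cod K a = Dom K s" "Cod K s = Dom K b" using e by (simp_all add: ab)
  have "weq (b \<cdot> (s \<cdot> a))" using w by (intro weq_Comp) simp_all
  moreover have "F = pr (b \<cdot> (s \<cdot> a))" unfolding F ab by simp
  ultimately show "\<exists>f. weq f \<and> F = pr f" by blast
next
  assume "\<exists>f. weq f \<and> F = pr f"
  then obtain f where f: "weq f" and F: "F = pr f" by blast
  obtain M P i j p q e x y \<delta> where M: "M \<in> N" and bp: "biproduct K (Cod K f) M P i j p q"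
    and e: "e \<in> Arr K" "Dom K e = Dom K f" "Cod K e = M" and x: "x = i \<cdot> f \<boxplus> j \<cdot> e"
    and t: "s_triangle K x y \<delta>" and y: "Cod K y \<in> N"
    by (rule weq_inflation[OF f])
  note [simp] = weqD(1)[OF f] e biproductD(1-15)[OF bp]
  have px: "p \<cdot> x = f" by (simp add: x biproduct_Comp[OF bp])
  have [simp]: "x \<in> Arr K" "Dom K x = Dom K f" "Cod K x = P" by (simp_all add: x)
  have "x \<in> S" using t y by (intro thick_morphisms.inflation) (auto simp: inflations_cone_in_def s_conflation_def)
  moreover have "is_iso Q (pr (Id K (Dom K f)))"
    unfolding is_iso_def by (auto simp: Q_simps Mor_Q Mor_iff intro!: bexI[of _ "pr (Id K (Dom K f))"] image_eqI[of _ _ "Id K (Dom K f)"])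
  moreover have "is_iso Q (pr p)"
  proof -
    have "null (j \<cdot> q)" by (rule null_through_N) (simp_all add: M)
    then have "null (i \<cdot> p \<boxplus> neg K (i \<cdot> p \<boxplus> j \<cdot> q))" by (simp add: Add_cancel)
    then have "pr (i \<cdot> p) = pr (Id K P)" unfolding biproductD(20)[OF bp] by (simp add: pr_eq_iff)
    moreover have "pr (p \<cdot> i) = pr (Id K (Cod K f))" using biproductD(16)[OF bp] by simp
    ultimately show ?thesis
      unfolding is_iso_def by (auto simp: Q_simps Mor_Q Mor_iff intro!: bexI[of _ "pr i"] image_eqI[of _ _ i])
  qed
  moreover have "F = pr p \<cdot>\<^bsub>Q\<^esub> pr x \<cdot>\<^bsub>Q\<^esub> pr (Id K (Dom K f))" by (simp add: F px)
  ultimately show "F \<in> W" unfolding bar_morphisms_def bar_eq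
    by (intro CollectI exI[of _ "pr p"] exI[of _ x] exI[of _ "pr (Id K (Dom K f))"]) simp
qed

lemma weq_Id: "A \<in> Obj K \<Longrightarrow> weq (Id K A)"
  by (rule weqI) simp_all

lemma pr_W: "f \<in> Arr K \<Longrightarrow> pr f \<in> W \<longleftrightarrow> weq f"
proof -
  assume f [simp]: "f \<in> Arr K"
  have "weq f" if "weq g" "pr f = pr g" for g
    using that weqD(1)[OF that(1)] weq_null[of g f] pr_eq_iff[of g f] by simp
  then show ?thesis unfolding W_iff by blast
qed

lemma W_eq_mono_epi: "W = {F \<in> Arr Q. is_mono Q F \<and> is_epi Q F}"
proof (rule Set.set_eqI)
  fix F
  show "F \<in> W \<longleftrightarrow> F \<in> {F \<in> Arr Q. is_mono Q F \<and> is_epi Q F}"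
  proof (cases "F \<in> Arr Q")
    case True
    then obtain f where "F = pr f" "f \<in> Arr K" by (auto simp: Q_simps)
    then show ?thesis using True by (simp add: pr_W weq_def is_mono_pr is_epi_pr)
  next
    case False then show ?thesis using weqD(1) by (auto simp: W_iff Q_simps)
  qed
qed

lemma two_out_of_three_W: "two_out_of_three Q W"
  unfolding two_out_of_three_def
proof (intro ballI impI)
  fix F G assume "F \<in> Arr Q" "G \<in> Arr Q" "Cod Q F = Dom Q G"
  then obtain f g where FG: "F = pr f" "G = pr g" and [simp]: "f \<in> Arr K" "g \<in> Arr K" "Cod K f = Dom K g"
    by (auto simp: Q_simps)
  show "(F \<in> W \<and> G \<in> W \<longrightarrow> G \<cdot>\<^bsub>Q\<^esub> F \<in> W) \<and> (F \<in> W \<and> G \<cdot>\<^bsub>Q\<^esub> F \<in> W \<longrightarrow> G \<in> W) \<and>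
      (G \<in> W \<and> G \<cdot>\<^bsub>Q\<^esub> F \<in> W \<longrightarrow> F \<in> W)"
    unfolding FG using weq_Comp[of f g] weq_cancel_right[of f g] weq_cancel_left[of g f]
    by (simp add: pr_W)
qed

lemma closed_under_comp_W: "closed_under_comp Q W"
proof -
  have "W \<subseteq> Arr Q" using W_eq_mono_epi by blast
  then show ?thesis using two_out_of_three_W
    unfolding closed_under_comp_def two_out_of_three_def by blast
qed

lemma multiplicative_system_W: "multiplicative_system Q W"
  unfolding multiplicative_system_def
proof (intro conjI)
  show sub: "W \<subseteq> Arr Q" using W_eq_mono_epi by blast
  have Id: "Id Q A \<in> W" if "A \<in> Obj K" for A
    using that by (simp add: Q_simps pr_W weq_Id)
  then show "\<forall>A \<in> Obj Q. Id Q A \<in> W" by (simp add: Q_simps(1))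
  show "closed_under_comp Q W" by (rule closed_under_comp_W)
  show "\<forall>s \<in> W. \<forall>f \<in> Arr Q. Dom Q s = Dom Q f \<longrightarrow>
      (\<exists>Z \<in> Obj Q. \<exists>s' \<in> W \<inter> Mor Q (Cod Q f) Z. \<exists>f' \<in> Mor Q (Cod Q s) Z. s' \<cdot>\<^bsub>Q\<^esub> f = f' \<cdot>\<^bsub>Q\<^esub> s)"
  proof (intro ballI impI)
    fix S' F assume "S' \<in> W" "F \<in> Arr Q" and e: "Dom Q S' = Dom Q F"
    then obtain s f where s: "weq s" and SF: "S' = pr s" "F = pr f" and [simp]: "f \<in> Arr K"
      by (auto simp: W_iff Q_simps)
    note [simp] = weqD(1)[OF s]
    have [simp]: "Dom K f = Dom K s" using e by (simp add: SF)
    obtain s' f' where s': "weq s'" and [simp]: "Dom K s' = Cod K f" "f' \<in> Arr K" "Dom K f' = Cod K s" "Cod K f' = Cod K s'"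
      and n: "null (s' \<cdot> f \<boxplus> neg K (f' \<cdot> s))"
      using weq_ore[OF s, of f] by auto
    note [simp] = weqD(1)[OF s']
    have "pr (s' \<cdot> f) = pr (f' \<cdot> s)" using n by (simp add: pr_eq_iff)
    moreover have "pr s' \<in> Mor Q (Cod K f) (Cod K s')" "pr f' \<in> Mor Q (Cod K s) (Cod K s')"
      unfolding Mor_Q by (auto simp: Mor_iff)
    ultimately show "\<exists>Z \<in> Obj Q. \<exists>s' \<in> W \<inter> Mor Q (Cod Q F) Z. \<exists>f' \<in> Mor Q (Cod Q S') Z. s' \<cdot>\<^bsub>Q\<^esub> F = f' \<cdot>\<^bsub>Q\<^esub> S'"
      using s' unfolding SF
      by (intro bexI[of _ "Cod K s'"] bexI[of _ "pr s'"] bexI[of _ "pr f'"]) (simp_all add: Q_simps pr_W)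
  qed
  show "\<forall>s \<in> W. \<forall>f \<in> Arr Q. Cod Q s = Cod Q f \<longrightarrow>
      (\<exists>Z \<in> Obj Q. \<exists>s' \<in> W \<inter> Mor Q Z (Dom Q f). \<exists>f' \<in> Mor Q Z (Dom Q s). f \<cdot>\<^bsub>Q\<^esub> s' = s \<cdot>\<^bsub>Q\<^esub> f')"
  proof (intro ballI impI)
    fix S' F assume "S' \<in> W" "F \<in> Arr Q" and e: "Cod Q S' = Cod Q F"
    then obtain s f where s: "weq s" and SF: "S' = pr s" "F = pr f" and [simp]: "f \<in> Arr K"
      by (auto simp: W_iff Q_simps)
    note [simp] = weqD(1)[OF s]
    have [simp]: "Cod K f = Cod K s" using e by (simp add: SF)
    obtain s' f' where s': "weq s'" and [simp]: "Cod K s' = Dom K f" "f' \<in> Arr K" "Cod K f' = Dom K s" "Dom K f' = Dom K s'"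
      and n: "null (f \<cdot> s' \<boxplus> neg K (s \<cdot> f'))"
      using weq_ore'[OF s, of f] by auto
    note [simp] = weqD(1)[OF s']
    have "pr (f \<cdot> s') = pr (s \<cdot> f')" using n by (simp add: pr_eq_iff)
    moreover have "pr s' \<in> Mor Q (Dom K s') (Dom K f)" "pr f' \<in> Mor Q (Dom K s') (Dom K s)"
      unfolding Mor_Q by (auto simp: Mor_iff)
    ultimately show "\<exists>Z \<in> Obj Q. \<exists>s' \<in> W \<inter> Mor Q Z (Dom Q F). \<exists>f' \<in> Mor Q Z (Dom Q S'). F \<cdot>\<^bsub>Q\<^esub> s' = S' \<cdot>\<^bsub>Q\<^esub> f'"
      using s' unfolding SF
      by (intro bexI[of _ "Dom K s'"] bexI[of _ "pr s'"] bexI[of _ "pr f'"]) (simp_all add: Q_simps pr_W)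
  qed
  show "\<forall>A \<in> Obj Q. \<forall>B \<in> Obj Q. \<forall>f \<in> Mor Q A B. \<forall>g \<in> Mor Q A B.
      (\<exists>s \<in> W. Cod Q s = A \<and> f \<cdot>\<^bsub>Q\<^esub> s = g \<cdot>\<^bsub>Q\<^esub> s) \<longleftrightarrow> (\<exists>t \<in> W. Dom Q t = B \<and> t \<cdot>\<^bsub>Q\<^esub> f = t \<cdot>\<^bsub>Q\<^esub> g)"
  proof (intro ballI)
    interpret QC: category Q by (rule category_Q)
    fix A B f g assume o: "A \<in> Obj Q" "B \<in> Obj Q" and fg: "f \<in> Mor Q A B" "g \<in> Mor Q A B"
    have "(\<exists>s \<in> W. Cod Q s = A \<and> f \<cdot>\<^bsub>Q\<^esub> s = g \<cdot>\<^bsub>Q\<^esub> s) \<longleftrightarrow> f = g"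
    proof
      assume "\<exists>s \<in> W. Cod Q s = A \<and> f \<cdot>\<^bsub>Q\<^esub> s = g \<cdot>\<^bsub>Q\<^esub> s"
      then obtain s where "is_epi Q s" "Cod Q s = A" "f \<cdot>\<^bsub>Q\<^esub> s = g \<cdot>\<^bsub>Q\<^esub> s"
        using W_eq_mono_epi by auto
      then show "f = g" using fg o(2) unfolding is_epi_def by blast
    next
      assume "f = g"
      then show "\<exists>s \<in> W. Cod Q s = A \<and> f \<cdot>\<^bsub>Q\<^esub> s = g \<cdot>\<^bsub>Q\<^esub> s"
        using Id[of A] o by (intro bexI[of _ "Id Q A"]) (simp_all add: Q_simps)
    qed
    moreover have "(\<exists>t \<in> W. Dom Q t = B \<and> t \<cdot>\<^bsub>Q\<^esub> f = t \<cdot>\<^bsub>Q\<^esub> g) \<longleftrightarrow> f = g"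
    proof
      assume "\<exists>t \<in> W. Dom Q t = B \<and> t \<cdot>\<^bsub>Q\<^esub> f = t \<cdot>\<^bsub>Q\<^esub> g"
      then obtain s where "is_mono Q s" "Dom Q s = B" "s \<cdot>\<^bsub>Q\<^esub> f = s \<cdot>\<^bsub>Q\<^esub> g"
        using W_eq_mono_epi by auto
      then show "f = g" using fg o(1) unfolding is_mono_def by blast
    next
      assume "f = g"
      then show "\<exists>t \<in> W. Dom Q t = B \<and> t \<cdot>\<^bsub>Q\<^esub> f = t \<cdot>\<^bsub>Q\<^esub> g"
        using Id[of B] o by (intro bexI[of _ "Id Q B"]) (simp_all add: Q_simps)
    qed
    ultimately show "(\<exists>s \<in> W. Cod Q s = A \<and> f \<cdot>\<^bsub>Q\<^esub> s = g \<cdot>\<^bsub>Q\<^esub> s) \<longleftrightarrow>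
      (\<exists>t \<in> W. Dom Q t = B \<and> t \<cdot>\<^bsub>Q\<^esub> f = t \<cdot>\<^bsub>Q\<^esub> g)" by blast
  qed
qed

text \<open>
  It suffices to factor morphisms of the original category.
\<close>

lemma sandwich_eq_Arr:
  assumes T: "T \<subseteq> Arr K"
    and f: "\<And>f. f \<in> Arr K \<Longrightarrow> \<exists>v t u. weq v \<and> t \<in> T \<and> weq u \<and> Cod K u = Dom K t \<and> Cod K t = Dom K v \<and> f = v \<cdot> (t \<cdot> u)"
  shows "sandwich Q W (pr ` T) = Arr Q"
proof (intro equalityI subsetI)
  interpret QC: category Q by (rule category_Q)
  fix F assume "F \<in> sandwich Q W (pr ` T)"
  then obtain V t U where F: "F = V \<cdot>\<^bsub>Q\<^esub> pr t \<cdot>\<^bsub>Q\<^esub> U" and "U \<in> W" "V \<in> W" "t \<in> T"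
    and e: "Cod Q U = Dom Q (pr t)" "Cod Q (pr t) = Dom Q V"
    unfolding sandwich_def by blast
  then have "U \<in> Arr Q" "V \<in> Arr Q" "pr t \<in> Arr Q" using W_eq_mono_epi T by (auto simp: Q_simps)
  then show "F \<in> Arr Q" unfolding F using e by simp
next
  fix F assume "F \<in> Arr Q"
  then obtain f where F: "F = pr f" and "f \<in> Arr K" by (auto simp: Q_simps)
  then obtain v t u where w: "weq v" "weq u" and t: "t \<in> T" and [simp]: "Cod K u = Dom K t" "Cod K t = Dom K v"
    and e: "f = v \<cdot> (t \<cdot> u)" using f[of f] by blast
  note [simp] = weqD(1)[OF w(1)] weqD(1)[OF w(2)]
  have [simp]: "t \<in> Arr K" using t T by blast
  have "F = pr v \<cdot>\<^bsub>Q\<^esub> pr t \<cdot>\<^bsub>Q\<^esub> pr u" unfolding F e by simp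
  then show "F \<in> sandwich Q W (pr ` T)" unfolding sandwich_def using w t
    by (intro CollectI exI[of _ "pr v"] exI[of _ "pr t"] exI[of _ "pr u"]) (simp add: pr_W)
qed

lemma closed_under_comp_Arr: "closed_under_comp Q (Arr Q)"
proof -
  interpret QC: category Q by (rule category_Q)
  show ?thesis by (simp add: closed_under_comp_def)
qed

lemma closed_under_comp_sandwich:
  "closed_under_comp Q (sandwich Q W (pr ` {x. s_inflation K x}))"
  "closed_under_comp Q (sandwich Q W (pr ` {y. s_deflation K y}))"
proof -
  have sub: "{x. s_inflation K x} \<subseteq> Arr K" "{y. s_deflation K y} \<subseteq> Arr K"
    using s_triangleD(1,2) by (auto simp: s_inflation_def s_deflation_def s_conflation_def)
  have "sandwich Q W (pr ` {x. s_inflation K x}) = Arr Q"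
  proof (rule sandwich_eq_Arr[OF sub(1)])
    fix f assume f: "f \<in> Arr K"
    show "\<exists>v t u. weq v \<and> t \<in> {x. s_inflation K x} \<and> weq u \<and> Cod K u = Dom K t \<and> Cod K t = Dom K v \<and> f = v \<cdot> (t \<cdot> u)"
    proof (rule arr_inflation[OF f])
      fix p x assume "s_inflation K x" "x \<in> Arr K" "weq p" "Dom K x = Dom K f" "Cod K x = Dom K p" "p \<cdot> x = f"
      then show ?thesis using f
        by - (rule exI[of _ p], rule exI[of _ x], rule exI[of _ "Id K (Dom K x)"], simp add: weq_Id)
    qed
  qed
  moreover have "sandwich Q W (pr ` {y. s_deflation K y}) = Arr Q"
  proof (rule sandwich_eq_Arr[OF sub(2)])
    fix f assume f: "f \<in> Arr K"
    show "\<exists>v t u. weq v \<and> t \<in> {y. s_deflation K y} \<and> weq u \<and> Cod K u = Dom K t \<and> Cod K t = Dom K v \<and> f = v \<cdot> (t \<cdot> u)"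
    proof (rule arr_deflation[OF f])
      fix i y assume "s_deflation K y" "y \<in> Arr K" "weq i" "Cod K y = Cod K f" "Dom K y = Cod K i" "y \<cdot> i = f"
      then show ?thesis using f weqD(1)[of i]
        by - (rule exI[of _ "Id K (Cod K y)"], rule exI[of _ y], rule exI[of _ i], simp add: weq_Id)
    qed
  qed
  ultimately show "closed_under_comp Q (sandwich Q W (pr ` {x. s_inflation K x}))"
    "closed_under_comp Q (sandwich Q W (pr ` {y. s_deflation K y}))"
    by (simp_all add: closed_under_comp_Arr)
qed

lemma W_middle:
  assumes t: "s_triangle K x y \<delta>" "x \<in> Mor K A B" "y \<in> Mor K B C"
    and t': "s_triangle K x' y' \<delta>'" "x' \<in> Mor K A' B'" "y' \<in> Mor K B' C'"
    and a: "a \<in> Mor K A A'" "pr a \<in> W" and c: "c \<in> Mor K C C'" "pr c \<in> W"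
    and e: "push K C a \<delta> = pull K c A' \<delta>'"
  shows "\<exists>b \<in> W \<inter> Mor Q B B'. b \<cdot>\<^bsub>Q\<^esub> pr x = pr x' \<cdot>\<^bsub>Q\<^esub> pr a \<and> pr c \<cdot>\<^bsub>Q\<^esub> pr y = pr y' \<cdot>\<^bsub>Q\<^esub> b"
proof -
  have m [simp]: "x \<in> Arr K" "Dom K x = A" "Cod K x = B" "y \<in> Arr K" "Dom K y = B" "Cod K y = C"
    "x' \<in> Arr K" "Dom K x' = A'" "Cod K x' = B'" "y' \<in> Arr K" "Dom K y' = B'" "Cod K y' = C'"
    "a \<in> Arr K" "Dom K a = A" "Cod K a = A'" "c \<in> Arr K" "Dom K c = C" "Cod K c = C'"
    using t t' a c by (simp_all add: Mor_iff)
  have w: "weq a" "weq c" using a c by (simp_all add: pr_W)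
  obtain b where b: "weq b" "Dom K b = B" "Cod K b = B'" and s: "b \<cdot> x = x' \<cdot> a" "y' \<cdot> b = c \<cdot> y"
    using weq_middle[OF t(1) t'(1) w(1) _ _ w(2)] e by auto
  have [simp]: "b \<in> Arr K" by (rule weqD(1)[OF b(1)])
  have "pr b \<in> W \<inter> Mor Q B B'" using b by (auto simp: pr_W Mor_Q Mor_iff)
  then show ?thesis using s b by (intro bexI[of _ "pr b"]) simp_all
qed

end

theorem proposition4p26:
  fixes K :: "('o, 'm, 'e) extri_category" and N :: "'o set"
  assumes "extriangulated_category K" and "biresolving K N"
  shows "let S = thick_morphisms K N; Q = bar_category K S; W = bar_morphisms K S in
    two_out_of_three Q W \<and>
    multiplicative_system Q W \<and>
    (\<forall>A B C x y \<delta> A' B' C' x' y' \<delta>'.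
      s_triangle K x y \<delta> \<and> x \<in> Mor K A B \<and> y \<in> Mor K B C \<and>
      s_triangle K x' y' \<delta>' \<and> x' \<in> Mor K A' B' \<and> y' \<in> Mor K B' C' \<longrightarrow>
      (\<forall>a \<in> Mor K A A'. \<forall>c \<in> Mor K C C'.
        push K C a \<delta> = pull K c A' \<delta>' \<and> bar K S a \<in> W \<and> bar K S c \<in> W \<longrightarrow>
        (\<exists>b \<in> W \<inter> Mor Q B B'.
          b \<cdot>\<^bsub>Q\<^esub> bar K S x = bar K S x' \<cdot>\<^bsub>Q\<^esub> bar K S a \<and>
          bar K S c \<cdot>\<^bsub>Q\<^esub> bar K S y = bar K S y' \<cdot>\<^bsub>Q\<^esub> b))) \<and>
    closed_under_comp Q (sandwich Q W (bar K S ` {x. s_inflation K x})) \<and>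
    closed_under_comp Q (sandwich Q W (bar K S ` {y. s_deflation K y})) \<and>
    W = {f \<in> Arr Q. is_mono Q f \<and> is_epi Q f}"
proof -
  interpret biresolving_subcategory K N
    using assms by (simp add: biresolving_subcategory_def biresolving_subcategory_axioms_def)
  have bar: "bar K S = pr" by (rule ext) (rule bar_eq(2))
  show ?thesis unfolding Let_def bar_eq(1) bar
  proof (intro conjI allI impI ballI; (elim conjE)?)
    show "two_out_of_three Q W" by (rule two_out_of_three_W)
    show "multiplicative_system Q W" by (rule multiplicative_system_W)
    show "closed_under_comp Q (sandwich Q W (pr ` {x. s_inflation K x}))"
      "closed_under_comp Q (sandwich Q W (pr ` {y. s_deflation K y}))"
      by (rule closed_under_comp_sandwich)+
    show "W = {f \<in> Arr Q. is_mono Q f \<and> is_epi Q f}" by (rule W_eq_mono_epi)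
  qed (rule W_middle)
qed

end
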